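(* There is a fixed $\varepsilon>0$ such that the following holds. Let $n=2k+1$ and $p>1-\varepsilon$, and let $\mathcal{H}_k(n,p)$ be the random $k$-graph on vertex set $[n]=\{1,\dots,n\}$ in which each $k$-subset of $[n]$ is an edge independently with probability $p$. Then, with probability tending to $1$ as $k\to\infty$, $\mathcal{H}_k(n,p)$ satisfies (strong) EKR, i.e. every largest intersecting subfamily of $\mathcal{H}_k(n,p)$ is a star $\{A\in\mathcal{H}_k(n,p): x\in A\}$ for some $x\in[n]$.
   Context: A family of sets is intersecting (a clique) if no two of its members are disjoint. For a $k$-graph $\mathcal{H}$ and a vertex $x$, the star of $x$ in $\mathcal{H}$ is $\mathcal{H}_x=\{A\in\mathcal{H}:x\in A\}$. $\mathcal{H}$ satisfies (strong) EKR if every clique of $\mathcal{H}$ of maximum size is a star of $\mathcal{H}$. *)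

theory Defs
  imports "HOL-Probability.Probability" "HOL-Probability.Product_PMF" "HOL-Library.Ramsey"
begin

definition intersecting :: "'a set set \<Rightarrow> bool" where
  "intersecting F \<longleftrightarrow> pairwise (\<lambda>A B. \<not> disjnt A B) F"

definition star :: "'a set set \<Rightarrow> 'a \<Rightarrow> 'a set set" where
  "star H x = {A \<in> H. x \<in> A}"

text \<open>Cardinality is compared with \<^const>\<open>card\<close>, so this is meant for finite hypergraphs.\<close>

definition max_clique :: "'a set set \<Rightarrow> 'a set set \<Rightarrow> bool" where
  "max_clique H F \<longleftrightarrow> F \<subseteq> H \<and> intersecting F \<and> (\<forall>G. G \<subseteq> H \<and> intersecting G \<longrightarrow> card G \<le> card F)"

text \<open>The vertex set \<open>V\<close> is explicit because a hypergraph may have isolated vertices.\<close>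

definition strong_EKR :: "'a set \<Rightarrow> 'a set set \<Rightarrow> bool" where
  "strong_EKR V H \<longleftrightarrow> (\<forall>F. max_clique H F \<longrightarrow> (\<exists>x\<in>V. F = star H x))"

text \<open>One independent Bernoulli coin per \<open>k\<close>-subset of \<open>{1..n}\<close>; the edges are the subsets
  whose coin shows \<^const>\<open>True\<close>.\<close>

definition random_kgraph :: "nat \<Rightarrow> nat \<Rightarrow> real \<Rightarrow> nat set set pmf" where
  "random_kgraph k n p =
     map_pmf (\<lambda>\<omega>. {A \<in> nsets {1..n} k. \<omega> A})
       (Pi_pmf (nsets {1..n} k) False (\<lambda>_. bernoulli_pmf p))"

end

theory Submission imports Defs begin

text \<open>
  With high probability every vertex of the Kneser graph on the \<open>k\<close>-subsets of \<open>V\<close> has at most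
  \<open>\<eta> k\<close> neighbours outside \<open>H\<close>, and the Kneser edges inside \<open>H\<close> carry weights \<open>1 + \<phi> A + \<phi> B\<close> close to
  1 for which all weighted degrees agree up to \<open>O(\<eta>)\<close>. Here \<open>\<phi>\<close> is a Neumann series for the inverse of the signless
  Laplacian of the Kneser graph on \<open>H\<close>, cut off after three terms; the error is an average of degree
  defects at the ends of walks of length three, and it is small because those defects are governed by fresh coins, at distance
  four, to which a bounded differences inequality applies.

  For a maximum intersecting family \<open>F\<close> the weights bound the number of disjoint pairs in \<open>H - F\<close>.
  Filling in the missing \<open>k\<close>-sets by majority vote costs only a factor \<open>1 + O(\<eta>)\<close>, since a mismatched edge at a missing
  vertex lies on about \<open>k\<^sup>2\<close> hexagons that contain a mismatched edge inside \<open>H\<close>, whereas few hexagons at an edge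
  inside \<open>H\<close> meet a missing vertex. So the filled family has nearly minimal boundary in the Johnson
  graph. A spectral inequality then places its indicator close to level one, and since an indicator has derivatives
  in \<open>{-1, 0, 1}\<close>, comparing their first and second moments forces a single coordinate to carry it: \<open>F\<close> is close to a star.

  If \<open>F\<close> is close to the star of \<open>x\<close> without being contained in it, the same counting for the sets of \<open>F\<close> that avoid \<open>x\<close> against the sets of the star outside \<open>F\<close>
  yields a small family avoiding \<open>x\<close> whose boundary violates the Poincare inequality on \<open>V - {x}\<close>.
\<close>

section \<open>Exchange energy on the slices of the cube\<close>


text \<open>The lengths and errors are set by a union bound. Comparing \<open>H - F\<close> with
  \<open>F\<close> subtracts two weighted counts of size about k M, and the remainder to be
  controlled is about M / 2, so weighted degrees may deviate only by O(\<eta>), not by \<eta> k. The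
  residual of the weights must therefore be O(\<eta> / k) at each of roughly 4^k centres at once. A
  residual that depends on coins at distance d is a function of about k^d coins of influence about
  k^(-d) each, and bounded differences at deviation \<eta> / k fails with probability about exp(- c
  \<eta>^2 k^(d - 2)). For small fixed \<eta> this beats 4^k only from d = 4 on, hence walks of
  length three. All errors are measured by the one parameter \<eta>; afterwards 1 - p is chosen so
  small in terms of \<eta> that losing more than \<eta> k neighbours is unlikely even for a single
  vertex among all. The value 10^(-8) comes from the averaging over rows in
  \<open>near_star_of_low_energy\<close>.\<close>

lemma nsetsD: "A \<in> nsets V k \<Longrightarrow> A \<subseteq> V" "A \<in> nsets V k \<Longrightarrow> finite A" "A \<in> nsets V k \<Longrightarrow> card A = k"
  by (auto simp: nsets_def)

lemma nsets_insertI: "S \<in> nsets V j \<Longrightarrow> a \<in> V - S \<Longrightarrow> insert a S \<in> nsets V (Suc j)"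
  by (auto simp: nsets_def)

lemma nsets_removeI: "A \<in> nsets V (Suc j) \<Longrightarrow> a \<in> A \<Longrightarrow> A - {a} \<in> nsets V j"
  by (auto simp: nsets_def)

lemma real_card_Diff_nsets:
  assumes "finite V" "S \<in> nsets V j"
  shows "real (card (V - S)) = real (card V) - real j"
  using assms card_mono[of V S] by (auto simp: card_Diff_subset nsets_def of_nat_diff)

text \<open>Inclusions between adjacent levels are indexed by the lower set and an added point, or
  by the upper set and a removed point. The double counts between adjacent levels below rest on
  this.\<close>

lemma sum_nsets_Suc:
  fixes G :: "'a set \<Rightarrow> 'a \<Rightarrow> 'b::comm_monoid_add"
  assumes fin: "finite V"
  shows "(\<Sum>S\<in>nsets V j. \<Sum>a\<in>V-S. G S a) = (\<Sum>A\<in>nsets V (Suc j). \<Sum>a\<in>A. G (A - {a}) a)"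
proof -
  have f: "finite (nsets V j)" "finite (nsets V (Suc j))" using fin by (auto intro: finite_imp_finite_nsets)
  have "(\<Sum>S\<in>nsets V j. \<Sum>a\<in>V-S. G S a) = (\<Sum>(S,a)\<in>Sigma (nsets V j) (\<lambda>S. V-S). G S a)"
    using f fin by (intro sum.Sigma) auto
  also have "\<dots> = (\<Sum>(A,a)\<in>Sigma (nsets V (Suc j)) (\<lambda>A. A). G (A-{a}) a)"
    by (rule sum.reindex_bij_witness[where i="\<lambda>(A,a). (A-{a},a)" and j="\<lambda>(S,a). (insert a S,a)"])
       (auto simp: insert_absorb nsetsD intro!: nsets_insertI nsets_removeI dest: nsetsD(1))
  also have "\<dots> = (\<Sum>A\<in>nsets V (Suc j). \<Sum>a\<in>A. G (A - {a}) a)"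
    using f by (intro sum.Sigma[symmetric]) (auto dest: nsetsD)
  finally show ?thesis .
qed

text \<open>Two sets at Johnson distance one have a common lower set and a common upper set. With
  \<open>T = insert a (insert b S)\<close>, the set \<open>insert a S\<close> is
  \<open>T - {b}\<close>, which is why the witness interchanges the two points.\<close>

lemma sum_nsets_exchange:
  fixes \<Phi> :: "'a set \<Rightarrow> 'a set \<Rightarrow> 'b::comm_monoid_add"
  assumes fin: "finite V"
  shows "(\<Sum>S\<in>nsets V j. \<Sum>a\<in>V-S. \<Sum>b\<in>V-S-{a}. \<Phi> (insert a S) (insert b S))
       = (\<Sum>T\<in>nsets V (Suc (Suc j)). \<Sum>a\<in>T. \<Sum>b\<in>T-{a}. \<Phi> (T-{a}) (T-{b}))"
proof -
  have f: "finite (nsets V i)" for i using fin by (auto intro: finite_imp_finite_nsets)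
  have "(\<Sum>S\<in>nsets V j. \<Sum>a\<in>V-S. \<Sum>b\<in>V-S-{a}. \<Phi> (insert a S) (insert b S))
     = (\<Sum>S\<in>nsets V j. \<Sum>(a,b)\<in>Sigma (V-S) (\<lambda>a. V-S-{a}). \<Phi> (insert a S) (insert b S))"
    using fin by (intro sum.cong refl sum.Sigma) auto
  also have "\<dots> = (\<Sum>(S,(a,b))\<in>Sigma (nsets V j) (\<lambda>S. Sigma (V-S) (\<lambda>a. V-S-{a})). \<Phi> (insert a S) (insert b S))"
    using f fin by (subst sum.Sigma) (auto intro!: sum.cong)
  also have "\<dots> = (\<Sum>(T,(a,b))\<in>Sigma (nsets V (Suc (Suc j))) (\<lambda>T. Sigma T (\<lambda>a. T-{a})). \<Phi> (T-{a}) (T-{b}))"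
  proof (rule sum.reindex_bij_witness[where i="\<lambda>(T,(a,b)). (T-{a,b},(b,a))" and j="\<lambda>(S,(a,b)). (insert a (insert b S),(b,a))"], goal_cases)
    case (1 x) then show ?case by (auto simp: nsets_def)
  next
    case (2 x) then show ?case by (auto simp: nsets_def)
  next
    case (3 x) then show ?case by (auto simp: nsets_def)
  next
    case (4 x) then show ?case by (auto simp: nsets_def card_Diff_singleton card_Diff_subset)
  next
    case (5 x)
    obtain S a b where x: "x = (S,a,b)" by (cases x) auto
    with 5 have *: "a \<notin> S" "b \<notin> S" "a \<noteq> b" by auto
    have "insert a (insert b S) - {b} = insert a S" "insert a (insert b S) - {a} = insert b S"
      using * by auto
    then show ?case by (simp add: x)
  qed
  also have "\<dots> = (\<Sum>T\<in>nsets V (Suc (Suc j)). \<Sum>(a,b)\<in>Sigma T (\<lambda>a. T-{a}). \<Phi> (T-{a}) (T-{b}))"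
    using f fin by (subst sum.Sigma) (auto intro!: sum.cong dest: nsetsD)
  also have "\<dots> = (\<Sum>T\<in>nsets V (Suc (Suc j)). \<Sum>a\<in>T. \<Sum>b\<in>T-{a}. \<Phi> (T-{a}) (T-{b}))"
    by (intro sum.cong refl sum.Sigma[symmetric]) (auto dest: nsetsD)
  finally show ?thesis .
qed

section \<open>Up and down operators, and the spectral gap of the Johnson graph\<close>

definition down :: "'a set \<Rightarrow> ('a set \<Rightarrow> real) \<Rightarrow> 'a set \<Rightarrow> real" where
  "down V f S = (\<Sum>a\<in>V-S. f (insert a S))"

definition up :: "('a set \<Rightarrow> real) \<Rightarrow> 'a set \<Rightarrow> real" where
  "up g A = (\<Sum>a\<in>A. g (A - {a}))"

definition sqn :: "'a set \<Rightarrow> nat \<Rightarrow> ('a set \<Rightarrow> real) \<Rightarrow> real" where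
  "sqn V j f = (\<Sum>A\<in>nsets V j. (f A)\<^sup>2)"

text \<open>The Dirichlet form of the Johnson graph over ordered pairs: \<open>S\<close> is the
  intersection of the two sets, so each pair counts once, and terms with \<open>a = b\<close>
  vanish. For an indicator this is twice the edge boundary.\<close>

definition exch_energy :: "'a set \<Rightarrow> nat \<Rightarrow> ('a set \<Rightarrow> real) \<Rightarrow> real" where
  "exch_energy V k f =
     (\<Sum>S\<in>nsets V (k - 1). \<Sum>a\<in>V-S. \<Sum>b\<in>V-S. (f (insert a S) - f (insert b S))\<^sup>2)"

lemma sqn_nonneg: "sqn V j f \<ge> 0"
  by (auto simp: sqn_def intro: sum_nonneg)

lemma sum_times_diag:
  fixes c :: "'b \<Rightarrow> real"
  assumes "finite X"
  shows "(\<Sum>a\<in>X. c a)\<^sup>2 = (\<Sum>a\<in>X. (c a)\<^sup>2 + (\<Sum>b\<in>X-{a}. c a * c b))"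
proof -
  have "(\<Sum>a\<in>X. c a)\<^sup>2 = (\<Sum>a\<in>X. \<Sum>b\<in>X. c a * c b)"
    by (simp add: power2_eq_square sum_product)
  also have "\<dots> = (\<Sum>a\<in>X. (c a)\<^sup>2 + (\<Sum>b\<in>X-{a}. c a * c b))"
    using assms by (intro sum.cong refl) (auto simp: sum.remove power2_eq_square)
  finally show ?thesis .
qed

lemma sum_remove_one:
  assumes fin: "finite V"
  shows "(\<Sum>A\<in>nsets V (Suc j). \<Sum>a\<in>A. (f (A - {a}))) = (real (card V) - real j) * (\<Sum>S\<in>nsets V j. f S :: real)"
proof -
  have "(\<Sum>A\<in>nsets V (Suc j). \<Sum>a\<in>A. f (A - {a})) = (\<Sum>S\<in>nsets V j. \<Sum>a\<in>V-S. f S)"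
    by (rule sum_nsets_Suc[OF fin, symmetric])
  also have "\<dots> = (\<Sum>S\<in>nsets V j. (real (card V) - real j) * f S)"
    using fin by (intro sum.cong refl) (auto simp: real_card_Diff_nsets)
  finally show ?thesis by (simp add: sum_distrib_left)
qed

lemma sum_insert_one:
  assumes fin: "finite V"
  shows "(\<Sum>S\<in>nsets V j. \<Sum>a\<in>V-S. f (insert a S)) = real (Suc j) * (\<Sum>A\<in>nsets V (Suc j). f A :: real)"
proof -
  have "(\<Sum>S\<in>nsets V j. \<Sum>a\<in>V-S. f (insert a S)) = (\<Sum>A\<in>nsets V (Suc j). \<Sum>a\<in>A. f (insert a (A-{a})))"
    by (rule sum_nsets_Suc[OF fin])
  also have "\<dots> = (\<Sum>A\<in>nsets V (Suc j). real (Suc j) * f A)"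
    by (intro sum.cong refl) (auto simp: insert_absorb nsetsD)
  finally show ?thesis by (simp add: sum_distrib_left)
qed

text \<open>The commutation relation of \<open>up\<close> and \<open>down\<close> as a quadratic
  form. The off-diagonal parts of the two squares agree by \<open>sum_nsets_exchange\<close>; the
  diagonal parts differ by the number of supersets minus the number of subsets of a set.\<close>

lemma sqn_up:
  assumes fin: "finite V"
  shows "sqn V (Suc (Suc j)) (up g) = sqn V j (down V g) + (real (card V) - 2 * real (Suc j)) * sqn V (Suc j) g"
proof -
  have "sqn V (Suc (Suc j)) (up g) = (\<Sum>T\<in>nsets V (Suc (Suc j)). \<Sum>a\<in>T. (g (T - {a}))\<^sup>2)
     + (\<Sum>T\<in>nsets V (Suc (Suc j)). \<Sum>a\<in>T. \<Sum>b\<in>T-{a}. g (T-{a}) * g (T-{b}))"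
    unfolding sqn_def up_def sum.distrib[symmetric]
    by (intro sum.cong refl sum_times_diag) (auto dest: nsetsD)
  moreover have "sqn V j (down V g) = (\<Sum>S\<in>nsets V j. \<Sum>a\<in>V-S. (g (insert a S))\<^sup>2)
     + (\<Sum>S\<in>nsets V j. \<Sum>a\<in>V-S. \<Sum>b\<in>V-S-{a}. g (insert a S) * g (insert b S))"
    unfolding sqn_def down_def sum.distrib[symmetric]
    using fin by (intro sum.cong refl sum_times_diag) auto
  ultimately show ?thesis
    using sum_remove_one[OF fin, of "\<lambda>A. (g A)\<^sup>2" "Suc j"] sum_insert_one[OF fin, of "\<lambda>A. (g A)\<^sup>2" j]
      sum_nsets_exchange[OF fin, of "\<lambda>A B. g A * g B" j]
    by (simp add: sqn_def algebra_simps)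
qed

lemma up_adjoint:
  assumes fin: "finite V"
  shows "(\<Sum>A\<in>nsets V (Suc j). f A * up g A) = (\<Sum>S\<in>nsets V j. down V f S * g S)"
proof -
  have "(\<Sum>S\<in>nsets V j. down V f S * g S) = (\<Sum>S\<in>nsets V j. \<Sum>a\<in>V-S. f (insert a S) * g S)"
    by (simp add: down_def sum_distrib_right)
  also have "\<dots> = (\<Sum>A\<in>nsets V (Suc j). \<Sum>a\<in>A. f (insert a (A-{a})) * g (A-{a}))"
    by (rule sum_nsets_Suc[OF fin])
  also have "\<dots> = (\<Sum>A\<in>nsets V (Suc j). f A * up g A)"
    by (intro sum.cong refl) (auto simp: up_def sum_distrib_left insert_absorb intro!: sum.cong)
  finally show ?thesis by simp
qed

text \<open>Each \<open>A\<close> above \<open>S\<close> arises from as many \<open>B\<close> as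
  there are points of \<open>A - S\<close> to drop. The consequence that matters:
  \<open>down\<close> preserves the vanishing of all sums over the supersets of an
  \<open>i\<close>-set, so the induction in \<open>sqn_down_le\<close> can descend.\<close>

lemma down_link_sum:
  assumes fin: "finite V" and S: "S \<in> nsets V i"
  shows "(\<Sum>B\<in>{B\<in>nsets V j. S \<subseteq> B}. down V f B) = (real (Suc j) - real i) * (\<Sum>A\<in>{A\<in>nsets V (Suc j). S \<subseteq> A}. f A)"
proof -
  have f: "finite (nsets V i)" for i using fin by (auto intro: finite_imp_finite_nsets)
  have "(\<Sum>B\<in>{B\<in>nsets V j. S \<subseteq> B}. down V f B) = (\<Sum>B\<in>nsets V j. \<Sum>a\<in>V-B. if S \<subseteq> B then f (insert a B) else 0)"
    using f by (subst sum.inter_filter) (auto simp: down_def intro!: sum.cong)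
  also have "\<dots> = (\<Sum>A\<in>nsets V (Suc j). \<Sum>a\<in>A. if S \<subseteq> A-{a} then f (insert a (A-{a})) else 0)"
    by (rule sum_nsets_Suc[OF fin])
  also have "\<dots> = (\<Sum>A\<in>nsets V (Suc j). if S \<subseteq> A then (real (Suc j) - real i) * f A else 0)"
  proof (intro sum.cong refl)
    fix A assume A: "A \<in> nsets V (Suc j)"
    have "(\<Sum>a\<in>A. if S \<subseteq> A-{a} then f (insert a (A-{a})) else 0) = (\<Sum>a\<in>A. if S \<subseteq> A \<and> a \<notin> S then f A else 0)"
      by (intro sum.cong refl) (auto simp: insert_absorb)
    also have "\<dots> = (if S \<subseteq> A then (\<Sum>a\<in>A-S. f A) else 0)"
      using A by (auto simp: sum.If_cases set_diff_eq Int_def nsetsD)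
    also have "\<dots> = (if S \<subseteq> A then (real (Suc j) - real i) * f A else 0)"
      using A S by (auto simp: card_Diff_subset nsetsD of_nat_diff dest!: card_mono[rotated])
    finally show "(\<Sum>a\<in>A. if S \<subseteq> A-{a} then f (insert a (A-{a})) else 0) = (if S \<subseteq> A then (real (Suc j) - real i) * f A else 0)" .
  qed
  also have "\<dots> = (real (Suc j) - real i) * (\<Sum>A\<in>{A\<in>nsets V (Suc j). S \<subseteq> A}. f A)"
    using f by (subst sum.inter_filter) (auto simp: sum_distrib_left intro!: sum.cong)
  finally show ?thesis .
qed

text \<open>The hypothesis says that \<open>f\<close> is orthogonal to all functions of degree at
  most \<open>i\<close>, and the factor is the eigenvalue of \<open>up\<close> after
  \<open>down\<close> in degree \<open>i + 1\<close>, the largest that remains. No eigenspaces are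
  needed: with X the squared norm of \<open>down V f\<close>, Cauchy-Schwarz for X = <f, up (down
  f)> together with \<open>sqn_up\<close> and the bound one level lower gives X^2 <= const *
  X.\<close>

lemma sqn_down_le:
  assumes fin: "finite V" and "2 * i + m + 1 \<le> card V"
    and "\<And>S. S \<in> nsets V i \<Longrightarrow> (\<Sum>A\<in>{A\<in>nsets V (Suc i + m). S \<subseteq> A}. f A) = 0"
  shows "sqn V (i + m) (down V f) \<le> real m * (real (card V) - 2 * real i - real m - 1) * sqn V (Suc i + m) f"
  using assms(2,3)
proof (induction m arbitrary: f)
  case 0
  have "down V f S = 0" if S: "S \<in> nsets V i" for S
  proof -
    have "down V f S = (\<Sum>B\<in>{B\<in>nsets V i. S \<subseteq> B}. down V f B)"
    proof -
      have "{B\<in>nsets V i. S \<subseteq> B} = {S}"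
        using S card_subset_eq unfolding nsets_def by blast
      then show ?thesis by simp
    qed
    also have "\<dots> = 0" using down_link_sum[OF fin S, where f=f and j=i] 0(2)[OF S] by simp
    finally show ?thesis .
  qed
  then show ?case by (simp add: sqn_def)
next
  case (Suc m)
  let ?g = "down V f" and ?n = "real (card V)"
  define X where "X = sqn V (Suc i + m) ?g"
  define lam where "lam = real (Suc m) * (?n - 2 * real i - real (Suc m) - 1)"
  have lam: "lam \<ge> 0" using Suc.prems(1) unfolding lam_def by (intro mult_nonneg_nonneg) auto
  have IH: "sqn V (i + m) (down V ?g) \<le> real m * (?n - 2 * real i - real m - 1) * X"
    unfolding X_def using Suc.prems(1)
    by (intro Suc.IH) (use Suc.prems(2) down_link_sum[OF fin] in auto)
  have "sqn V (Suc (Suc (i+m))) (up ?g) = sqn V (i+m) (down V ?g) + (?n - 2 * real (Suc (i+m))) * X"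
    using sqn_up[OF fin, of "i+m" ?g] by (simp add: X_def)
  also have "\<dots> \<le> lam * X"
    using IH by (simp add: lam_def algebra_simps)
  finally have up: "sqn V (Suc (Suc (i+m))) (up ?g) \<le> lam * X" .
  have "X = (\<Sum>A\<in>nsets V (Suc (Suc (i+m))). f A * up ?g A)"
    using up_adjoint[OF fin, where j="Suc (i+m)" and f=f and g="?g"] by (simp add: X_def sqn_def power2_eq_square)
  then have "X\<^sup>2 \<le> sqn V (Suc (Suc (i+m))) f * sqn V (Suc (Suc (i+m))) (up ?g)"
    unfolding sqn_def by (simp add: Cauchy_Schwarz_ineq_sum)
  also have "\<dots> \<le> sqn V (Suc (Suc (i+m))) f * (lam * X)"
    by (intro mult_left_mono up sqn_nonneg)
  finally have *: "X * X \<le> (lam * sqn V (Suc (Suc (i+m))) f) * X" by (simp add: power2_eq_square algebra_simps)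
  have "X \<le> lam * sqn V (Suc (Suc (i+m))) f"
  proof (cases "X > 0")
    case True then show ?thesis using * by (simp add: mult_le_cancel_right)
  next
    case False
    then show ?thesis using lam sqn_nonneg[of V "Suc (Suc (i+m))" f] by (smt (verit) mult_nonneg_nonneg)
  qed
  then show ?case by (simp add: X_def lam_def)
qed

lemma exch_energy_eq:
  assumes fin: "finite V" and k: "k = Suc j" "k \<le> card V"
  shows "exch_energy V k f = 2 * (real (card V) - real j) * real k * sqn V k f - 2 * sqn V j (down V f)"
proof -
  have "exch_energy V k f = (\<Sum>S\<in>nsets V j. 2 * (real (card V) - real j) * (\<Sum>a\<in>V-S. (f (insert a S))\<^sup>2) - 2 * (down V f S)\<^sup>2)"
    unfolding exch_energy_def k diff_Suc_1
  proof (intro sum.cong refl)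
    fix S assume S: "S \<in> nsets V j"
    let ?X = "V - S" and ?c = "\<lambda>a. f (insert a S)"
    have fX: "finite ?X" using fin by auto
    have c: "real (card ?X) = real (card V) - real j"
      using S fin by (rule real_card_Diff_nsets[rotated])
    have "(\<Sum>a\<in>?X. \<Sum>b\<in>?X. (?c a - ?c b)\<^sup>2) = (\<Sum>a\<in>?X. \<Sum>b\<in>?X. (?c a)\<^sup>2 + (?c b)\<^sup>2 - 2 * (?c a * ?c b))"
      by (simp add: power2_diff algebra_simps)
    also have "\<dots> = 2 * real (card ?X) * (\<Sum>a\<in>?X. (?c a)\<^sup>2) - 2 * (\<Sum>a\<in>?X. ?c a)\<^sup>2"
      by (simp add: sum.distrib sum_subtractf sum_distrib_left power2_eq_square sum_product algebra_simps)
    finally show "(\<Sum>a\<in>?X. \<Sum>b\<in>?X. (?c a - ?c b)\<^sup>2)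
      = 2 * (real (card V) - real j) * (\<Sum>a\<in>?X. (?c a)\<^sup>2) - 2 * (down V f S)\<^sup>2"
      by (simp add: c down_def)
  qed
  also have "\<dots> = 2 * (real (card V) - real j) * real k * sqn V k f - 2 * sqn V j (down V f)"
    using sum_insert_one[OF fin, of "\<lambda>A. (f A)\<^sup>2" j]
    by (simp add: sum_subtractf sum_distrib_left[symmetric] sqn_def k)
  finally show ?thesis .
qed


lemma poincare_exch:
  assumes fin: "finite V" and k: "0 < k" "k + 1 \<le> card V" and sum0: "(\<Sum>A\<in>nsets V k. f A) = 0"
  shows "exch_energy V k f \<ge> 2 * real (card V) * sqn V k f"
proof -
  obtain j where j: "k = Suc j" using k by (cases k) auto
  have "sqn V (0 + j) (down V f) \<le> real j * (real (card V) - 2 * real 0 - real j - 1) * sqn V (Suc 0 + j) f"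
    by (rule sqn_down_le[OF fin]) (use k j sum0 in \<open>auto simp: nsets_def\<close>)
  then show ?thesis using k by (subst exch_energy_eq[OF fin j]) (auto simp: j algebra_simps)
qed

lemma exch_energy_shift: "exch_energy V k (\<lambda>A. f A - c) = exch_energy V k f"
  by (simp add: exch_energy_def)

text \<open>The Poincare inequality for the centred indicator, whose squared norm is |J| (1 - |J| /
  M) with M the number of \<open>k\<close>-sets. Multiplying through by M avoids the
  division.\<close>

lemma poincare_exch_indicator:
  assumes fin: "finite V" and k: "0 < k" "k + 1 \<le> card V" and J: "J \<subseteq> nsets V k"
  shows "exch_energy V k (\<lambda>A. of_bool (A \<in> J)) * real (card V choose k)
     \<ge> 2 * real (card V) * real (card J) * (real (card V choose k) - real (card J))"
proof -
  let ?M = "real (card V choose k)" and ?f = "\<lambda>A. of_bool (A \<in> J) :: real"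
  have M: "?M > 0" "card (nsets V k) = card V choose k" using k by (auto simp: card_nsets)
  have fn: "finite (nsets V k)" using fin by (rule finite_imp_finite_nsets)
  define c where "c = real (card J) / ?M"
  have s1: "(\<Sum>A\<in>nsets V k. ?f A) = real (card J)"
    using J fn by (simp add: Int_absorb1)
  have "(\<Sum>A\<in>nsets V k. ?f A - c) = 0"
    using M by (simp add: sum_subtractf s1 c_def del: sum_of_bool_eq)
  then have "exch_energy V k (\<lambda>A. ?f A - c) \<ge> 2 * real (card V) * sqn V k (\<lambda>A. ?f A - c)"
    by (rule poincare_exch[OF fin k])
  moreover have "sqn V k (\<lambda>A. ?f A - c) = real (card J) * (1 - 2 * c) + ?M * c\<^sup>2"
  proof -
    have "sqn V k (\<lambda>A. ?f A - c) = (\<Sum>A\<in>nsets V k. ?f A * (1 - 2 * c) + c\<^sup>2)"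
      unfolding sqn_def by (intro sum.cong refl) (auto simp: power2_eq_square algebra_simps)
    then show ?thesis by (simp add: sum.distrib sum_distrib_right[symmetric] s1 M del: sum_of_bool_eq)
  qed
  ultimately have "exch_energy V k ?f \<ge> 2 * real (card V) * (real (card J) * (1 - 2 * c) + ?M * c\<^sup>2)"
    by (simp add: exch_energy_shift)
  then have "exch_energy V k ?f * ?M \<ge> 2 * real (card V) * (real (card J) * (1 - 2 * c) + ?M * c\<^sup>2) * ?M"
    using M by (intro mult_right_mono) auto
  also have "2 * real (card V) * (real (card J) * (1 - 2 * c) + ?M * c\<^sup>2) * ?M
     = 2 * real (card V) * real (card J) * (?M - real (card J))"
    using M(1) unfolding c_def by (simp add: power2_eq_square field_simps)
  finally show ?thesis .
qed

lemma exch_energy_upper_form: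
  assumes fin: "finite V" and k: "k > 0"
  shows "exch_energy V k f = (\<Sum>T\<in>nsets V (Suc k). \<Sum>a\<in>T. \<Sum>b\<in>T. (f (T-{a}) - f (T-{b}))\<^sup>2)"
proof -
  obtain j where j: "k = Suc j" using k by (cases k) auto
  have 1: "(\<Sum>b\<in>X. (g a - g b)\<^sup>2) = (\<Sum>b\<in>X-{a}. (g a - g b)\<^sup>2)" if "finite X" "a \<in> X" for X a and g :: "'a \<Rightarrow> real"
    using that by (simp add: sum.remove)
  have "exch_energy V k f = (\<Sum>S\<in>nsets V j. \<Sum>a\<in>V-S. \<Sum>b\<in>V-S-{a}. (f (insert a S) - f (insert b S))\<^sup>2)"
    unfolding exch_energy_def j diff_Suc_1
    using fin by (intro sum.cong refl 1[of _ _ "\<lambda>a. f (insert a _)"]) auto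
  also have "\<dots> = (\<Sum>T\<in>nsets V (Suc k). \<Sum>a\<in>T. \<Sum>b\<in>T-{a}. (f (T-{a}) - f (T-{b}))\<^sup>2)"
    unfolding j by (rule sum_nsets_exchange[OF fin, where \<Phi>="\<lambda>A B. (f A - f B)\<^sup>2"])
  also have "\<dots> = (\<Sum>T\<in>nsets V (Suc k). \<Sum>a\<in>T. \<Sum>b\<in>T. (f (T-{a}) - f (T-{b}))\<^sup>2)"
    by (intro sum.cong refl 1[symmetric, of _ _ "\<lambda>a. f (_ - {a})"]) (auto dest: nsetsD)
  finally show ?thesis .
qed

text \<open>The minority of two labels inside \<open>T\<close> is at most the number of labels that differ from \<open>l T\<close>.\<close>

lemma exch_energy_le_mismatch:
  assumes fin: "finite V" and k: "k > 0"
  shows "exch_energy V k (\<lambda>A. of_bool (l A))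
    \<le> 2 * real (Suc k) * (\<Sum>T\<in>nsets V (Suc k). real (card {a\<in>T. l (T - {a}) \<noteq> l T}))"
  unfolding exch_energy_upper_form[OF fin k] sum_distrib_left
proof (intro sum_mono)
  fix T assume T: "T \<in> nsets V (Suc k)"
  have fT: "finite T" "card T = Suc k" using T by (auto dest: nsetsD)
  define X where "X = {a\<in>T. l (T - {a})}"
  define Y where "Y = {a\<in>T. \<not> l (T - {a})}"
  have XY: "T = X \<union> Y" "X \<inter> Y = {}" "finite X" "finite Y" using fT by (auto simp: X_def Y_def)
  have c: "card X + card Y = Suc k" using fT XY by (metis card_Un_disjoint)
  have "(\<Sum>a\<in>T. \<Sum>b\<in>T. (of_bool (l (T-{a})) - of_bool (l (T-{b})) :: real)\<^sup>2)
     = (\<Sum>a\<in>T. if l (T-{a}) then real (card Y) else real (card X))"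
  proof (intro sum.cong refl)
    fix a assume "a \<in> T"
    have "(\<Sum>b\<in>T. (of_bool (l (T-{a})) - of_bool (l (T-{b})) :: real)\<^sup>2)
      = (\<Sum>b\<in>T. of_bool (b \<in> (if l (T-{a}) then Y else X)))"
      by (intro sum.cong refl) (auto simp: X_def Y_def)
    also have "\<dots> = (if l (T-{a}) then real (card Y) else real (card X))"
      using fT XY by (auto intro: arg_cong[where f=card])
    finally show "(\<Sum>b\<in>T. (of_bool (l (T-{a})) - of_bool (l (T-{b})) :: real)\<^sup>2) = (if l (T-{a}) then real (card Y) else real (card X))" .
  qed
  also have "\<dots> = real (card X) * real (card Y) + real (card Y) * real (card X)"
    using fT by (subst sum.If_cases) (auto simp: X_def Y_def Int_def)
  also have "\<dots> = 2 * (real (card X) * real (card Y))" by simp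
  also have "\<dots> \<le> 2 * (real (Suc k) * real (card {a\<in>T. l (T - {a}) \<noteq> l T}))"
  proof -
    have "{a\<in>T. l (T - {a}) \<noteq> l T} = (if l T then Y else X)" by (auto simp: X_def Y_def)
    moreover have "real (card X) \<le> real (Suc k)" "real (card Y) \<le> real (Suc k)" using c by linarith+
    ultimately show ?thesis
      using mult_right_mono[of "real (card X)" "real (Suc k)" "real (card Y)"]
        mult_right_mono[of "real (card Y)" "real (Suc k)" "real (card X)"] by (auto simp: mult.commute)
  qed
  finally show "(\<Sum>a\<in>T. \<Sum>b\<in>T. (of_bool (l (T-{a})) - of_bool (l (T-{b})) :: real)\<^sup>2)
     \<le> 2 * real (Suc k) * real (card {a\<in>T. l (T - {a}) \<noteq> l T})" by (simp only: mult.assoc)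
qed

section \<open>Hexagons between two middle layers\<close>


definition layer_edges :: "'a set \<Rightarrow> nat \<Rightarrow> ('a set \<times> 'a) set" where
  "layer_edges V k = Sigma (nsets V k) (\<lambda>A. V - A)"

lemma finite_layer_edges: "finite V \<Longrightarrow> finite (layer_edges V k)"
  by (auto simp: layer_edges_def intro: finite_imp_finite_nsets)

text \<open>\<open>R\<close> holds the vertices of both middle levels whose label is not prescribed.
  Every vertex has at most \<open>r\<close> neighbours in \<open>R\<close>, and a vertex of
  \<open>R\<close> agrees with at least half of its neighbours outside \<open>R\<close>.\<close>

locale majority_labelling =
  fixes V :: "'a set" and k r :: nat and R :: "'a set set" and l :: "'a set \<Rightarrow> bool"
  assumes fin: "finite V" and card_V: "card V = 2 * k + 1" and k_pos: "0 < k" and r_small: "100 * r \<le> k"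
    and up_sparse: "A \<in> nsets V k \<Longrightarrow> card {y\<in>V-A. insert y A \<in> R} \<le> r"
    and down_sparse: "T \<in> nsets V (Suc k) \<Longrightarrow> card {z\<in>T. T - {z} \<in> R} \<le> r"
    and up_majority: "A \<in> nsets V k \<Longrightarrow> A \<in> R \<Longrightarrow>
      card {y\<in>V-A. insert y A \<notin> R} \<le> 2 * card {y\<in>V-A. insert y A \<notin> R \<and> l (insert y A) = l A}"
    and down_majority: "T \<in> nsets V (Suc k) \<Longrightarrow> T \<in> R \<Longrightarrow>
      card {z\<in>T. T - {z} \<notin> R} \<le> 2 * card {z\<in>T. T - {z} \<notin> R \<and> l (T - {z}) = l T}"
begin

text \<open>A hexagon of the inclusion graph between levels \<open>k\<close> and \<open>k + 1\<close> is given by a \<open>(k-1)\<close>-set \<open>S\<close>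
  and three points outside \<open>S\<close>; permuting the points moves any edge to any other.\<close>

definition hh :: "'a set \<Rightarrow> 'a \<Rightarrow> 'a \<Rightarrow> bool" where
  "hh S z y \<longleftrightarrow> l (insert z S) \<noteq> l (insert y (insert z S)) \<and> insert z S \<notin> R \<and> insert y (insert z S) \<notin> R"

definition hex_hh :: "'a set \<Rightarrow> 'a \<Rightarrow> 'a \<Rightarrow> 'a \<Rightarrow> bool" where
  "hex_hh S x y z \<longleftrightarrow> hh S z y \<or> hh S z x \<or> hh S y z \<or> hh S y x \<or> hh S x y \<or> hh S x z"

definition hex_R :: "'a set \<Rightarrow> 'a \<Rightarrow> 'a \<Rightarrow> 'a \<Rightarrow> bool" where
  "hex_R S x y z \<longleftrightarrow> {insert x S, insert y S, insert z S,
     insert x (insert y S), insert x (insert z S), insert y (insert z S)} \<inter> R \<noteq> {}"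

definition hexes :: "('a set \<times> 'a \<times> 'a \<times> 'a) set" where
  "hexes = {(S,x,y,z). S \<in> nsets V (k - 1) \<and> {x,y,z} \<subseteq> V - S \<and> x \<noteq> y \<and> x \<noteq> z \<and> y \<noteq> z}"

definition removed_bad :: "('a set \<times> 'a) set" where
  "removed_bad = {(A,y)\<in>layer_edges V k. l A \<noteq> l (insert y A) \<and> (A \<in> R \<or> insert y A \<in> R)}"

definition present_bad :: "('a set \<times> 'a) set" where
  "present_bad = {(A,y)\<in>layer_edges V k. l A \<noteq> l (insert y A) \<and> A \<notin> R \<and> insert y A \<notin> R}"

lemma finite_hexes: "finite hexes"
  by (rule finite_subset[of _ "nsets V (k-1) \<times> V \<times> V \<times> V"])
     (use fin finite_imp_finite_nsets[OF fin, of "k-1"] in \<open>auto simp: hexes_def\<close>)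

text \<open>Ordering the three points of a hexagon marks one of its edges, from
  \<open>insert z S\<close> to \<open>insert y (insert z S)\<close>. Once this edge is fixed,
  \<open>z\<close> in \<open>A\<close> and \<open>x\<close> outside remain to be chosen, about k^2
  hexagons per edge.\<close>

lemma card_hexes_by_edge:
  "card {(S,x,y,z)\<in>hexes. \<Phi> (insert z S) y \<and> \<Psi> S x y z}
   = (\<Sum>(A,y)\<in>{(A,y)\<in>layer_edges V k. \<Phi> A y}. card {(x,z). z \<in> A \<and> x \<in> V - A - {y} \<and> \<Psi> (A - {z}) x y z})"
  (is "card ?L = _")
proof -
  let ?E = "{(A,y)\<in>layer_edges V k. \<Phi> A y}"
  let ?F = "\<lambda>e. case e of (A,y) \<Rightarrow> {(x,z). z \<in> A \<and> x \<in> V - A - {y} \<and> \<Psi> (A - {z}) x y z}"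
  have fE: "finite ?E" using finite_layer_edges[OF fin, of k] by (rule rev_finite_subset) auto
  have fF: "finite (?F e)" if "e \<in> ?E" for e
  proof -
    obtain A y where e: "e = (A,y)" by force
    have "?F e \<subseteq> V \<times> V" using that by (auto simp: e layer_edges_def nsets_def)
    then show ?thesis using fin by (meson finite_SigmaI finite_subset)
  qed
  have "card ?L = card (Sigma ?E ?F)"
  proof (rule bij_betw_same_card, rule bij_betwI')
    let ?f = "\<lambda>(S,x,y,z). ((insert z S, y), (x, z))"
    show "(?f p = ?f q) = (p = q)" if pq: "p \<in> ?L" "q \<in> ?L" for p q
    proof -
      obtain S x y z S' x' y' z' where p: "p = (S,x,y,z)" "q = (S',x',y',z')" by (metis prod_cases4)
      have "z \<notin> S" "z' \<notin> S'" using pq unfolding p hexes_def by blast+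
      then have "insert z S = insert z S' \<longleftrightarrow> S = S'" if "z = z'" using that by (metis insert_ident)
      then show ?thesis unfolding p by auto
    qed
    show "?f p \<in> Sigma ?E ?F" if "p \<in> ?L" for p
    proof -
      obtain S x y z where p: "p = (S,x,y,z)" by (metis prod_cases4)
      from that have *: "S \<in> nsets V (k-1)" "{x,y,z} \<subseteq> V - S" "x \<noteq> y" "x \<noteq> z" "y \<noteq> z" "\<Phi> (insert z S) y" "\<Psi> S x y z"
        by (auto simp: p hexes_def)
      have "insert z S - {z} = S" "insert z S \<in> nsets V k" using * k_pos by (auto simp: nsets_def)
      then show ?thesis using * by (auto simp: p layer_edges_def)
    qed
    show "\<exists>p\<in>?L. q = ?f p" if "q \<in> Sigma ?E ?F" for q
    proof -
      obtain A y x z where q: "q = ((A,y),(x,z))" by (metis prod.exhaust)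
      from that have *: "A \<in> nsets V k" "y \<in> V - A" "\<Phi> A y" "z \<in> A" "x \<in> V - A - {y}" "\<Psi> (A-{z}) x y z"
        by (auto simp: q layer_edges_def)
      have "A - {z} \<in> nsets V (k-1)" using * by (auto simp: nsets_def)
      then have "(A-{z},x,y,z) \<in> ?L" using * by (auto simp: hexes_def insert_absorb simp: nsets_def)
      moreover have "q = ?f (A-{z},x,y,z)" using * by (auto simp: q insert_absorb)
      ultimately show ?thesis by blast
    qed
  qed
  also have "\<dots> = (\<Sum>e\<in>?E. card (?F e))"
    using fE fF by (subst card_SigmaI) auto
  finally show ?thesis by (simp add: case_prod_unfold)
qed

lemma card_pairs_le:
  fixes m :: nat
  assumes "finite X" "\<And>x. x \<in> X \<Longrightarrow> finite (Y x)" "\<And>x. x \<in> X \<Longrightarrow> card (Y x) \<le> m" "P \<subseteq> Sigma X Y"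
  shows "card P \<le> card X * m"
proof -
  have "card P \<le> card (Sigma X Y)" using assms by (intro card_mono) auto
  also have "\<dots> = (\<Sum>x\<in>X. card (Y x))" using assms by simp
  also have "\<dots> \<le> card X * m" using sum_bounded_above[of X "\<lambda>x. card (Y x)" m] assms by simp
  finally show ?thesis .
qed

lemma card_pairs_le':
  fixes m :: nat
  assumes "finite X" "\<And>x. x \<in> X \<Longrightarrow> finite (Y x)" "\<And>x. x \<in> X \<Longrightarrow> card (Y x) \<le> m" "\<And>a b. (a,b) \<in> P \<Longrightarrow> b \<in> X \<and> a \<in> Y b"
  shows "card P \<le> card X * m"
proof -
  have "card P = card (prod.swap ` P)" by (simp add: card_image)
  also have "\<dots> \<le> card X * m" by (rule card_pairs_le[of X Y]) (use assms in auto)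
  finally show ?thesis .
qed

text \<open>Besides the ends of the edge a hexagon has four vertices, one for each of
  \<open>P1\<close> to \<open>P4\<close>. For each of them, fixing one of \<open>x\<close>,
  \<open>z\<close> makes it vary with the other over the neighbours of a single set, at most
  \<open>r\<close> of which lie in \<open>R\<close>.\<close>

lemma removed_in_hexes_at_present_edge:
  assumes A: "A \<in> nsets V k" and y: "y \<in> V - A" and pr: "A \<notin> R" "insert y A \<notin> R"
  shows "card {(x,z). z \<in> A \<and> x \<in> V - A - {y} \<and> hex_R (A - {z}) x y z} \<le> 4 * (k + 1) * r"
proof -
  let ?T = "insert y A"
  have T: "?T \<in> nsets V (Suc k)" using A y by (auto simp: nsets_def)
  have cA: "card A = k" "finite A" "A \<subseteq> V" using A by (auto simp: nsets_def)
  have cVA: "card (V - A) = k + 1" using cA fin card_V by (simp add: card_Diff_subset)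
  define P1 where "P1 = {(x,z). z \<in> A \<and> x \<in> V - A \<and> insert x A - {z} \<in> R}"
  define P2 where "P2 = {(x,z). z \<in> A \<and> x \<in> V - A \<and> ?T - {z} \<in> R}"
  define P3 where "P3 = {(x,z). z \<in> A \<and> x \<in> V - (?T - {z}) \<and> insert x (?T - {z}) \<in> R}"
  define P4 where "P4 = {(x,z). z \<in> A \<and> x \<in> V - A \<and> insert x A \<in> R}"
  have sub: "{(x,z). z \<in> A \<and> x \<in> V - A - {y} \<and> hex_R (A - {z}) x y z} \<subseteq> P1 \<union> P2 \<union> P3 \<union> P4"
  proof (rule subsetI, rule ccontr)
    fix p assume p: "p \<in> {(x,z). z \<in> A \<and> x \<in> V - A - {y} \<and> hex_R (A - {z}) x y z}" "p \<notin> P1 \<union> P2 \<union> P3 \<union> P4"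
    obtain x z where pp: "p = (x,z)" by force
    have *: "z \<in> A" "x \<in> V" "x \<notin> A" "x \<noteq> y" "hex_R (A-{z}) x y z" "(x,z) \<notin> P1 \<union> P2 \<union> P3 \<union> P4"
      using p by (auto simp: pp)
    have e: "insert z (A-{z}) = A" "insert x (A-{z}) = insert x A - {z}" "insert y (A-{z}) = ?T - {z}"
      using * y by auto
    show False using * pr y unfolding hex_R_def e by (auto simp: P1_def P2_def P3_def P4_def)
  qed
  have dx: "card {z\<in>insert x A. insert x A - {z} \<in> R} \<le> r" if "x \<in> V - A" for x
    by (rule down_sparse) (use A that in \<open>auto simp: nsets_def\<close>)
  have c1: "card P1 \<le> (k+1) * r"
    unfolding cVA[symmetric]
    by (rule card_pairs_le[of _ "\<lambda>x. {z\<in>insert x A. insert x A - {z} \<in> R}"])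
       (use fin cA dx in \<open>auto simp: P1_def\<close>)
  have c2: "card P2 \<le> (k+1) * r"
    unfolding cVA[symmetric]
    by (rule card_pairs_le[of _ "\<lambda>x. {z\<in>?T. ?T - {z} \<in> R}"])
       (use T fin cA y down_sparse[OF T] in \<open>auto simp: P2_def\<close>)
  have c3: "card P3 \<le> card A * r"
  proof (rule card_pairs_le'[of _ "\<lambda>z. {x\<in>V - (?T - {z}). insert x (?T - {z}) \<in> R}"])
    fix z assume "z \<in> A"
    then have "?T - {z} \<in> nsets V k" using T by (auto simp: nsets_def)
    then show "card {x\<in>V - (?T - {z}). insert x (?T - {z}) \<in> R} \<le> r" by (rule up_sparse)
  qed (use cA fin in \<open>auto simp: P3_def\<close>)
  have c4: "card P4 \<le> card A * r"
    by (rule card_pairs_le'[of _ "\<lambda>z. {x\<in>V - A. insert x A \<in> R}"])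
       (use cA fin up_sparse[OF A] in \<open>auto simp: P4_def\<close>)
  have "P1 \<union> P2 \<union> P3 \<union> P4 \<subseteq> V \<times> V" using cA by (auto simp: P1_def P2_def P3_def P4_def)
  then have f: "finite (P1 \<union> P2 \<union> P3 \<union> P4)" using fin by (meson finite_SigmaI finite_subset)
  have "card {(x,z). z \<in> A \<and> x \<in> V - A - {y} \<and> hex_R (A - {z}) x y z} \<le> card (P1 \<union> P2 \<union> P3 \<union> P4)"
    by (rule card_mono[OF f sub])
  also have "\<dots> \<le> card P1 + card P2 + card P3 + card P4"
    by (meson add_mono card_Un_le le_trans order_refl)
  also have "\<dots> \<le> 4 * (k + 1) * r" using c1 c2 c3 c4 cA by (simp add: algebra_simps)
  finally show ?thesis .
qed

text \<open>Go around the hexagon the other way. By majority about half of the \<open>x\<close> give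
  an \<open>insert x A\<close> outside \<open>R\<close> that, if \<open>A\<close> is in
  \<open>R\<close>, is labelled like \<open>A\<close>; likewise for \<open>z\<close> and the upper
  end. Replacing a removed end by this neighbour gives a path whose ends have different labels,
  hence with a mismatched edge. The path avoids \<open>R\<close> unless one of the two remaining
  vertices, treated by \<open>B1\<close> and \<open>B2\<close>, lies in it.\<close>

lemma hexes_at_removed_bad_edge:
  assumes A: "A \<in> nsets V k" and y: "y \<in> V - A" and bad: "l A \<noteq> l (insert y A)" and rem: "A \<in> R \<or> insert y A \<in> R"
  shows "k\<^sup>2 \<le> 8 * card {(x,z). z \<in> A \<and> x \<in> V - A - {y} \<and> hex_hh (A - {z}) x y z}"
proof -
  let ?T = "insert y A"
  have T: "?T \<in> nsets V (Suc k)" using A y by (auto simp: nsets_def)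
  have cA: "card A = k" "finite A" "A \<subseteq> V" using A by (auto simp: nsets_def)
  have cVA: "card (V - A) = k + 1" using cA fin card_V by (simp add: card_Diff_subset)
  define X where "X = {x\<in>V-A-{y}. insert x A \<notin> R \<and> (A \<in> R \<longrightarrow> l (insert x A) = l A)}"
  define Z where "Z = {z\<in>A. ?T - {z} \<notin> R \<and> (?T \<in> R \<longrightarrow> l (?T - {z}) = l ?T)}"
  have fXZ: "finite X" "finite Z" using fin cA by (auto simp: X_def Z_def)
  have cX: "k \<le> 2 * card X + r"
  proof -
    have "card {x\<in>V-A. insert x A \<notin> R} + card {x\<in>V-A. insert x A \<in> R} = k + 1"
      unfolding cVA[symmetric] using fin by (subst card_Un_disjoint[symmetric]) (auto intro!: arg_cong[where f=card])
    then have 1: "k + 1 \<le> card {x\<in>V-A. insert x A \<notin> R} + r" using up_sparse[OF A] by linarith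
    show ?thesis
    proof (cases "A \<in> R")
      case True
      have "{x\<in>V-A. insert x A \<notin> R \<and> l (insert x A) = l A} \<subseteq> X"
        using True bad by (auto simp: X_def)
      then have "card {x\<in>V-A. insert x A \<notin> R \<and> l (insert x A) = l A} \<le> card X" by (intro card_mono fXZ)
      then show ?thesis using up_majority[OF A True] 1 by linarith
    next
      case False
      have "{x\<in>V-A. insert x A \<notin> R} \<subseteq> X" using False rem by (auto simp: X_def)
      then have "card {x\<in>V-A. insert x A \<notin> R} \<le> card X" by (intro card_mono fXZ)
      then show ?thesis using 1 by linarith
    qed
  qed
  have cZ: "k \<le> 2 * card Z + r"
  proof -
    have "card {z\<in>?T. ?T-{z} \<notin> R} + card {z\<in>?T. ?T-{z} \<in> R} = card ?T"
      using cA by (subst card_Un_disjoint[symmetric]) (auto intro!: arg_cong[where f=card])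
    then have 1: "k + 1 \<le> card {z\<in>?T. ?T-{z} \<notin> R} + r" using down_sparse[OF T] T by (simp add: nsets_def)
    have TA: "?T - {y} = A" using y by auto
    show ?thesis
    proof (cases "?T \<in> R")
      case True
      have "{z\<in>?T. ?T-{z} \<notin> R \<and> l (?T-{z}) = l ?T} \<subseteq> Z"
      proof
        fix z assume z: "z \<in> {z\<in>?T. ?T-{z} \<notin> R \<and> l (?T-{z}) = l ?T}"
        then have "l (?T-{z}) = l ?T" by blast
        then have "z \<noteq> y" using bad TA by metis
        then show "z \<in> Z" using z by (simp add: Z_def)
      qed
      then have "card {z\<in>?T. ?T-{z} \<notin> R \<and> l (?T-{z}) = l ?T} \<le> card Z" by (intro card_mono fXZ)
      then show ?thesis using down_majority[OF T True] 1 by linarith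
    next
      case False
      have "{z\<in>?T. ?T-{z} \<notin> R} \<subseteq> Z"
      proof
        fix z assume z: "z \<in> {z\<in>?T. ?T-{z} \<notin> R}"
        then have "?T-{z} \<notin> R" by blast
        then have "z \<noteq> y" using False rem TA by metis
        then show "z \<in> Z" using z False by (simp add: Z_def)
      qed
      then have "card {z\<in>?T. ?T-{z} \<notin> R} \<le> card Z" by (intro card_mono fXZ)
      then show ?thesis using 1 by linarith
    qed
  qed
  define B1 where "B1 = {(x,z). x \<in> X \<and> z \<in> Z \<and> insert x A - {z} \<in> R}"
  define B2 where "B2 = {(x,z). x \<in> X \<and> z \<in> Z \<and> insert x (?T - {z}) \<in> R}"
  have dx: "card {z\<in>insert x A. insert x A - {z} \<in> R} \<le> r" if "x \<in> V - A" for x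
    by (rule down_sparse) (use A that in \<open>auto simp: nsets_def\<close>)
  have c1: "card B1 \<le> card X * r"
    by (rule card_pairs_le[of _ "\<lambda>x. {z\<in>insert x A. insert x A - {z} \<in> R}"])
       (use cA fXZ dx in \<open>auto simp: B1_def X_def Z_def\<close>)
  have c2: "card B2 \<le> card Z * r"
  proof (rule card_pairs_le'[of _ "\<lambda>z. {x\<in>V - (?T - {z}). insert x (?T - {z}) \<in> R}"])
    fix z assume "z \<in> Z"
    then have "?T - {z} \<in> nsets V k" using T by (auto simp: nsets_def Z_def)
    then show "card {x\<in>V - (?T - {z}). insert x (?T - {z}) \<in> R} \<le> r" by (rule up_sparse)
  qed (use fXZ fin in \<open>auto simp: B2_def X_def Z_def\<close>)
  have sub: "X \<times> Z - B1 - B2 \<subseteq> {(x,z). z \<in> A \<and> x \<in> V - A - {y} \<and> hex_hh (A - {z}) x y z}"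
  proof
    fix p assume p: "p \<in> X \<times> Z - B1 - B2"
    obtain x z where pp: "p = (x,z)" by force
    have *: "x \<in> X" "z \<in> Z" "(x,z) \<notin> B1" "(x,z) \<notin> B2" using p by (auto simp: pp)
    then have **: "z \<in> A" "x \<in> V - A - {y}" by (auto simp: X_def Z_def)
    then have e: "insert z (A-{z}) = A" "insert x (A-{z}) = insert x A - {z}" "insert y (A-{z}) = ?T - {z}"
        "insert z (insert x A - {z}) = insert x A" "insert z (?T - {z}) = ?T"
        "insert y (insert x A - {z}) = insert x (?T - {z})"
      using y by auto
    have "insert x A \<notin> R" "?T - {z} \<notin> R" "insert x A - {z} \<notin> R" "insert x (?T - {z}) \<notin> R"
      "A \<in> R \<Longrightarrow> l (insert x A) = l A" "?T \<in> R \<Longrightarrow> l (?T - {z}) = l ?T"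
      using * by (auto simp: X_def Z_def B1_def B2_def)
    then have "hex_hh (A-{z}) x y z"
      unfolding hex_hh_def hh_def e using bad by metis
    then show "p \<in> {(x,z). z \<in> A \<and> x \<in> V - A - {y} \<and> hex_hh (A - {z}) x y z}"
      using ** by (simp add: pp)
  qed
  have fB: "finite B1" "finite B2"
    by (rule finite_subset[of _ "X \<times> Z"]; use fXZ in \<open>auto simp: B1_def B2_def\<close>)+
  have fin': "finite {(x,z). z \<in> A \<and> x \<in> V - A - {y} \<and> hex_hh (A - {z}) x y z}"
    by (rule finite_subset[of _ "V \<times> V"]) (use fin cA in auto)
  have "card (X \<times> Z) - card B1 - card B2 \<le> card (X \<times> Z - B1 - B2)"
    using diff_card_le_card_Diff[OF fB(1), of "X \<times> Z"] diff_card_le_card_Diff[OF fB(2), of "X \<times> Z - B1"] by linarith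
  also have "\<dots> \<le> card {(x,z). z \<in> A \<and> x \<in> V - A - {y} \<and> hex_hh (A - {z}) x y z}"
    by (rule card_mono[OF fin' sub])
  finally have main: "card X * card Z \<le> card {(x,z). z \<in> A \<and> x \<in> V - A - {y} \<and> hex_hh (A - {z}) x y z} + card X * r + card Z * r"
    (is "_ \<le> ?c + _ + _") using c1 c2 by (simp add: card_cartesian_product)
  have arith: "real k * real k \<le> 8 * real c"
    if "card X * card Z \<le> c + card X * r + card Z * r" for c
  proof -
    \<comment> \<open>The quantity |X| |Z| - |X| r - |Z| r equals (|X| - r) (|Z| - r) - r^2. As r is
      at most k / 100, both factors are at least 12/25 k, which leaves more than k^2 / 8.\<close>
    define x z q where "x = real (card X) - real r" and "z = real (card Z) - real r" and "q = real r"
    have "real k * (12/25) \<le> x" "real k * (12/25) \<le> z" "q \<le> real k * (1/100)"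
      using cX cZ r_small unfolding x_def z_def q_def by linarith+
    then have *: "(real k * (12/25)) * (real k * (12/25)) \<le> x * z" "q * q \<le> (real k * (1/100)) * (real k * (1/100))"
      by (intro mult_mono; simp add: q_def)+
    have "real (card X * card Z) \<le> real (c + card X * r + card Z * r)"
      using that by (simp only: of_nat_le_iff)
    then have "(x + q) * (z + q) \<le> real c + (x + q) * q + (z + q) * q"
      by (simp add: x_def z_def q_def)
    then have "x * z \<le> real c + q * q" by (simp add: algebra_simps)
    then show ?thesis using * by simp
  qed
  have "real (k\<^sup>2) \<le> real (8 * ?c)" using arith[OF main] by (simp add: power2_eq_square)
  then show ?thesis by (simp only: of_nat_le_iff)
qed

text \<open>Count hexagons with a marked mismatched edge. A marked edge that touches
  \<open>R\<close> lies on at least k^2 / 8 hexagons with another mismatched edge avoiding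
  \<open>R\<close> (\<open>N1\<close>). Moving the mark to that edge is one of six permutations
  (\<open>N2\<close>), and an edge avoiding \<open>R\<close> lies on at most 4 (k + 1) r hexagons
  that meet \<open>R\<close>. Hence 192 = 8 * 6 * 4.\<close>

lemma removed_bad_le: "k\<^sup>2 * card removed_bad \<le> 192 * (k + 1) * r * card present_bad"
proof -
  define N1 where "N1 = {(S,x,y,z)\<in>hexes. (l (insert z S) \<noteq> l (insert y (insert z S)) \<and> (insert z S \<in> R \<or> insert y (insert z S) \<in> R)) \<and> hex_hh S x y z}"
  define N2 where "N2 = {(S,x,y,z)\<in>hexes. (l (insert z S) \<noteq> l (insert y (insert z S)) \<and> insert z S \<notin> R \<and> insert y (insert z S) \<notin> R) \<and> hex_R S x y z}"
  have fN: "finite N2" unfolding N2_def by (rule finite_subset[OF _ finite_hexes]) auto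
  have "k\<^sup>2 * card removed_bad = (\<Sum>e\<in>removed_bad. k\<^sup>2)" by simp
  also have "\<dots> \<le> (\<Sum>(A,y)\<in>removed_bad. 8 * card {(x,z). z \<in> A \<and> x \<in> V - A - {y} \<and> hex_hh (A - {z}) x y z})"
  proof (intro sum_mono, clarify)
    fix A y assume "(A,y) \<in> removed_bad"
    then have "A \<in> nsets V k" "y \<in> V - A" "l A \<noteq> l (insert y A)" "A \<in> R \<or> insert y A \<in> R"
      unfolding removed_bad_def layer_edges_def by blast+
    then show "k\<^sup>2 \<le> 8 * card {(x,z). z \<in> A \<and> x \<in> V - A - {y} \<and> hex_hh (A - {z}) x y z}"
      by (rule hexes_at_removed_bad_edge)
  qed
  also have "\<dots> = 8 * card N1"
    unfolding N1_def card_hexes_by_edge[where \<Phi>="\<lambda>A y. l A \<noteq> l (insert y A) \<and> (A \<in> R \<or> insert y A \<in> R)" and \<Psi>=hex_hh]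
    by (simp add: removed_bad_def sum_distrib_left case_prod_unfold)
  also have "card N1 \<le> 6 * card N2"
  proof -
    define f1 where "f1 = (\<lambda>(S :: 'a set, x :: 'a, y :: 'a, z :: 'a). (S,y,x,z))"
    define f2 where "f2 = (\<lambda>(S :: 'a set, x :: 'a, y :: 'a, z :: 'a). (S,x,z,y))"
    define f3 where "f3 = (\<lambda>(S :: 'a set, x :: 'a, y :: 'a, z :: 'a). (S,y,z,x))"
    define f4 where "f4 = (\<lambda>(S :: 'a set, x :: 'a, y :: 'a, z :: 'a). (S,z,x,y))"
    define f5 where "f5 = (\<lambda>(S :: 'a set, x :: 'a, y :: 'a, z :: 'a). (S,z,y,x))"
    have "N1 \<subseteq> N2 \<union> (f1 ` N2 \<union> (f2 ` N2 \<union> (f3 ` N2 \<union> (f4 ` N2 \<union> f5 ` N2))))"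
    proof
      fix q assume q: "q \<in> N1"
      obtain S x y z where qq: "q = (S,x,y,z)" by (metis prod_cases4)
      have *: "(S,x,y,z) \<in> hexes" "hex_hh S x y z" "hex_R S x y z"
        using q by (auto simp: qq N1_def hex_R_def)
      have perm: "(S,b,a,c) \<in> hexes" "(S,a,c,b) \<in> hexes" "hex_R S b a c" "hex_R S a c b"
        if "(S,a,b,c) \<in> hexes" "hex_R S a b c" for a b c
        using that by (auto simp: hexes_def hex_R_def insert_commute)
      have N2I: "(S,a,b,c) \<in> N2" if "(S,a,b,c) \<in> hexes" "hex_R S a b c" "hh S c b" for a b c
        using that by (auto simp: N2_def hh_def)
      note p1 = perm(1,3)[OF *(1,3)] and p2 = perm(2,4)[OF *(1,3)]
      note p3 = perm(2,4)[OF p1] and p4 = perm(1,3)[OF p2]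
      note p5 = perm(1,3)[OF p3]
      have "(S,x,y,z) \<in> N2 \<or> (S,y,x,z) \<in> N2 \<or> (S,x,z,y) \<in> N2 \<or> (S,z,x,y) \<in> N2 \<or> (S,z,y,x) \<in> N2 \<or> (S,y,z,x) \<in> N2"
        using *(2) N2I[OF *(1,3)] N2I[OF p1] N2I[OF p2] N2I[OF p3] N2I[OF p4] N2I[OF p5] unfolding hex_hh_def by blast
      moreover have "(S,y,x,z) \<in> N2 \<Longrightarrow> q \<in> f1 ` N2"
        by (rule rev_image_eqI) (auto simp: qq f1_def)
      moreover have "(S,x,z,y) \<in> N2 \<Longrightarrow> q \<in> f2 ` N2"
        by (rule rev_image_eqI) (auto simp: qq f2_def)
      moreover have "(S,z,x,y) \<in> N2 \<Longrightarrow> q \<in> f3 ` N2"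
        by (rule rev_image_eqI) (auto simp: qq f3_def)
      moreover have "(S,y,z,x) \<in> N2 \<Longrightarrow> q \<in> f4 ` N2"
        by (rule rev_image_eqI) (auto simp: qq f4_def)
      moreover have "(S,z,y,x) \<in> N2 \<Longrightarrow> q \<in> f5 ` N2"
        by (rule rev_image_eqI) (auto simp: qq f5_def)
      ultimately show "q \<in> N2 \<union> (f1 ` N2 \<union> (f2 ` N2 \<union> (f3 ` N2 \<union> (f4 ` N2 \<union> f5 ` N2))))" unfolding qq by blast
    qed
    then have "card N1 \<le> card (N2 \<union> (f1 ` N2 \<union> (f2 ` N2 \<union> (f3 ` N2 \<union> (f4 ` N2 \<union> f5 ` N2)))))" using fN by (intro card_mono) auto
    also have "\<dots> \<le> card N2 + (card (f1 ` N2) + (card (f2 ` N2) + (card (f3 ` N2) + (card (f4 ` N2) + card (f5 ` N2)))))"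
      by (intro order_trans[OF card_Un_le] add_mono order_refl)
    also have "\<dots> \<le> 6 * card N2"
      using card_image_le[OF fN, of f1] card_image_le[OF fN, of f2] card_image_le[OF fN, of f3] card_image_le[OF fN, of f4] card_image_le[OF fN, of f5] by linarith
    finally show ?thesis .
  qed
  also have "card N2 = (\<Sum>(A,y)\<in>present_bad. card {(x,z). z \<in> A \<and> x \<in> V - A - {y} \<and> hex_R (A - {z}) x y z})"
    unfolding N2_def card_hexes_by_edge[where \<Phi>="\<lambda>A y. l A \<noteq> l (insert y A) \<and> A \<notin> R \<and> insert y A \<notin> R" and \<Psi>=hex_R]
    by (simp add: present_bad_def)
  also have "\<dots> \<le> (\<Sum>e\<in>present_bad. 4 * (k + 1) * r)"
  proof (intro sum_mono, clarify)
    fix A y assume "(A,y) \<in> present_bad"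
    then have "A \<in> nsets V k" "y \<in> V - A" "A \<notin> R" "insert y A \<notin> R"
      unfolding present_bad_def layer_edges_def by blast+
    then show "card {(x,z). z \<in> A \<and> x \<in> V - A - {y} \<and> hex_R (A - {z}) x y z} \<le> 4 * (k + 1) * r"
      by (rule removed_in_hexes_at_present_edge)
  qed
  finally show ?thesis by (simp add: algebra_simps)
qed

end

section \<open>Boolean functions of low energy\<close>


lemma card_nsets_superset:
  assumes fin: "finite V" and S: "S \<subseteq> V" "card S \<le> k"
  shows "card {A\<in>nsets V k. S \<subseteq> A} = (card V - card S) choose (k - card S)"
proof -
  have fS: "finite S" using fin S finite_subset by blast
  have "bij_betw (\<lambda>A. A - S) {A\<in>nsets V k. S \<subseteq> A} (nsets (V - S) (k - card S))"
  proof (rule bij_betw_byWitness[where f'="\<lambda>B. B \<union> S"])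
    show "(\<lambda>A. A - S) ` {A\<in>nsets V k. S \<subseteq> A} \<subseteq> nsets (V - S) (k - card S)"
      using fS by (auto simp: nsets_def card_Diff_subset)
    show "(\<lambda>B. B \<union> S) ` nsets (V - S) (k - card S) \<subseteq> {A\<in>nsets V k. S \<subseteq> A}"
    proof clarify
      fix B assume B: "B \<in> nsets (V - S) (k - card S)"
      then have "card (B \<union> S) = card B + card S" using fS by (intro card_Un_disjoint) (auto simp: nsets_def)
      then show "B \<union> S \<in> nsets V k \<and> S \<subseteq> B \<union> S" using B S fS by (auto simp: nsets_def)
    qed
  qed (auto simp: nsets_def)
  then have "card {A\<in>nsets V k. S \<subseteq> A} = card (nsets (V - S) (k - card S))" by (rule bij_betw_same_card)
  also have "\<dots> = (card V - card S) choose (k - card S)"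
    using fS S by (simp add: card_nsets card_Diff_subset)
  finally show ?thesis .
qed

lemma sum_nsets_swap:
  fixes c :: "'a \<Rightarrow> real"
  assumes fin: "finite V"
  shows "(\<Sum>A\<in>nsets V k. (\<Sum>x\<in>A. c x) * h A) = (\<Sum>x\<in>V. c x * (\<Sum>A\<in>{A\<in>nsets V k. x \<in> A}. h A))"
proof -
  have fn: "finite (nsets V k)" using fin by (rule finite_imp_finite_nsets)
  have "(\<Sum>A\<in>nsets V k. (\<Sum>x\<in>A. c x) * h A) = (\<Sum>A\<in>nsets V k. \<Sum>x\<in>V. if x \<in> A then c x * h A else 0)"
  proof (intro sum.cong refl)
    fix A assume "A \<in> nsets V k"
    then have "{x\<in>V. x \<in> A} = A" by (auto simp: nsets_def)
    then show "(\<Sum>x\<in>A. c x) * h A = (\<Sum>x\<in>V. if x \<in> A then c x * h A else 0)"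
      using fin by (simp add: sum.inter_filter[symmetric] sum_distrib_right)
  qed
  also have "\<dots> = (\<Sum>x\<in>V. \<Sum>A\<in>nsets V k. if x \<in> A then c x * h A else 0)" by (rule sum.swap)
  also have "\<dots> = (\<Sum>x\<in>V. c x * (\<Sum>A\<in>{A\<in>nsets V k. x \<in> A}. h A))"
    using fn by (simp add: sum.inter_filter[symmetric] sum_distrib_left)
  finally show ?thesis .
qed

text \<open>\<open>lin\<close> has degree one and \<open>h\<close> is orthogonal to degree at most
  one. \<open>down\<close> maps \<open>lin\<close> to a multiple of the same linear function one
  level lower and keeps \<open>h\<close> orthogonal to such functions, so all cross terms
  vanish.\<close>

lemma exch_energy_add_linear:
  fixes b :: "'a \<Rightarrow> real"
  assumes fin: "finite V" and k: "2 \<le> k" "k + 2 \<le> card V"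
    and b: "(\<Sum>x\<in>V. b x) = 0"
    and h: "\<And>x. x \<in> V \<Longrightarrow> (\<Sum>A\<in>{A\<in>nsets V k. x \<in> A}. h A) = 0"
  defines "lin \<equiv> (\<lambda>A. \<Sum>x\<in>A. b x)"
  shows "sqn V k (\<lambda>A. lin A + h A) = sqn V k lin + sqn V k h"
    and "exch_energy V k (\<lambda>A. lin A + h A) = exch_energy V k lin + exch_energy V k h"
proof -
  obtain j where j: "k = Suc j" using k by (cases k) auto
  have add: "sqn V i (\<lambda>A. p A + q A) = sqn V i p + sqn V i q + 2 * (\<Sum>A\<in>nsets V i. p A * q A)" for i and p q :: "'a set \<Rightarrow> real"
    by (simp add: sqn_def power2_sum sum.distrib sum_distrib_left mult.assoc)
  show 1: "sqn V k (\<lambda>A. lin A + h A) = sqn V k lin + sqn V k h"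
    unfolding add lin_def sum_nsets_swap[OF fin] using h by simp
  have down_lin: "down V lin S = (real (card V) - real k) * (\<Sum>x\<in>S. b x)" if S: "S \<in> nsets V j" for S
  proof -
    have "down V lin S = (\<Sum>a\<in>V-S. b a + (\<Sum>x\<in>S. b x))"
      unfolding down_def lin_def using S by (intro sum.cong refl) (auto simp: nsets_def)
    also have "\<dots> = (\<Sum>a\<in>V-S. b a) + real (card (V-S)) * (\<Sum>x\<in>S. b x)"
      by (simp add: sum.distrib)
    also have "(\<Sum>a\<in>V-S. b a) = - (\<Sum>x\<in>S. b x)"
      using b fin S by (subst sum_diff) (auto simp: nsets_def)
    finally show ?thesis
      unfolding real_card_Diff_nsets[OF fin S] by (simp add: j algebra_simps)
  qed
  have "(\<Sum>S\<in>nsets V j. down V lin S * down V h S) = (real (card V) - real k) * (\<Sum>S\<in>nsets V j. (\<Sum>x\<in>S. b x) * down V h S)"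
    unfolding sum_distrib_left[of "real (card V) - real k" _ "nsets V j"] by (intro sum.cong refl) (simp add: down_lin)
  also have "(\<Sum>S\<in>nsets V j. (\<Sum>x\<in>S. b x) * down V h S) = 0"
  proof -
    have "(\<Sum>A\<in>{A\<in>nsets V j. x \<in> A}. down V h A) = 0" if "x \<in> V" for x
    proof -
      have "{x} \<in> nsets V 1" using that by (auto simp: nsets_def)
      from down_link_sum[OF fin this, where j=j and f=h] show ?thesis using h[OF that] by (simp add: j)
    qed
    then show ?thesis by (simp add: sum_nsets_swap[OF fin])
  qed
  finally have 2: "sqn V j (down V (\<lambda>A. lin A + h A)) = sqn V j (down V lin) + sqn V j (down V h)"
    using add[of j "down V lin" "down V h"] by (simp add: down_def[abs_def] sum.distrib)
  show "exch_energy V k (\<lambda>A. lin A + h A) = exch_energy V k lin + exch_energy V k h"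
  proof -
    have "k \<le> card V" using k by simp
    then show ?thesis unfolding exch_energy_eq[OF fin j \<open>k \<le> card V\<close>] 1 2 by (simp add: algebra_simps)
  qed
qed

text \<open>The case \<open>i = 1\<close> of \<open>sqn_down_le\<close>. Beyond degree one the
  energy per unit of squared norm is at least 4 (n - 1) with n = |V|, nearly twice the value 2 n in
  degree one; this gap forces a function of low energy onto degree one.\<close>

lemma exch_energy_level_two:
  assumes fin: "finite V" and k: "2 \<le> k" "k + 2 \<le> card V"
    and h: "\<And>x. x \<in> V \<Longrightarrow> (\<Sum>A\<in>{A\<in>nsets V k. x \<in> A}. h A) = 0"
  shows "exch_energy V k h \<ge> 4 * (real (card V) - 1) * sqn V k h"
proof -
  obtain m where m: "k = Suc (Suc m)" using k by (metis Suc_le_D numeral_2_eq_2 Suc_le_mono)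
  have "sqn V (1 + m) (down V h) \<le> real m * (real (card V) - 2 * real 1 - real m - 1) * sqn V (Suc 1 + m) h"
  proof (rule sqn_down_le[OF fin])
    fix S assume "S \<in> nsets V 1"
    then obtain x where "S = {x}" "x \<in> V" by (auto simp: nsets_def card_1_singleton_iff)
    then show "(\<Sum>A\<in>{A\<in>nsets V (Suc 1 + m). S \<subseteq> A}. h A) = 0" using h[of x] by (simp add: m)
  qed (use k m in auto)
  then show ?thesis
    using k by (subst exch_energy_eq[OF fin, of _ "Suc m"]) (auto simp: m algebra_simps)
qed

lemma sum_sq_diff:
  fixes b :: "'a \<Rightarrow> real"
  assumes "finite V" "(\<Sum>x\<in>V. b x) = 0"
  shows "(\<Sum>x\<in>V. (b x - c)\<^sup>2) = (\<Sum>x\<in>V. (b x)\<^sup>2) + real (card V) * c\<^sup>2"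
  using assms by (simp add: power2_diff sum.distrib sum_subtractf sum_distrib_right[symmetric] sum_distrib_left[symmetric])

text \<open>For a zero-one function a squared difference is an absolute value, and the signed
  differences for exchanging \<open>a\<close> with \<open>b\<close> add up to the difference of the
  degrees of \<open>a\<close> and \<open>b\<close>. The number of such exchanges is the number of
  \<open>k - 1\<close>-sets avoiding both points, which gives the second bound.\<close>

lemma exch_energy_indicator_ge:
  assumes fin: "finite V" and k: "0 < k" and Ft: "F \<subseteq> nsets V k"
  shows "exch_energy V k (\<lambda>A. of_bool (A \<in> F))
    \<ge> (\<Sum>a\<in>V. \<Sum>b\<in>V. \<bar>real (card {A\<in>F. a \<in> A}) - real (card {A\<in>F. b \<in> A})\<bar>)"
    and "a \<in> V \<Longrightarrow> b \<in> V \<Longrightarrow> \<bar>real (card {A\<in>F. a \<in> A}) - real (card {A\<in>F. b \<in> A})\<bar> \<le> real ((card V - 2) choose (k - 1))"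
proof -
  let ?f = "\<lambda>A. of_bool (A \<in> F) :: real"
  let ?L = "nsets V (k-1)"
  have fn: "finite ?L" "finite F" using fin finite_imp_finite_nsets Ft by (metis finite_subset)+
  have key: "(\<Sum>S\<in>{S\<in>?L. a \<notin> S \<and> b \<notin> S}. ?f (insert a S) - ?f (insert b S))
     = real (card {A\<in>F. a \<in> A}) - real (card {A\<in>F. b \<in> A})" if ab: "a \<in> V" "b \<in> V" for a b
  proof (cases "a = b")
    case True then show ?thesis by simp
  next
    case False
    have half: "(\<Sum>S\<in>{S\<in>?L. a \<notin> S \<and> b \<notin> S}. ?f (insert a S)) = real (card {A\<in>F. a \<in> A}) - real (card {A\<in>F. a \<in> A \<and> b \<in> A})"
      if ab: "a \<in> V" "b \<in> V" "a \<noteq> b" for a b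
    proof -
      have "(\<Sum>S\<in>{S\<in>?L. a \<notin> S \<and> b \<notin> S}. ?f (insert a S)) = real (card ({S\<in>?L. a \<notin> S \<and> b \<notin> S} \<inter> {S. insert a S \<in> F}))"
        using fn by (subst sum_of_bool_eq) (auto simp: Int_def)
      also have "card ({S\<in>?L. a \<notin> S \<and> b \<notin> S} \<inter> {S. insert a S \<in> F}) = card {A\<in>F. a \<in> A \<and> b \<notin> A}"
      proof (rule bij_betw_same_card[OF bij_betw_byWitness[where f="insert a" and f'="\<lambda>A. A - {a}"]])
        show "(\<lambda>A. A - {a}) ` {A\<in>F. a \<in> A \<and> b \<notin> A} \<subseteq> {S\<in>?L. a \<notin> S \<and> b \<notin> S} \<inter> {S. insert a S \<in> F}"
          using Ft by (auto simp: nsets_def insert_absorb)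
      qed (use ab in \<open>auto simp: insert_absorb\<close>)
      also have "real \<dots> = real (card {A\<in>F. a \<in> A}) - real (card {A\<in>F. a \<in> A \<and> b \<in> A})"
      proof -
        have "card {A\<in>F. a \<in> A} = card {A\<in>F. a \<in> A \<and> b \<notin> A} + card {A\<in>F. a \<in> A \<and> b \<in> A}"
          using fn by (subst card_Un_disjoint[symmetric]) (auto intro!: arg_cong[where f=card])
        then show ?thesis by simp
      qed
      finally show ?thesis .
    qed
    have sw: "{S\<in>?L. a \<notin> S \<and> b \<notin> S} = {S\<in>?L. b \<notin> S \<and> a \<notin> S}"
      "{A\<in>F. b \<in> A \<and> a \<in> A} = {A\<in>F. a \<in> A \<and> b \<in> A}" by auto
    show ?thesis
      using half[OF ab False] half[OF ab(2,1) False[symmetric], folded sw(1)] unfolding sum_subtractf sw(2) by linarith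
  qed
  have restr: "sum c (V - S) = (\<Sum>a\<in>V. if a \<notin> S then c a else 0)" for c :: "'a \<Rightarrow> real" and S
    by (simp only: set_diff_eq sum.inter_filter[OF fin])
  have "exch_energy V k ?f = (\<Sum>S\<in>?L. \<Sum>a\<in>V. \<Sum>b\<in>V. if a \<notin> S \<and> b \<notin> S then \<bar>?f (insert a S) - ?f (insert b S)\<bar> else 0)"
    unfolding exch_energy_def
  proof (rule sum.cong[OF refl])
    fix S assume "S \<in> ?L"
    have "(\<Sum>a\<in>V-S. \<Sum>b\<in>V-S. (?f (insert a S) - ?f (insert b S))\<^sup>2)
        = (\<Sum>a\<in>V-S. \<Sum>b\<in>V-S. \<bar>?f (insert a S) - ?f (insert b S)\<bar>)"
      by (intro sum.cong refl) auto
    also have "\<dots> = (\<Sum>a\<in>V. if a \<notin> S then \<Sum>b\<in>V-S. \<bar>?f (insert a S) - ?f (insert b S)\<bar> else 0)"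
      by (rule restr)
    also have "\<dots> = (\<Sum>a\<in>V. \<Sum>b\<in>V. if a \<notin> S \<and> b \<notin> S then \<bar>?f (insert a S) - ?f (insert b S)\<bar> else 0)"
      by (intro sum.cong refl) (simp add: restr)
    finally show "(\<Sum>a\<in>V-S. \<Sum>b\<in>V-S. (?f (insert a S) - ?f (insert b S))\<^sup>2)
        = (\<Sum>a\<in>V. \<Sum>b\<in>V. if a \<notin> S \<and> b \<notin> S then \<bar>?f (insert a S) - ?f (insert b S)\<bar> else 0)" .
  qed
  also have "\<dots> = (\<Sum>a\<in>V. \<Sum>b\<in>V. \<Sum>S\<in>?L. if a \<notin> S \<and> b \<notin> S then \<bar>?f (insert a S) - ?f (insert b S)\<bar> else 0)"
    by (subst sum.swap, intro sum.cong refl, rule sum.swap)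
  also have "\<dots> = (\<Sum>a\<in>V. \<Sum>b\<in>V. \<Sum>S\<in>{S\<in>?L. a \<notin> S \<and> b \<notin> S}. \<bar>?f (insert a S) - ?f (insert b S)\<bar>)"
    using fn by (simp only: sum.inter_filter)
  also have "\<dots> \<ge> (\<Sum>a\<in>V. \<Sum>b\<in>V. \<bar>real (card {A\<in>F. a \<in> A}) - real (card {A\<in>F. b \<in> A})\<bar>)"
    by (intro sum_mono) (simp only: key[symmetric] sum_abs)
  finally show "exch_energy V k ?f \<ge> (\<Sum>a\<in>V. \<Sum>b\<in>V. \<bar>real (card {A\<in>F. a \<in> A}) - real (card {A\<in>F. b \<in> A})\<bar>)" .
  show "\<bar>real (card {A\<in>F. a \<in> A}) - real (card {A\<in>F. b \<in> A})\<bar> \<le> real ((card V - 2) choose (k - 1))"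
    if ab: "a \<in> V" "b \<in> V" for a b
  proof (cases "a = b")
    case True then show ?thesis by simp
  next
    case False
    have "\<bar>real (card {A\<in>F. a \<in> A}) - real (card {A\<in>F. b \<in> A})\<bar> \<le> (\<Sum>S\<in>{S\<in>?L. a \<notin> S \<and> b \<notin> S}. \<bar>?f (insert a S) - ?f (insert b S)\<bar>)"
      unfolding key[OF ab, symmetric] by (rule sum_abs)
    also have "\<dots> \<le> (\<Sum>S\<in>{S\<in>?L. a \<notin> S \<and> b \<notin> S}. 1)" by (intro sum_mono) auto
    also have "{S\<in>?L. a \<notin> S \<and> b \<notin> S} = nsets (V - {a,b}) (k-1)" by (auto simp: nsets_def)
    finally show ?thesis using ab False fin by (simp add: card_nsets card_Diff_subset numeral_2_eq_2)
  qed
qed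

lemma middle_binomials:
  assumes "0 < k"
  shows "real (2 * k choose (k - 1)) * real (2 * k + 1) = real (2 * k + 1 choose k) * real k"
    and "2 * real (2 * k - 1 choose (k - 1)) * real (2 * k + 1) = real (2 * k + 1 choose k) * real (k + 1)"
    and "real (2 * k choose k) = 2 * real (2 * k - 1 choose (k - 1))"
    and "2 \<le> k \<Longrightarrow> real (2 * k choose (k - 1)) = real (2 * k - 1 choose (k - 1)) + real (2 * k - 1 choose (k - 2))"
proof -
  obtain j where j: "k = Suc j" using assms by (cases k) auto
  have "Suc j * (Suc (2*k) choose Suc j) = Suc (2*k) * (2*k choose j)" by (rule Suc_times_binomial)
  then have "real (Suc j * (Suc (2*k) choose Suc j)) = real (Suc (2*k) * (2*k choose j))" by (simp only:)
  then show "real (2 * k choose (k - 1)) * real (2 * k + 1) = real (2 * k + 1 choose k) * real k"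
    unfolding j by (simp add: algebra_simps)
  have "Suc j * (Suc (Suc (2*j)) choose Suc j) = Suc (Suc (2*j)) * (Suc (2*j) choose j)" by (rule Suc_times_binomial)
  then have "Suc j * (2*k choose k) = Suc j * (2 * (2*k-1 choose (k-1)))" by (simp add: j)
  then have c: "2*k choose k = 2 * (2*k-1 choose (k-1))" by (metis mult_cancel1 nat.distinct(1))
  then show "real (2 * k choose k) = 2 * real (2 * k - 1 choose (k - 1))" by simp
  have "Suc k * (Suc (2*k) choose Suc k) = Suc (2*k) * (2*k choose k)" by (rule Suc_times_binomial)
  moreover have "Suc (2*k) choose Suc k = Suc (2*k) choose k" using binomial_symmetric[of k "Suc (2*k)"] by simp
  ultimately have "Suc k * (Suc (2*k) choose k) = Suc (2*k) * (2 * (2*k-1 choose (k-1)))" by (simp add: c)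
  then have "real (Suc k * (Suc (2*k) choose k)) = real (Suc (2*k) * (2 * (2*k-1 choose (k-1))))" by (simp only:)
  then show "2 * real (2 * k - 1 choose (k - 1)) * real (2 * k + 1) = real (2 * k + 1 choose k) * real (k + 1)"
    by (simp add: algebra_simps)
  show "real (2 * k choose (k - 1)) = real (2 * k - 1 choose (k - 1)) + real (2 * k - 1 choose (k - 2))" if "2 \<le> k"
    using that by (cases j) (simp_all add: j)
qed


lemma large_of_eta:
  fixes \<eta> :: real
  assumes "\<eta> \<le> 1 / 10^8" "1 \<le> \<eta> * real k"
  shows "real k \<ge> 10^8"
proof -
  have "1 \<le> (1 / 10^8) * real k" using assms by (meson mult_right_mono of_nat_0_le_iff order_trans)
  then show ?thesis by simp
qed

text \<open>Subtract the mean and split off the degree-one part, with coefficients \<open>b\<close>;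
  by the spectral gap it carries nearly all the variance. The differences d(x,y) = |b x - b y| are
  at most 1. The degree-one part fixes the sum of d^2 and the energy bounds the sum of d by almost
  the same number, so d (1 - d) is small on average. Some \<open>y\<close> then sees only values
  near 0 or 1, and they cannot all be near 0 because the sum of the squares of \<open>b\<close> is
  bounded below.\<close>

lemma near_star_of_low_energy:
  fixes \<eta> M :: real
  assumes fin: "finite V" and cV: "card V = 2 * k + 1" and F: "F \<subseteq> nsets V k"
    and eta: "0 < \<eta>" "\<eta> \<le> 1 / 10^8" "1 \<le> \<eta> * real k"
    and M: "M = real (2 * k + 1 choose k)"
    and energy: "exch_energy V k (\<lambda>A. of_bool (A \<in> F)) \<le> real (k + 1) * M * (1 + 1800 * \<eta>)"
    and half: "\<bar>real (card F) - M / 2\<bar> \<le> 2 * \<eta> * M"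
  shows "\<exists>x\<in>V. real (card {A\<in>F. x \<notin> A}) \<le> M / 50 \<or> real (card {A\<in>F. x \<in> A}) \<le> M / 50"
proof -
  let ?L = "nsets V k"
  let ?f = "\<lambda>A. of_bool (A \<in> F) :: real"
  have fn: "finite ?L" "finite F" using fin finite_imp_finite_nsets F by (metis finite_subset)+
  have k8: "real k \<ge> 10^8" using eta(2,3) by (rule large_of_eta)
  then have k: "2 \<le> k" "0 < k" "k \<noteq> 1" by (auto intro: Suc_leI)
  \<comment> \<open>\<open>N\<close> and \<open>N2\<close> count the \<open>k\<close>-sets through
    one and through two points. Summing a linear function with coefficients of sum zero over the
    sets through \<open>x\<close> gives its coefficient at \<open>x\<close> times
    \<open>C = N - N2\<close>; hence \<open>b = s / C\<close> makes \<open>h\<close> orthogonal to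
    degree one.\<close>
  define C where "C = real (2 * k - 1 choose (k - 1))"
  define N where "N = real (2 * k choose (k - 1))"
  define N2 where "N2 = real (2 * k - 1 choose (k - 2))"
  have C0: "C > 0" and M0: "M > 0" using k by (auto simp: C_def M)
  have rel: "N * (2 * real k + 1) = M * real k" "2 * C * (2 * real k + 1) = M * (real k + 1)" "N = C + N2"
    using middle_binomials[of k] k by (auto simp: N_def C_def N2_def M algebra_simps)
  have cL: "real (card ?L) = M" "real (card V choose k) = M" by (simp_all add: card_nsets cV M)
  have count1: "real (card {A\<in>?L. x \<in> A}) = N" if "x \<in> V" for x
    using card_nsets_superset[OF fin, of "{x}" k] that k cV by (simp add: N_def)
  have count2: "real (card {A\<in>?L. x \<in> A \<and> y \<in> A}) = N2" if "x \<in> V" "y \<in> V" "x \<noteq> y" for x y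
    using card_nsets_superset[OF fin, of "{x,y}" k] that k cV by (simp add: N2_def numeral_2_eq_2)
  define mu where "mu = real (card F) / M"
  define deg where "deg = (\<lambda>x. real (card {A\<in>F. x \<in> A}))"
  define s where "s = (\<lambda>x. deg x - mu * N)"
  define b where "b = (\<lambda>x. s x / C)"
  define g where "g = (\<lambda>A. ?f A - mu)"
  define lin where "lin = (\<lambda>A. \<Sum>x\<in>A. b x)"
  define h where "h = (\<lambda>A. g A - lin A)"
  have sumg: "(\<Sum>A\<in>?L. g A) = 0"
  proof -
    have "(\<Sum>A\<in>?L. ?f A) = real (card F)" using F fn by (simp add: Int_absorb1)
    then show ?thesis using M0 by (simp add: g_def sum_subtractf cL mu_def del: sum_of_bool_eq)
  qed
  have sx: "(\<Sum>A\<in>{A\<in>?L. x \<in> A}. g A) = s x" if "x \<in> V" for x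
  proof -
    have "(\<Sum>A\<in>{A\<in>?L. x \<in> A}. ?f A) = real (card ({A\<in>?L. x \<in> A} \<inter> {A. A \<in> F}))"
      using fn by (subst sum_of_bool_eq) auto
    also have "{A\<in>?L. x \<in> A} \<inter> {A. A \<in> F} = {A\<in>F. x \<in> A}" using F by auto
    finally show ?thesis by (simp add: g_def sum_subtractf count1[OF that] s_def deg_def del: sum_of_bool_eq)
  qed
  have "(\<Sum>x\<in>V. s x) = (\<Sum>x\<in>V. 1 * (\<Sum>A\<in>{A\<in>?L. x \<in> A}. g A))" by (simp add: sx)
  also have "\<dots> = (\<Sum>A\<in>?L. (\<Sum>x\<in>A. 1) * g A)" by (rule sum_nsets_swap[OF fin, symmetric])
  also have "\<dots> = (\<Sum>A\<in>?L. real k * g A)" by (intro sum.cong refl) (simp add: nsetsD)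
  also have "\<dots> = 0" by (simp add: sum_distrib_left[symmetric] sumg)
  finally have sumb: "(\<Sum>x\<in>V. b x) = 0" by (simp add: b_def sum_divide_distrib[symmetric])
  have linx: "(\<Sum>A\<in>{A\<in>?L. x \<in> A}. lin A) = s x" if x: "x \<in> V" for x
  proof -
    have "(\<Sum>A\<in>{A\<in>?L. x \<in> A}. lin A) = (\<Sum>A\<in>?L. (\<Sum>y\<in>A. b y) * of_bool (x \<in> A))"
      unfolding sum.inter_filter[OF fn(1)] by (rule sum.cong[OF refl]) (simp add: lin_def)
    also have "\<dots> = (\<Sum>y\<in>V. b y * (\<Sum>A\<in>{A\<in>?L. y \<in> A}. of_bool (x \<in> A)))"
      by (rule sum_nsets_swap[OF fin])
    also have "\<dots> = (\<Sum>y\<in>V. b y * N2 + (if y = x then b x * C else 0))"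
    proof (intro sum.cong refl)
      fix y assume y: "y \<in> V"
      have "(\<Sum>A\<in>{A\<in>?L. y \<in> A}. of_bool (x \<in> A)) = real (card {A\<in>?L. y \<in> A \<and> x \<in> A})"
        using fn by (subst sum_of_bool_eq) (auto simp: Int_def conj_assoc)
      also have "\<dots> = (if y = x then N else N2)" using count1[OF x] count2[OF y x] by simp
      finally show "b y * (\<Sum>A\<in>{A\<in>?L. y \<in> A}. of_bool (x \<in> A)) = b y * N2 + (if y = x then b x * C else 0)"
        using rel(3) by (simp add: algebra_simps)
    qed
    also have "\<dots> = (\<Sum>y\<in>V. b y) * N2 + b x * C"
      using x fin by (simp add: sum.distrib sum_distrib_right)
    finally show ?thesis using C0 unfolding sumb by (simp add: b_def)
  qed
  have hx: "(\<Sum>A\<in>{A\<in>?L. x \<in> A}. h A) = 0" if "x \<in> V" for x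
    using that by (simp add: h_def sum_subtractf sx linx)
  have gdec: "g = (\<lambda>A. (\<Sum>x\<in>A. b x) + h A)" by (simp add: h_def lin_def)
  have k2: "k + 2 \<le> card V" using k cV by simp
  note dec = exch_energy_add_linear[OF fin k(1) k2 sumb hx, folded gdec lin_def]
  define Q where "Q = sqn V k lin"
  define beta where "beta = (\<Sum>x\<in>V. (b x)\<^sup>2)"
  have Q: "Q = C * beta"
  proof -
    have "Q = (\<Sum>A\<in>?L. (\<Sum>x\<in>A. b x) * lin A)" by (simp add: Q_def sqn_def lin_def power2_eq_square)
    also have "\<dots> = (\<Sum>x\<in>V. b x * s x)" unfolding sum_nsets_swap[OF fin] by (simp add: linx)
    also have "\<dots> = C * beta" using C0
      by (simp add: beta_def sum_distrib_left b_def power2_eq_square)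
    finally show ?thesis .
  qed
  have sumlin: "(\<Sum>A\<in>?L. lin A) = 0"
  proof -
    have "(\<Sum>A\<in>?L. lin A) = (\<Sum>A\<in>?L. (\<Sum>x\<in>A. b x) * 1)" by (simp add: lin_def)
    also have "\<dots> = (\<Sum>x\<in>V. b x * N)" unfolding sum_nsets_swap[OF fin] by (simp add: count1)
    also have "\<dots> = 0" by (simp add: sum_distrib_right[symmetric] sumb)
    finally show ?thesis .
  qed
  define E where "E = exch_energy V k ?f"
  have Eg: "E = exch_energy V k g" unfolding E_def g_def exch_energy_shift ..
  have E1: "exch_energy V k lin \<ge> 2 * (2 * real k + 1) * Q"
    using poincare_exch[OF fin k(2) _ sumlin] k2 cV by (simp add: Q_def algebra_simps)
  have E2: "exch_energy V k h \<ge> 8 * real k * sqn V k h"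
    using exch_energy_level_two[OF fin k(1) k2 hx] cV by simp
  have sq: "sqn V k g = M * (mu * (1 - mu))"
  proof -
    have "sqn V k g = (\<Sum>A\<in>?L. g A * (1 - 2 * mu) + (mu - mu * mu))"
      unfolding sqn_def g_def by (intro sum.cong refl) (auto simp: power2_eq_square algebra_simps)
    also have "\<dots> = M * (mu - mu * mu)"
      by (simp add: sum.distrib sum_distrib_right[symmetric] sumg cL)
    finally show ?thesis by (simp add: algebra_simps)
  qed
  have muh: "\<bar>mu - 1/2\<bar> \<le> 2 * \<eta>"
  proof -
    have "mu - 1/2 = (real (card F) - M / 2) / M" using M0 by (simp add: mu_def field_simps)
    then show ?thesis using half M0 by (simp add: divide_le_eq)
  qed
  define S where "S = mu * (1 - mu)"
  have S: "S = 1/4 - (mu - 1/2)\<^sup>2" by (simp add: S_def power2_eq_square algebra_simps)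
  have S1: "S \<le> 1/4" by (simp add: S)
  have S2: "S \<ge> 1/4 - \<eta>"
  proof -
    have "(mu - 1/2)\<^sup>2 \<le> (2 * \<eta>)\<^sup>2" using muh by (metis abs_ge_zero power2_abs power_mono)
    also have "\<dots> \<le> \<eta>" using eta by (simp add: power2_eq_square)
    finally show ?thesis by (simp add: S)
  qed
  have hS: "sqn V k h = M * S - Q" using dec(1) sq by (simp add: Q_def S_def)
  have "E = exch_energy V k lin + exch_energy V k h" using dec(2) Eg by simp
  then have E3: "E \<ge> 2 * (2 * real k + 1) * Q + 8 * real k * (M * S - Q)" using E1 E2 hS by simp
  have E4: "E \<le> (real k + 1) * M * (1 + 1800 * \<eta>)" using energy by (simp add: E_def algebra_simps)
  define q where "q = Q / M"
  have Qq: "Q = q * M" using M0 by (simp add: q_def)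
  have "(2 * (2 * real k + 1) * q + 8 * real k * (S - q)) * M \<le> ((real k + 1) * (1 + 1800 * \<eta>)) * M"
    using E3 E4 by (simp add: Qq algebra_simps)
  then have E5: "2 * (2 * real k + 1) * q + 8 * real k * (S - q) \<le> (real k + 1) * (1 + 1800 * \<eta>)"
    using M0 by simp
  \<comment> \<open>Eliminating the part of degree at least two leaves q with the coefficient 8 k -
    2 (2 k + 1) = 4 k - 2. The additive constants are absorbed by
    \<open>1 \<le> \<eta> * real k\<close>.\<close>
  have qlow: "q \<ge> 1/4 - 500 * \<eta>"
  proof -
    have "real k * S \<ge> real k * (1/4 - \<eta>)" by (intro mult_left_mono S2) auto
    then have "(4 * real k - 2) * q \<ge> 8 * (real k * (1/4 - \<eta>)) - (real k + 1) * (1 + 1800 * \<eta>)"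
      using E5 by (simp add: algebra_simps)
    also have "8 * (real k * (1/4 - \<eta>)) - (real k + 1) * (1 + 1800 * \<eta>)
        = (4 * real k - 2) * (1/4 - 500 * \<eta>) + (192 * (\<eta> * real k) - 2800 * \<eta> - 1/2)"
      by (simp add: algebra_simps)
    also have "\<dots> \<ge> (4 * real k - 2) * (1/4 - 500 * \<eta>)" using eta by simp
    finally show ?thesis using k8 by (simp add: mult_le_cancel_left)
  qed
  have qup: "q \<le> 1/4"
  proof -
    have "sqn V k h \<ge> 0" by (rule sqn_nonneg)
    then have "q * M \<le> S * M" using hS by (simp add: Qq mult.commute)
    then show ?thesis using M0 S1 by simp
  qed
  have CM: "C \<ge> M / 4" "C \<le> M / 2"
  proof -
    have "C * (4 * real k + 2) = M * (real k + 1)" using rel(2) by (simp add: algebra_simps)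
    then have C: "C = M * ((real k + 1) / (4 * real k + 2))" by (simp add: field_simps)
    have "(real k + 1) / (4 * real k + 2) \<ge> 1/4" "(real k + 1) / (4 * real k + 2) \<le> 1/2"
      by (simp_all add: field_simps)
    then show "C \<ge> M / 4" "C \<le> M / 2" using M0 unfolding C
      by (metis mult.commute mult_le_cancel_left_pos times_divide_eq_right mult.right_neutral)+
  qed
  have beta: "beta \<le> 1" "beta \<ge> 2/5"
  proof -
    have "q * M \<le> 1/4 * M" using qup M0 by (intro mult_right_mono) auto
    then have "beta * C \<le> 1 * C" using Q CM by (simp add: Qq mult.commute)
    then show "beta \<le> 1" using C0 by simp
    have "q * M \<ge> (1/5) * M" using qlow eta M0 by (intro mult_right_mono) auto
    then have "beta * C \<ge> 2/5 * C" using Q CM by (simp add: Qq mult.commute)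
    then show "beta \<ge> 2/5" using C0 by simp
  qed
  define d where "d = (\<lambda>x y. \<bar>b x - b y\<bar>)"
  have dC: "\<bar>deg x - deg y\<bar> = C * d x y" for x y
  proof -
    have "deg x - deg y = C * (b x - b y)" using C0 by (simp add: b_def s_def field_simps)
    then show ?thesis using C0 by (simp add: d_def abs_mult)
  qed
  note bool = exch_energy_indicator_ge[OF fin k(2) F]
  have d1: "d x y \<le> 1" if "x \<in> V" "y \<in> V" for x y
  proof -
    have "C * d x y \<le> C * 1" using bool(2)[OF that] cV dC[of x y] by (simp add: deg_def C_def)
    then show ?thesis using C0 by simp
  qed
  have sumd: "C * (\<Sum>x\<in>V. \<Sum>y\<in>V. d x y) \<le> E"
  proof -
    have "C * (\<Sum>x\<in>V. \<Sum>y\<in>V. d x y) = (\<Sum>x\<in>V. \<Sum>y\<in>V. \<bar>deg x - deg y\<bar>)"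
      by (simp only: dC sum_distrib_left)
    then show ?thesis using bool(1) by (simp only: E_def deg_def)
  qed
  have rowsq: "(\<Sum>x\<in>V. (d x y)\<^sup>2) = beta + real (card V) * (b y)\<^sup>2" for y
    unfolding d_def power2_abs beta_def by (rule sum_sq_diff[OF fin sumb])
  have "(\<Sum>x\<in>V. \<Sum>y\<in>V. (d x y)\<^sup>2) = 2 * real (card V) * beta"
    by (subst sum.swap) (simp add: rowsq sum.distrib sum_distrib_left[symmetric] beta_def[symmetric])
  then have defect: "C * (\<Sum>x\<in>V. \<Sum>y\<in>V. d x y * (1 - d x y)) \<le> E - 2 * (2 * real k + 1) * Q"
    using sumd Q cV by (simp add: sum_subtractf right_diff_distrib power2_eq_square algebra_simps)
  define Def where "Def = (\<Sum>y\<in>V. \<Sum>x\<in>V. d x y * (1 - d x y))"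
  have "C * Def \<le> E - 2 * (2 * real k + 1) * Q" unfolding Def_def using defect by (subst sum.swap)
  also have "\<dots> \<le> ((real k + 1) * (1 + 1800 * \<eta>) - (4 * real k + 2) * q) * M"
    using E4 by (simp add: Qq algebra_simps)
  also have "\<dots> \<le> (3801 * (\<eta> * real k)) * M"
  proof (intro mult_right_mono)
    have "(4 * real k + 2) * q \<ge> (4 * real k + 2) * (1/4 - 500 * \<eta>)" by (intro mult_left_mono qlow) auto
    then show "(real k + 1) * (1 + 1800 * \<eta>) - (4 * real k + 2) * q \<le> 3801 * (\<eta> * real k)"
      using eta by (simp add: algebra_simps)
  qed (use M0 in simp)
  also have "\<dots> \<le> (3801 * (\<eta> * real k)) * (4 * C)" using CM eta by (intro mult_left_mono) auto
  finally have "C * Def \<le> C * (15204 * (\<eta> * real k))" by (simp add: algebra_simps)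
  then have Def: "Def \<le> 15204 * (\<eta> * real k)" using C0 by simp
  \<comment> \<open>Averaging over the 2 k + 1 rows, whose total is at most 15205 \<eta> k; this is
    where \<eta> has to be as small as 10^(-8). Adding the square of \<open>b y\<close> keeps
    \<open>b y\<close> itself near zero, so that a large \<open>d x y\<close> means a large
    \<open>b x\<close>.\<close>
  have "\<exists>y\<in>V. (\<Sum>x\<in>V. d x y * (1 - d x y)) + (b y)\<^sup>2 \<le> 1 / 10^4"
  proof (rule ccontr)
    assume "\<not> ?thesis"
    then have "(\<Sum>y\<in>V. 1 / 10^4) \<le> (\<Sum>y\<in>V. (\<Sum>x\<in>V. d x y * (1 - d x y)) + (b y)\<^sup>2)"
      by (intro sum_mono) (simp add: not_le less_imp_le)
    then have "real (card V) * (1 / 10^4) \<le> Def + beta" by (simp add: Def_def beta_def sum.distrib)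
    then have "(2 * real k + 1) / 10^4 \<le> 15205 * (\<eta> * real k)" using Def beta eta cV by simp
    also have "\<dots> \<le> 15205 * ((1 / 10^8) * real k)" using eta by (intro mult_left_mono mult_right_mono) auto
    finally show False by (simp add: field_simps)
  qed
  then obtain y where y: "y \<in> V" "(\<Sum>x\<in>V. d x y * (1 - d x y)) + (b y)\<^sup>2 \<le> 1 / 10^4" by blast
  have dd: "d x y * (1 - d x y) \<ge> 0" if "x \<in> V" for x
    using d1[OF that y(1)] by (auto simp: d_def)
  then have sd: "(\<Sum>x\<in>V. d x y * (1 - d x y)) \<ge> 0" by (intro sum_nonneg) auto
  have by': "\<bar>b y\<bar> \<le> 1/100"
  proof -
    have "(b y)\<^sup>2 \<le> (1/100)\<^sup>2" using y(2) sd by (simp add: power2_eq_square)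
    then show ?thesis by (metis abs_le_square_iff abs_of_nonneg zero_le_divide_1_iff zero_le_numeral)
  qed
  \<comment> \<open>Otherwise d^2 is at most 100 d (1 - d) along the row, and the sum of d^2, which
    is at least \<open>beta\<close>, would be at most 1/100.\<close>
  have "\<exists>x\<in>V. d x y \<ge> 99/100"
  proof (rule ccontr)
    assume "\<not> ?thesis"
    then have lt: "d x y < 99/100" if "x \<in> V" for x using that by force
    have "(\<Sum>x\<in>V. (d x y)\<^sup>2) \<le> (\<Sum>x\<in>V. 100 * (d x y * (1 - d x y)))"
    proof (intro sum_mono)
      fix x assume x: "x \<in> V"
      have "d x y * (d x y) \<le> d x y * (100 * (1 - d x y))"
        using lt[OF x] by (intro mult_left_mono) (auto simp: d_def)
      then show "(d x y)\<^sup>2 \<le> 100 * (d x y * (1 - d x y))" by (simp add: power2_eq_square algebra_simps)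
    qed
    also have "\<dots> = 100 * (\<Sum>x\<in>V. d x y * (1 - d x y))" by (simp add: sum_distrib_left)
    also have "\<dots> \<le> 100 * (1 / 10^4)"
      using y(2) zero_le_power2[of "b y"] by (intro mult_left_mono) linarith+
    finally have "beta + real (card V) * (b y)\<^sup>2 \<le> 1/100" unfolding rowsq by simp
    moreover have "0 \<le> real (card V) * (b y)\<^sup>2" by simp
    ultimately have "beta \<le> 1/100" by linarith
    then show False using beta by simp
  qed
  then obtain x where x: "x \<in> V" "d x y \<ge> 99/100" by blast
  then have bx: "b x \<ge> 49/50 \<or> b x \<le> - (49/50)" using by' by (auto simp: d_def abs_if split: if_splits)
  have degx: "deg x = mu * N + C * b x" using C0 by (simp add: b_def s_def)
  have Ft: "real (card {A\<in>F. x \<notin> A}) = mu * M - deg x"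
  proof -
    have "card F = card {A\<in>F. x \<notin> A} + card {A\<in>F. x \<in> A}"
      using fn by (subst card_Un_disjoint[symmetric]) (auto intro!: arg_cong[where f=card])
    then show ?thesis using M0 by (simp add: mu_def deg_def)
  qed
  have MN: "M - N = 2 * C"
  proof -
    have "(M - N) * (2 * real k + 1) = 2 * C * (2 * real k + 1)" using rel by (simp add: algebra_simps)
    then show ?thesis by simp
  qed
  have N2C: "N \<le> 2 * C"
  proof -
    have "N * (2 * real k + 1) \<le> 2 * C * (2 * real k + 1)" using rel M0 by (simp add: algebra_simps)
    then show ?thesis by simp
  qed
  have small: "C * (2 * mu - 49/50) \<le> M / 50"
  proof -
    have "C * (2 * mu - 49/50) \<le> C * (1/25)" using muh eta C0 by (intro mult_left_mono) auto
    then show ?thesis using CM by simp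
  qed
  \<comment> \<open>A coefficient near 1 means that nearly all of \<open>F\<close> contains
    \<open>x\<close>, one near -1 that nearly none does. Low energy allows both; for cliques the
    second is excluded later.\<close>
  from bx show ?thesis
  proof
    assume "b x \<ge> 49/50"
    then have "C * b x \<ge> C * (49/50)" using C0 by simp
    then have "real (card {A\<in>F. x \<notin> A}) \<le> mu * (M - N) - C * (49/50)" unfolding Ft degx by (simp add: algebra_simps)
    also have "\<dots> = C * (2 * mu - 49/50)" unfolding MN by (simp add: algebra_simps)
    finally show ?thesis using small x(1) by force
  next
    assume "b x \<le> - (49/50)"
    then have "C * b x \<le> C * (- (49/50))" using C0 by (intro mult_left_mono) auto
    moreover have "mu * N \<le> mu * (2 * C)" using N2C muh eta by (intro mult_left_mono) auto
    ultimately have "deg x \<le> C * (2 * mu - 49/50)" unfolding degx by (simp add: algebra_simps)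
    then show ?thesis using small x(1) by (force simp: deg_def)
  qed
qed

section \<open>Hypergraphs with balanced edge weights\<close>


text \<open>The \<open>k\<close>-subsets of \<open>T\<close> are the Kneser neighbours of
  \<open>V - T\<close>. So \<open>sparse\<close> bounds the missing neighbours of every
  \<open>k\<close>-set, and through complements it serves both levels of the inclusion
  graph.\<close>

locale sparse_complement =
  fixes V :: "'a set" and k r :: nat and H :: "'a set set" and \<eta> :: real
  assumes fin: "finite V" and card_V: "card V = 2 * k + 1" and H: "H \<subseteq> nsets V k"
    and eta: "0 < \<eta>" "\<eta> \<le> 1 / 10^8" "1 \<le> \<eta> * real k"
    and r: "real r \<le> \<eta> * real k"
    and sparse: "T \<in> nsets V (Suc k) \<Longrightarrow> card {z\<in>T. T - {z} \<notin> H} \<le> r"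
begin

definition M :: real where "M = real (2 * k + 1 choose k)"

text \<open>The inclusion graph of levels \<open>k\<close> and \<open>k + 1\<close> is the bipartite
  double cover of the Kneser graph: a \<open>k\<close>-set occurs once as itself and once as its
  complement, so a missing set removes one vertex from each level.\<close>

definition removed :: "'a set set" where
  "removed = {A\<in>nsets V k. A \<notin> H} \<union> {T\<in>nsets V (Suc k). V - T \<notin> H}"

lemma k_large: "real k \<ge> 10^8" using eta(2,3) by (rule large_of_eta)

lemma k_pos: "0 < k" using k_large by (cases k) auto

lemma r_small: "100 * r \<le> k"
proof -
  have "real (100 * r) \<le> 100 * (\<eta> * real k)" using r by simp
  also have "\<dots> \<le> 100 * ((1/10^8) * real k)" using eta by (intro mult_left_mono mult_right_mono) auto
  also have "\<dots> \<le> real k" by simp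
  finally show ?thesis by (simp only: of_nat_le_iff)
qed

lemma M_pos: "M > 0" by (simp add: M_def)

lemma finite_H: "finite H" using H finite_imp_finite_nsets[OF fin] by (rule finite_subset)

lemma removed_lower: "A \<in> nsets V k \<Longrightarrow> A \<in> removed \<longleftrightarrow> A \<notin> H"
  by (auto simp: removed_def nsets_def)

lemma removed_upper: "T \<in> nsets V (Suc k) \<Longrightarrow> T \<in> removed \<longleftrightarrow> V - T \<notin> H"
  by (auto simp: removed_def nsets_def)

lemma compl_lower: "A \<in> nsets V k \<Longrightarrow> V - A \<in> nsets V (Suc k)"
  using fin card_V by (auto simp: nsets_def card_Diff_subset)

lemma compl_upper: "T \<in> nsets V (Suc k) \<Longrightarrow> V - T \<in> nsets V k"
  using fin card_V by (auto simp: nsets_def card_Diff_subset)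

lemma removed_up_sparse:
  assumes A: "A \<in> nsets V k"
  shows "card {y\<in>V-A. insert y A \<in> removed} \<le> r"
proof -
  have "{y\<in>V-A. insert y A \<in> removed} = {z\<in>V-A. (V-A) - {z} \<notin> H}"
  proof (rule Collect_cong, rule conj_cong[OF refl])
    fix y assume y: "y \<in> V - A"
    have "insert y A \<in> nsets V (Suc k)" using A y by (auto simp: nsets_def)
    moreover have "V - insert y A = (V - A) - {y}" by auto
    ultimately show "(insert y A \<in> removed) = ((V-A) - {y} \<notin> H)" by (simp add: removed_upper)
  qed
  then show ?thesis using sparse[OF compl_lower[OF A]] by simp
qed

lemma removed_down_sparse:
  assumes T: "T \<in> nsets V (Suc k)"
  shows "card {z\<in>T. T - {z} \<in> removed} \<le> r"
proof -
  have "{z\<in>T. T - {z} \<in> removed} = {z\<in>T. T - {z} \<notin> H}"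
    using T by (intro Collect_cong conj_cong refl removed_lower nsets_removeI)
  then show ?thesis using sparse[OF T] by simp
qed

section \<open>Filling in missing sets by majority\<close>

text \<open>A tie gives \<open>True\<close>, and so does the absence of any present
  neighbour.\<close>

definition majority_ext :: "('a set \<Rightarrow> bool) \<Rightarrow> 'a set \<Rightarrow> bool" where
  "majority_ext l A = (if A \<notin> removed then l A
     else if card A = k then card {y\<in>V-A. insert y A \<notin> removed} \<le> 2 * card {y\<in>V-A. insert y A \<notin> removed \<and> l (insert y A)}
     else card {z\<in>A. A - {z} \<notin> removed} \<le> 2 * card {z\<in>A. A - {z} \<notin> removed \<and> l (A - {z})})"

lemma card_majority:
  assumes "finite X" and m: "m \<longleftrightarrow> card X \<le> 2 * card {x\<in>X. P x}"
  shows "card X \<le> 2 * card {x\<in>X. P x = m}"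
proof (cases m)
  case True then show ?thesis using m by simp
next
  case False
  have "card X = card {x\<in>X. P x} + card {x\<in>X. \<not> P x}"
    using assms(1) by (subst card_Un_disjoint[symmetric]) (auto intro!: arg_cong[where f=card])
  then show ?thesis using False m by simp
qed

lemma majority_labelling_ext: "majority_labelling V k r removed (majority_ext l)"
proof
  fix A assume A: "A \<in> nsets V k" "A \<in> removed"
  let ?X = "{y\<in>V-A. insert y A \<notin> removed}"
  have "majority_ext l A \<longleftrightarrow> card ?X \<le> 2 * card {y\<in>?X. l (insert y A)}"
    using A by (simp add: majority_ext_def nsetsD conj_assoc)
  then have "card ?X \<le> 2 * card {y\<in>?X. l (insert y A) = majority_ext l A}"
    using fin by (intro card_majority) auto
  also have "{y\<in>?X. l (insert y A) = majority_ext l A} = {y\<in>V-A. insert y A \<notin> removed \<and> majority_ext l (insert y A) = majority_ext l A}"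
    by (auto simp: majority_ext_def[of l "insert _ A"])
  finally show "card ?X \<le> 2 * card {y\<in>V-A. insert y A \<notin> removed \<and> majority_ext l (insert y A) = majority_ext l A}" .
next
  fix T assume T: "T \<in> nsets V (Suc k)" "T \<in> removed"
  let ?X = "{z\<in>T. T - {z} \<notin> removed}"
  have "majority_ext l T \<longleftrightarrow> card ?X \<le> 2 * card {z\<in>?X. l (T - {z})}"
    using T by (simp add: majority_ext_def nsetsD conj_assoc)
  then have "card ?X \<le> 2 * card {z\<in>?X. l (T - {z}) = majority_ext l T}"
    using T by (intro card_majority) (auto dest: nsetsD)
  also have "{z\<in>?X. l (T - {z}) = majority_ext l T} = {z\<in>T. T - {z} \<notin> removed \<and> majority_ext l (T - {z}) = majority_ext l T}"
    by (auto simp: majority_ext_def[of l "T - {_}"])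
  finally show "card ?X \<le> 2 * card {z\<in>T. T - {z} \<notin> removed \<and> majority_ext l (T - {z}) = majority_ext l T}" .
qed (use fin card_V k_pos r_small removed_up_sparse removed_down_sparse in auto)

text \<open>An upper set \<open>T\<close> stands for the \<open>k\<close>-set \<open>V - T\<close>, so that inclusion of a \<open>k\<close>-set in \<open>T\<close> is disjointness.\<close>

lemma filled_family:
  assumes F1: "F1 \<subseteq> H" and F2: "F2 \<subseteq> H"
  shows "\<exists>X. X \<subseteq> nsets V k \<and> X \<inter> H = F1 \<and>
    exch_energy V k (\<lambda>A. of_bool (A \<in> X))
      \<le> 2 * real (k + 1) * (1 + 200 * \<eta>) * real (card {(A,B). A \<in> H \<and> B \<in> H \<and> A \<inter> B = {} \<and> (A \<in> F1) \<noteq> (B \<in> F2)}) \<and>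
    (\<forall>x\<in>V. (\<forall>A\<in>F1. x \<notin> A) \<longrightarrow> (\<forall>B\<in>F2. x \<in> B) \<longrightarrow> (\<forall>A\<in>X. x \<notin> A))"
proof -
  \<comment> \<open>Two families are needed since the two sides of a disjoint pair are judged
    differently: for a clique \<open>F\<close> with \<open>F1 = F\<close> and
    \<open>F2 = H - F\<close>, a pair agrees when exactly one of its members is in
    \<open>F\<close>.\<close>
  define l0 where "l0 = (\<lambda>A. if card A = k then A \<in> F1 else V - A \<in> F2)"
  define l where "l = majority_ext l0"
  interpret majority_labelling V k r removed l unfolding l_def by (rule majority_labelling_ext)
  define X where "X = {A\<in>nsets V k. l A}"
  define P where "P = {(A,B). A \<in> H \<and> B \<in> H \<and> A \<inter> B = {} \<and> (A \<in> F1) \<noteq> (B \<in> F2)}"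
  have fP: "finite P" by (rule finite_subset[of _ "H \<times> H"]) (use finite_H in \<open>auto simp: P_def\<close>)
  have low: "l A \<longleftrightarrow> A \<in> F1" if "A \<in> H" for A
    using that H removed_lower[of A] by (auto simp: l_def majority_ext_def l0_def nsets_def)
  have upp: "l T \<longleftrightarrow> V - T \<in> F2" if "T \<in> nsets V (Suc k)" "V - T \<in> H" for T
    using that removed_upper[of T] by (auto simp: l_def majority_ext_def l0_def nsets_def)
  have "card present_bad \<le> card P"
  proof (rule card_inj_on_le[where f="\<lambda>(A,y). (A, V - insert y A)"])
    show "inj_on (\<lambda>(A,y). (A, V - insert y A)) present_bad"
      by (auto simp: inj_on_def present_bad_def layer_edges_def)
    show "(\<lambda>(A,y). (A, V - insert y A)) ` present_bad \<subseteq> P"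
    proof clarify
      fix A y assume "(A,y) \<in> present_bad"
      then have *: "A \<in> nsets V k" "y \<in> V - A" "l A \<noteq> l (insert y A)" "A \<notin> removed" "insert y A \<notin> removed"
        by (auto simp: present_bad_def layer_edges_def)
      have T: "insert y A \<in> nsets V (Suc k)" using * by (auto simp: nsets_def)
      have "A \<in> H" "V - insert y A \<in> H" using * T by (auto simp: removed_lower removed_upper)
      then show "(A, V - insert y A) \<in> P" using * low upp[OF T] by (auto simp: P_def)
    qed
  qed (rule fP)
  have "real k * real k * real (card removed_bad) \<le> 192 * real (k + 1) * real r * real (card present_bad)"
  proof -
    have "real (k\<^sup>2 * card removed_bad) \<le> real (192 * (k + 1) * r * card present_bad)"
      using removed_bad_le by (simp only: of_nat_le_iff)
    then show ?thesis by (simp add: power2_eq_square)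
  qed
  also have "\<dots> \<le> 192 * real (k + 1) * (\<eta> * real k) * real (card present_bad)"
    using r by (intro mult_right_mono mult_left_mono) auto
  finally have "real k * (real k * real (card removed_bad)) \<le> real k * (192 * real (k + 1) * \<eta> * real (card present_bad))"
    by (simp add: algebra_simps)
  then have "real k * real (card removed_bad) \<le> 192 * real (k + 1) * \<eta> * real (card present_bad)"
    using k_large by simp
  also have "\<dots> \<le> (200 * real k) * \<eta> * real (card present_bad)"
    using k_large eta by (intro mult_right_mono) auto
  finally have "real k * real (card removed_bad) \<le> real k * (200 * \<eta> * real (card present_bad))" by simp
  then have rb: "real (card removed_bad) \<le> 200 * \<eta> * real (card present_bad)" using k_large by simp
  have "(\<Sum>T\<in>nsets V (Suc k). card {a\<in>T. l (T - {a}) \<noteq> l T})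
     = (\<Sum>T\<in>nsets V (Suc k). \<Sum>a\<in>T. of_bool (l (T - {a}) \<noteq> l (insert a (T - {a}))))"
    by (intro sum.cong refl) (auto simp: insert_absorb nsetsD Int_def intro!: arg_cong[where f=card])
  also have "\<dots> = (\<Sum>A\<in>nsets V k. \<Sum>a\<in>V-A. of_bool (l A \<noteq> l (insert a A)))"
    by (rule sum_nsets_Suc[OF fin, symmetric])
  also have "\<dots> = (\<Sum>e\<in>layer_edges V k. of_bool (case e of (A,y) \<Rightarrow> l A \<noteq> l (insert y A)))"
    unfolding layer_edges_def using fin finite_imp_finite_nsets[OF fin] by (subst sum.Sigma) (simp_all add: case_prod_unfold del: sum_of_bool_eq)
  also have "\<dots> = card (removed_bad \<union> present_bad)"
    using finite_layer_edges[OF fin] by (auto simp: removed_bad_def present_bad_def intro!: arg_cong[where f=card])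
  also have "\<dots> \<le> card removed_bad + card present_bad" by (rule card_Un_le)
  finally have "real (\<Sum>T\<in>nsets V (Suc k). card {a\<in>T. l (T - {a}) \<noteq> l T}) \<le> real (card removed_bad + card present_bad)"
    by (simp only: of_nat_le_iff)
  also have "\<dots> \<le> (1 + 200 * \<eta>) * real (card present_bad)" using rb by (simp add: algebra_simps)
  also have "\<dots> \<le> (1 + 200 * \<eta>) * real (card P)"
    using \<open>card present_bad \<le> card P\<close> eta by (intro mult_left_mono) auto
  finally have mm: "(\<Sum>T\<in>nsets V (Suc k). real (card {a\<in>T. l (T - {a}) \<noteq> l T})) \<le> (1 + 200 * \<eta>) * real (card P)"
    by simp
  have "exch_energy V k (\<lambda>A. of_bool (A \<in> X)) = exch_energy V k (\<lambda>A. of_bool (l A))"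
    unfolding exch_energy_def
  proof (intro sum.cong[OF refl])
    fix S a b assume "S \<in> nsets V (k - 1)" "a \<in> V - S" "b \<in> V - S"
    then have "insert a S \<in> nsets V k" "insert b S \<in> nsets V k" using k_pos by (auto simp: nsets_def)
    then show "((of_bool (insert a S \<in> X) :: real) - of_bool (insert b S \<in> X))\<^sup>2 = (of_bool (l (insert a S)) - of_bool (l (insert b S)))\<^sup>2"
      by (simp add: X_def)
  qed
  also have "\<dots> \<le> 2 * real (Suc k) * (\<Sum>T\<in>nsets V (Suc k). real (card {a\<in>T. l (T - {a}) \<noteq> l T}))"
    by (rule exch_energy_le_mismatch[OF fin k_pos])
  also have "\<dots> \<le> 2 * real (Suc k) * ((1 + 200 * \<eta>) * real (card P))"
    using mm by (intro mult_left_mono) auto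
  finally have en: "exch_energy V k (\<lambda>A. of_bool (A \<in> X)) \<le> 2 * real (k + 1) * (1 + 200 * \<eta>) * real (card P)" by simp
  show ?thesis
  proof (intro exI[of _ X] conjI ballI impI)
    show "X \<subseteq> nsets V k" by (auto simp: X_def)
    show "X \<inter> H = F1" using low F1 H by (auto simp: X_def)
    show "exch_energy V k (\<lambda>A. of_bool (A \<in> X))
      \<le> 2 * real (k + 1) * (1 + 200 * \<eta>) * real (card {(A,B). A \<in> H \<and> B \<in> H \<and> A \<inter> B = {} \<and> (A \<in> F1) \<noteq> (B \<in> F2)})"
      using en by (simp add: P_def)
    fix x A assume x: "x \<in> V" "\<forall>A\<in>F1. x \<notin> A" "\<forall>B\<in>F2. x \<in> B" and A: "A \<in> X"
    \<comment> \<open>The upper neighbours of a set containing \<open>x\<close> contain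
      \<open>x\<close>, so their complements are not in \<open>F2\<close> and their labels are
      \<open>False\<close>. Majority could then give \<open>True\<close> only without any present
      neighbour, which is impossible because r < k + 1.\<close>
    show "x \<notin> A"
    proof
      assume xA: "x \<in> A"
      have A': "A \<in> nsets V k" "l A" using A by (auto simp: X_def)
      have "A \<in> removed" using A' xA x(2) low removed_lower by blast
      have empty: "{y\<in>V-A. insert y A \<notin> removed \<and> l0 (insert y A)} = {}"
        using A' x(3) xA by (auto simp: l0_def nsets_def)
      have "card {y\<in>V-A. insert y A \<notin> removed} \<le> 2 * card {y\<in>V-A. insert y A \<notin> removed \<and> l0 (insert y A)}"
        using A' \<open>A \<in> removed\<close> by (simp only: l_def majority_ext_def nsetsD(3)[OF A'(1)] if_True if_False not_not simp_thms)
      then have "card {y\<in>V-A. insert y A \<notin> removed} = 0" unfolding empty by simp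
      moreover have "card (V - A) = card {y\<in>V-A. insert y A \<notin> removed} + card {y\<in>V-A. insert y A \<in> removed}"
        using fin by (subst card_Un_disjoint[symmetric]) (auto intro!: arg_cong[where f=card])
      ultimately have "card (V - A) \<le> r" using removed_up_sparse[OF A'(1)] by simp
      moreover have "card (V - A) = Suc k" using compl_lower[OF A'(1)] by (rule nsetsD)
      ultimately show False using r_small by simp
    qed
  qed
qed

text \<open>Average \<open>sparse\<close> over all \<open>k + 1\<close>-sets: there are M of them,
  and each missing set lies in k + 1.\<close>

lemma card_missing: "real (card (nsets V k - H)) \<le> \<eta> * M"
proof -
  let ?L = "nsets V k"
  have fn: "finite ?L" by (rule finite_imp_finite_nsets[OF fin])
  have "real (card ?L) = M" by (simp add: card_nsets card_V M_def)
  have cU: "real (card (nsets V (Suc k))) = M" "real (card V choose Suc k) = M"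
    using binomial_symmetric[of "Suc k" "2*k+1"] by (simp_all add: card_nsets card_V M_def)
  have "real (k + 1) * real (card (?L - H)) = (real (card V) - real k) * (\<Sum>A\<in>?L. of_bool (A \<notin> H))"
    using fn card_V by (simp add: set_diff_eq Int_def)
  also have "\<dots> = (\<Sum>T\<in>nsets V (Suc k). \<Sum>z\<in>T. of_bool (T - {z} \<notin> H))"
    by (rule sum_remove_one[OF fin, symmetric])
  also have "\<dots> = (\<Sum>T\<in>nsets V (Suc k). real (card {z\<in>T. T - {z} \<notin> H}))"
    by (intro sum.cong refl) (auto simp: nsetsD Int_def)
  also have "\<dots> \<le> (\<Sum>T\<in>nsets V (Suc k). real r)"
    by (intro sum_mono) (simp add: sparse)
  also have "\<dots> = M * real r" by (simp add: cU)
  also have "\<dots> \<le> M * (\<eta> * real k)" using r M_pos by (intro mult_left_mono) auto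
  also have "\<dots> \<le> M * (\<eta> * real (k + 1))" using eta M_pos by (intro mult_left_mono) auto
  finally have "real (k + 1) * real (card (?L - H)) \<le> real (k + 1) * (\<eta> * M)" by (simp add: algebra_simps)
  then show ?thesis by (simp del: of_nat_add of_nat_Suc)
qed

end


text \<open>A set of \<open>X\<close> can exchange any of its k points for \<open>x\<close>, and the
  result is never in \<open>X\<close>. These pairs, in both orders, give 2 k |X|; exchanges inside
  \<open>V - {x}\<close> give the rest.\<close>

lemma exch_energy_avoiding_point:
  assumes fin: "finite V" and x: "x \<in> V" and k: "0 < k" and X: "X \<subseteq> nsets V k" "\<And>A. A \<in> X \<Longrightarrow> x \<notin> A"
  shows "exch_energy V k (\<lambda>A. of_bool (A \<in> X)) \<ge> 2 * real k * real (card X) + exch_energy (V - {x}) k (\<lambda>A. of_bool (A \<in> X))"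
proof -
  let ?f = "\<lambda>A. of_bool (A \<in> X) :: real"
  let ?W = "V - {x}"
  let ?L = "nsets ?W (k - 1)"
  obtain j where j: "k = Suc j" using k by (cases k) auto
  have fW: "finite ?W" using fin by simp
  have fn: "finite (nsets V i)" for i using fin by (rule finite_imp_finite_nsets)
  have sub: "?L \<subseteq> nsets V (k - 1)" by (auto simp: nsets_def)
  have XW: "X \<subseteq> nsets ?W k" using X by (auto simp: nsets_def)
  have fx: "?f (insert x S) = 0" for S using X by auto
  have row: "(\<Sum>a\<in>V-S. \<Sum>b\<in>V-S. (?f (insert a S) - ?f (insert b S))\<^sup>2)
     = 2 * (\<Sum>a\<in>?W-S. ?f (insert a S)) + (\<Sum>a\<in>?W-S. \<Sum>b\<in>?W-S. (?f (insert a S) - ?f (insert b S))\<^sup>2)"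
    if S: "S \<in> ?L" for S
  proof -
    have e: "V - S = insert x (?W - S)" "x \<notin> ?W - S" "finite (?W - S)" using S x fin by (auto simp: nsets_def)
    have sq: "(?f A)\<^sup>2 = ?f A" for A by simp
    show ?thesis
      unfolding e(1) using e(2,3) by (simp add: fx sum.distrib sq del: sum_of_bool_eq of_bool_eq_0_iff)
  qed
  have "2 * real k * real (card X) + exch_energy ?W k ?f
     = 2 * (\<Sum>S\<in>?L. \<Sum>a\<in>?W-S. ?f (insert a S)) + exch_energy ?W k ?f"
  proof -
    have "(\<Sum>S\<in>?L. \<Sum>a\<in>?W-S. ?f (insert a S)) = real k * (\<Sum>A\<in>nsets ?W k. ?f A)"
      using sum_insert_one[OF fW, of ?f j] by (simp only: j diff_Suc_1)
    also have "(\<Sum>A\<in>nsets ?W k. ?f A) = real (card X)"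
      using XW finite_imp_finite_nsets[OF fW, of k] by (simp add: Int_absorb1)
    finally show ?thesis by simp
  qed
  also have "\<dots> = (\<Sum>S\<in>?L. \<Sum>a\<in>V-S. \<Sum>b\<in>V-S. (?f (insert a S) - ?f (insert b S))\<^sup>2)"
    unfolding exch_energy_def sum_distrib_left[of 2 _ ?L] sum.distrib[symmetric]
    by (rule sum.cong[OF refl], subst row) simp_all
  also have "\<dots> \<le> exch_energy V k ?f"
    unfolding exch_energy_def by (rule sum_mono2[OF fn sub]) (intro sum_nonneg zero_le_power2)
  finally show ?thesis .
qed

section \<open>Maximum cliques by weighted counting of disjoint pairs\<close>

text \<open>The weights themselves may vary by O(\<eta>), but the weighted degrees, of size about k,
  agree up to O(\<eta>) without a factor k. The constants 6 and 530 are those obtained for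
  \<open>potential\<close>.\<close>

locale balanced_hypergraph = sparse_complement V k r H \<eta>
  for V :: "'a set" and k r :: nat and H :: "'a set set" and \<eta> :: real +
  fixes D :: real and \<phi> :: "'a set \<Rightarrow> real"
  assumes D: "real k / 2 \<le> D" "D \<le> real k + 1"
    and phi: "A \<in> H \<Longrightarrow> \<bar>\<phi> A\<bar> \<le> 6 * \<eta>"
    and balanced: "A \<in> H \<Longrightarrow> \<bar>(\<Sum>B\<in>{B\<in>H. A \<inter> B = {}}. 1 + \<phi> A + \<phi> B) - D\<bar> \<le> 530 * \<eta>"
begin

definition W :: "'a set set \<Rightarrow> 'a set set \<Rightarrow> real" where
  "W X Y = (\<Sum>A\<in>X. \<Sum>B\<in>Y. if A \<inter> B = {} then 1 + \<phi> A + \<phi> B else 0)"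

lemma W_sym: "W X Y = W Y X"
  unfolding W_def by (subst sum.swap) (auto intro!: sum.cong simp: Int_commute)

lemma W_split:
  assumes "Y \<subseteq> H"
  shows "W X H = W X Y + W X (H - Y)"
  unfolding W_def sum.distrib[symmetric]
  by (intro sum.cong refl) (simp add: sum.subset_diff[OF assms finite_H] add.commute)

lemma W_bounds:
  assumes "X \<subseteq> H"
  shows "W X H \<le> (D + 530 * \<eta>) * real (card X)" "(D - 530 * \<eta>) * real (card X) \<le> W X H"
proof -
  have row: "\<bar>(\<Sum>B\<in>H. if A \<inter> B = {} then 1 + \<phi> A + \<phi> B else 0) - D\<bar> \<le> 530 * \<eta>" if "A \<in> X" for A
  proof -
    have "(\<Sum>B\<in>H. if A \<inter> B = {} then 1 + \<phi> A + \<phi> B else 0) = (\<Sum>B\<in>{B\<in>H. A \<inter> B = {}}. 1 + \<phi> A + \<phi> B)"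
      by (rule sum.inter_filter[OF finite_H, symmetric])
    then show ?thesis using balanced[of A] that assms by auto
  qed
  have "W X H \<le> (\<Sum>A\<in>X. D + 530 * \<eta>)" unfolding W_def using row by (intro sum_mono) (fastforce simp: abs_le_iff)
  then show "W X H \<le> (D + 530 * \<eta>) * real (card X)" by (simp add: mult.commute)
  have "(\<Sum>A\<in>X. D - 530 * \<eta>) \<le> W X H" unfolding W_def using row by (intro sum_mono) (fastforce simp: abs_le_iff)
  then show "(D - 530 * \<eta>) * real (card X) \<le> W X H" by (simp add: mult.commute)
qed

lemma W_count:
  assumes X: "X \<subseteq> H" and Y: "Y \<subseteq> H"
  shows "(1 - 12 * \<eta>) * real (card {(A,B). A \<in> X \<and> B \<in> Y \<and> A \<inter> B = {}}) \<le> W X Y"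
    "W X Y \<le> (1 + 12 * \<eta>) * real (card {(A,B). A \<in> X \<and> B \<in> Y \<and> A \<inter> B = {}})"
proof -
  have f: "finite X" "finite Y" using finite_H X Y finite_subset by blast+
  let ?P = "{(A,B). A \<in> X \<and> B \<in> Y \<and> A \<inter> B = {}}"
  have P: "?P = {p\<in>X \<times> Y. fst p \<inter> snd p = {}}" by auto
  have "W X Y = (\<Sum>p\<in>X \<times> Y. if fst p \<inter> snd p = {} then 1 + \<phi> (fst p) + \<phi> (snd p) else 0)"
    unfolding W_def using f by (subst sum.Sigma) (simp_all add: case_prod_unfold)
  also have "\<dots> = (\<Sum>p\<in>?P. 1 + \<phi> (fst p) + \<phi> (snd p))"
    unfolding P using f by (intro sum.inter_filter[symmetric]) auto
  finally have W: "W X Y = (\<Sum>p\<in>?P. 1 + \<phi> (fst p) + \<phi> (snd p))" .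
  have b: "\<bar>\<phi> (fst p)\<bar> \<le> 6 * \<eta>" "\<bar>\<phi> (snd p)\<bar> \<le> 6 * \<eta>" if "p \<in> ?P" for p
    using that X Y phi by auto
  have "(\<Sum>p\<in>?P. 1 - 12 * \<eta>) \<le> W X Y" unfolding W
    by (intro sum_mono) (use b in \<open>fastforce simp: abs_le_iff\<close>)
  then show "(1 - 12 * \<eta>) * real (card ?P) \<le> W X Y" by (simp add: mult.commute)
  have "W X Y \<le> (\<Sum>p\<in>?P. 1 + 12 * \<eta>)" unfolding W
    by (intro sum_mono) (use b in \<open>fastforce simp: abs_le_iff\<close>)
  then show "W X Y \<le> (1 + 12 * \<eta>) * real (card ?P)" by (simp add: mult.commute)
qed

lemma W_empty:
  assumes "\<And>A B. A \<in> X \<Longrightarrow> B \<in> Y \<Longrightarrow> A \<inter> B \<noteq> {}"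
  shows "W X Y = 0"
  unfolding W_def using assms by (intro sum.neutral) auto

lemma clique_meets:
  assumes "F \<subseteq> H" "intersecting F" "A \<in> F" "B \<in> F"
  shows "A \<inter> B \<noteq> {}"
proof (cases "A = B")
  case True
  then show ?thesis using assms H k_pos by (auto simp: nsets_def)
next
  case False
  then show ?thesis using assms by (auto simp: intersecting_def pairwise_def disjnt_def)
qed

text \<open>No weight lies inside \<open>F\<close>, so all the weight at \<open>F\<close> goes to
  \<open>H - F\<close>. What is left inside \<open>H - F\<close> is the difference of two nearly
  regular totals, in which the main terms cancel up to D (|H| - 2 |F|).\<close>

lemma disjoint_pairs_outside_clique:
  assumes F: "F \<subseteq> H" "intersecting F"
  shows "W (H - F) (H - F) \<le> (D + 530 * \<eta>) * real (card (H - F)) - (D - 530 * \<eta>) * real (card F)"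
    "0 \<le> W (H - F) (H - F)"
proof -
  have "W F F = 0" by (rule W_empty) (use clique_meets[OF F] in auto)
  then have "W F H = W F (H - F)" using W_split[OF F(1), of F] by simp
  moreover have "W (H - F) H = W (H - F) F + W (H - F) (H - F)" by (rule W_split[OF F(1)])
  moreover have "W (H - F) F = W F (H - F)" by (rule W_sym)
  ultimately have "W (H - F) (H - F) = W (H - F) H - W F H" by simp
  then show "W (H - F) (H - F) \<le> (D + 530 * \<eta>) * real (card (H - F)) - (D - 530 * \<eta>) * real (card F)"
    using W_bounds(1)[of "H - F"] W_bounds(2)[OF F(1)] by auto
  have "0 \<le> (1 - 12 * \<eta>) * real (card {(A,B). A \<in> H - F \<and> B \<in> H - F \<and> A \<inter> B = {}})"
    using eta by (intro mult_nonneg_nonneg) auto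
  also have "\<dots> \<le> W (H - F) (H - F)" by (rule W_count) auto
  finally show "0 \<le> W (H - F) (H - F)" .
qed

text \<open>The size of \<open>F\<close> gives |L| <= |J|. Almost all weight at \<open>J\<close>
  goes to \<open>L\<close>, and since \<open>L\<close> is no larger, little of its own weight goes
  elsewhere; so \<open>J\<close> and \<open>L\<close> have about 2 |J| mismatches. The filled family
  \<open>X\<close> then has energy at most about 4 k |X|, while a small family avoiding
  \<open>x\<close> needs 5.8 k |X|, so \<open>X\<close> is empty.\<close>

lemma clique_near_star_in_star:
  assumes F: "F \<subseteq> H" "intersecting F" and x: "x \<in> V"
    and big: "card (star H x) \<le> card F" and near: "real (card {A\<in>F. x \<notin> A}) \<le> M / 50"
  shows "F \<subseteq> star H x"
proof -
  define J where "J = {A\<in>F. x \<notin> A}"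
  define L where "L = star H x - F"
  have fF: "finite F" using F finite_H finite_subset by blast
  have sub: "J \<subseteq> H" "L \<subseteq> H" using F by (auto simp: J_def L_def star_def)
  have LJ: "card L \<le> card J"
  proof -
    have "card F = card J + card {A\<in>F. x \<in> A}"
      unfolding J_def using fF by (subst card_Un_disjoint[symmetric]) (auto intro!: arg_cong[where f=card])
    moreover have "card (star H x) = card L + card {A\<in>F. x \<in> A}"
      unfolding L_def using fF finite_H F(1)
      by (subst card_Un_disjoint[symmetric]) (auto simp: star_def intro!: arg_cong[where f=card])
    ultimately show ?thesis using big by simp
  qed
  \<comment> \<open>A \<open>B\<close> disjoint from a member \<open>A\<close> of \<open>J\<close>
    is not in \<open>F\<close>, hence in \<open>L\<close> if it contains \<open>x\<close>. Otherwise
    it is the complement of \<open>A\<close> in \<open>V - {x}\<close>. So each \<open>A\<close>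
    occurs in at most one pair of \<open>P2\<close>.\<close>
  define P2 where "P2 = {(A,B). A \<in> J \<and> B \<in> H - L \<and> A \<inter> B = {}}"
  define P3 where "P3 = {(A,B). A \<in> H - J \<and> B \<in> L \<and> A \<inter> B = {}}"
  have P2: "card P2 \<le> card J"
  proof (rule card_inj_on_le[where f=fst])
    show "finite J" using fF by (simp add: J_def)
    show "fst ` P2 \<subseteq> J" by (auto simp: P2_def)
    have snd: "B = V - {x} - A" if "(A,B) \<in> P2" for A B
    proof -
      from that have *: "A \<in> F" "x \<notin> A" "B \<in> H" "B \<notin> L" "A \<inter> B = {}" by (auto simp: P2_def J_def)
      have "B \<notin> F" using * clique_meets[OF F] by blast
      then have xB: "x \<notin> B" using * by (auto simp: L_def star_def)
      have AB: "A \<in> nsets V k" "B \<in> nsets V k" using * F H by auto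
      then have "B \<subseteq> V - {x} - A" using * xB by (auto simp: nsets_def)
      moreover have "card (V - {x} - A) = card B"
        using AB x * fin card_V by (simp add: card_Diff_subset nsets_def subset_Diff_insert)
      ultimately show ?thesis using fin by (simp add: card_subset_eq)
    qed
    show "inj_on fst P2" by (rule inj_onI) (metis prod.collapse snd)
  qed
  have "W L J = W J L" by (rule W_sym)
  also have "\<dots> = W J H - W J (H - L)" using W_split[OF sub(2), of J] by simp
  also have "\<dots> \<ge> (D - 530 * \<eta>) * real (card J) - (1 + 12 * \<eta>) * real (card J)"
  proof -
    have "W J (H - L) \<le> (1 + 12 * \<eta>) * real (card P2)" unfolding P2_def by (rule W_count) (use sub in auto)
    also have "\<dots> \<le> (1 + 12 * \<eta>) * real (card J)" using P2 eta by (intro mult_left_mono) auto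
    finally show ?thesis using W_bounds(2)[OF sub(1)] by simp
  qed
  finally have WLJ: "W L J \<ge> (D - 530 * \<eta>) * real (card J) - (1 + 12 * \<eta>) * real (card J)" .
  have "(1 - 12 * \<eta>) * real (card P3) \<le> W (H - J) L" unfolding P3_def by (rule W_count) (use sub in auto)
  also have "\<dots> = W L H - W L J" using W_split[OF sub(1), of L] W_sym[of L] by simp
  also have "\<dots> \<le> (D + 530 * \<eta>) * real (card L) - ((D - 530 * \<eta>) * real (card J) - (1 + 12 * \<eta>) * real (card J))"
    using WLJ W_bounds(1)[OF sub(2)] by simp
  also have "\<dots> \<le> (D + 530 * \<eta>) * real (card J) - ((D - 530 * \<eta>) * real (card J) - (1 + 12 * \<eta>) * real (card J))"
    using LJ D eta by (intro diff_right_mono mult_left_mono) auto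
  also have "\<dots> = (1 + 1072 * \<eta>) * real (card J)" by (simp add: algebra_simps)
  also have "\<dots> \<le> ((1 - 12 * \<eta>) * (1 + 1200 * \<eta>)) * real (card J)"
  proof (intro mult_right_mono)
    have "14400 * (\<eta> * \<eta>) \<le> 14400 * (\<eta> * (1/10^8))" using eta by (intro mult_left_mono) auto
    then show "1 + 1072 * \<eta> \<le> (1 - 12 * \<eta>) * (1 + 1200 * \<eta>)" using eta by (simp add: algebra_simps)
  qed simp
  finally have "(1 - 12 * \<eta>) * real (card P3) \<le> (1 - 12 * \<eta>) * ((1 + 1200 * \<eta>) * real (card J))" by (simp add: mult.assoc)
  then have P3: "real (card P3) \<le> (1 + 1200 * \<eta>) * real (card J)" using eta by (simp add: mult_le_cancel_left)
  define P where "P = {(A,B). A \<in> H \<and> B \<in> H \<and> A \<inter> B = {} \<and> (A \<in> J) \<noteq> (B \<in> L)}"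
  have "P \<subseteq> P2 \<union> P3" using sub by (auto simp: P_def P2_def P3_def)
  moreover have "finite (P2 \<union> P3)"
    by (rule finite_subset[of _ "H \<times> H"]) (use finite_H sub in \<open>auto simp: P2_def P3_def\<close>)
  ultimately have "card P \<le> card P2 + card P3" by (meson card_Un_le card_mono le_trans)
  then have P: "real (card P) \<le> (2 + 1200 * \<eta>) * real (card J)" using P2 P3 by (simp add: algebra_simps)
  obtain X where X: "X \<subseteq> nsets V k" "X \<inter> H = J"
    "exch_energy V k (\<lambda>A. of_bool (A \<in> X)) \<le> 2 * real (k + 1) * (1 + 200 * \<eta>) * real (card P)"
    "\<forall>y\<in>V. (\<forall>A\<in>J. y \<notin> A) \<longrightarrow> (\<forall>B\<in>L. y \<in> B) \<longrightarrow> (\<forall>A\<in>X. y \<notin> A)"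
    using filled_family[OF sub, folded P_def] by auto
  have Xx: "x \<notin> A" if "A \<in> X" for A
  proof -
    have "\<forall>A\<in>J. x \<notin> A" "\<forall>B\<in>L. x \<in> B" by (simp_all add: J_def L_def star_def)
    then show ?thesis using X(4) x that by blast
  qed
  have fn: "finite (nsets V k)" by (rule finite_imp_finite_nsets[OF fin])
  have fX: "finite X" using X(1) fn by (rule finite_subset)
  have "card J \<le> card X" using X(2) fX by (intro card_mono) auto
  have cX: "real (card X) \<le> M / 50 + \<eta> * M"
  proof -
    have "X \<subseteq> J \<union> (nsets V k - H)" using X by auto
    then have "card X \<le> card (J \<union> (nsets V k - H))" using fn fF by (intro card_mono) (auto simp: J_def)
    also have "\<dots> \<le> card J + card (nsets V k - H)" by (rule card_Un_le)
    finally have "real (card X) \<le> real (card J) + real (card (nsets V k - H))" by simp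
    then show ?thesis using near card_missing by (simp add: J_def)
  qed
  define K where "K = real (2 * k choose k)"
  have K: "K \<ge> M / 2" "K > 0"
  proof -
    have "K * (2 * real k + 1) = M * (real k + 1)"
      using middle_binomials(2,3)[OF k_pos] by (simp add: K_def M_def algebra_simps)
    moreover have "M * (real k + 1) \<ge> M / 2 * (2 * real k + 1)" using M_pos by (simp add: algebra_simps)
    ultimately have "K * (2 * real k + 1) \<ge> M / 2 * (2 * real k + 1)" by simp
    then show "K \<ge> M / 2" by (simp add: mult_le_cancel_right)
    then show "K > 0" using M_pos by simp
  qed
  have cXK: "real (card X) \<le> K / 20"
  proof -
    have "\<eta> * M \<le> (1 / 1000) * M" using eta M_pos by (intro mult_right_mono) auto
    then show ?thesis using cX K M_pos by linarith
  qed
  have cVx: "card (V - {x}) = 2 * k" using x fin card_V by simp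
  have "4 * real k * real (card X) * (19 / 20 * K) \<le> 4 * real k * real (card X) * (K - real (card X))"
    using cXK by (intro mult_left_mono) auto
  also have "\<dots> \<le> exch_energy (V - {x}) k (\<lambda>A. of_bool (A \<in> X)) * K"
    using poincare_exch_indicator[of "V - {x}" k X] X(1) Xx fin k_pos k_large
    unfolding cVx K_def by (auto simp: nsets_def)
  finally have "(4 * real k * real (card X) * (19 / 20)) * K \<le> exch_energy (V - {x}) k (\<lambda>A. of_bool (A \<in> X)) * K"
    by (simp only: mult.assoc)
  then have e1: "4 * real k * real (card X) * (19 / 20) \<le> exch_energy (V - {x}) k (\<lambda>A. of_bool (A \<in> X))"
    using K by (simp add: mult_le_cancel_right)
  \<comment> \<open>29/5 = 2 + 4 * 19/20: the exchanges with \<open>x\<close>, plus the Poincare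
    inequality on 2 k points for a family of density at most 1/20.\<close>
  have "real k * (29/5) * real (card X) \<le> exch_energy V k (\<lambda>A. of_bool (A \<in> X))"
    using exch_energy_avoiding_point[OF fin x k_pos X(1) Xx] e1 by simp
  also have "\<dots> \<le> 2 * real (k + 1) * (1 + 200 * \<eta>) * ((2 + 1200 * \<eta>) * real (card J))"
    using X(3) P eta by (elim order_trans) (intro mult_left_mono; simp)
  also have "\<dots> \<le> 2 * real (k + 1) * (1 + 200 * (1/10^8)) * ((2 + 1200 * (1/10^8)) * real (card X))"
    using eta \<open>card J \<le> card X\<close> by (intro mult_mono mult_left_mono mult_right_mono add_mono) auto
  also have "\<dots> \<le> (real k * (5 :: real)) * real (card X)"
  proof -
    have "2 * real (k + 1) * (1 + 200 * (1/10^8)) * (2 + 1200 * (1/10^8)) \<le> real k * 5"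
      using k_large by simp
    then show ?thesis by (metis (no_types, lifting) mult.assoc mult_right_mono of_nat_0_le_iff)
  qed
  finally have "real k * (4/5) * real (card X) \<le> 0" by simp
  then have "card X = 0" using k_large by (auto simp: mult_le_0_iff)
  then have "J = {}" using fX X(2) by simp
  then show ?thesis using F by (auto simp: J_def star_def)
qed

text \<open>Stars are cliques, and each set lies in k of the 2 k + 1 stars; the average star is the
  comparison.\<close>

lemma max_clique_lower:
  assumes "max_clique H F"
  shows "real k * real (card H) \<le> (2 * real k + 1) * real (card F)"
proof -
  have le: "card (star H x) \<le> card F" for x
  proof -
    have "intersecting (star H x)" by (auto simp: intersecting_def pairwise_def disjnt_def star_def)
    then show ?thesis using assms unfolding max_clique_def by (simp add: star_def)
  qed
  have "real k * real (card H) = (\<Sum>A\<in>H. \<Sum>x\<in>V. of_bool (x \<in> A))"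
  proof -
    have "(\<Sum>x\<in>V. of_bool (x \<in> A)) = real k" if "A \<in> H" for A
    proof -
      have "V \<inter> A = A" "card A = k" using that H by (auto simp: nsets_def)
      then show ?thesis using fin by (simp add: Int_def)
    qed
    then show ?thesis by simp
  qed
  also have "\<dots> = (\<Sum>x\<in>V. \<Sum>A\<in>H. of_bool (x \<in> A))" by (rule sum.swap)
  also have "\<dots> = (\<Sum>x\<in>V. real (card (star H x)))"
    using finite_H by (simp add: star_def Int_def)
  also have "\<dots> \<le> (\<Sum>x\<in>V. real (card F))" using le by (intro sum_mono) simp
  finally show ?thesis using card_V by (simp add: add.commute)
qed

text \<open>In the complete hypergraph the sets outside a star pair off as complements in
  \<open>V - {x}\<close>, giving about M / 2 ordered disjoint pairs. A maximum clique of
  \<open>H\<close> leaves at most (1/2 + 600 \<eta>) M, so its filled family has the energy of a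
  star up to a factor 1 + O(\<eta>). A star near \<open>F\<close> follows, and
  \<open>clique_near_star_in_star\<close> makes the containment exact.\<close>

theorem strong_EKR_if_balanced: "strong_EKR V H"
  unfolding strong_EKR_def
proof (intro allI impI)
  fix F assume mc: "max_clique H F"
  then have F: "F \<subseteq> H" "intersecting F" by (auto simp: max_clique_def)
  have fF: "finite F" using F finite_H finite_subset by blast
  have fn: "finite (nsets V k)" by (rule finite_imp_finite_nsets[OF fin])
  have cL: "real (card (nsets V k)) = M" by (simp add: card_nsets card_V M_def)
  have cH: "real (card H) \<le> M" "real (card H) \<ge> (1 - \<eta>) * M"
  proof -
    have "card H \<le> card (nsets V k)" using H fn by (intro card_mono)
    then show "real (card H) \<le> M" using cL by linarith
    have "card (nsets V k - H) = card (nsets V k) - card H" using finite_H H by (simp add: card_Diff_subset)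
    then have "real (card (nsets V k)) = real (card H) + real (card (nsets V k - H))"
      using \<open>card H \<le> card (nsets V k)\<close> by linarith
    then show "real (card H) \<ge> (1 - \<eta>) * M" using card_missing cL by (simp add: algebra_simps)
  qed
  have cHF: "real (card (H - F)) = real (card H) - real (card F)"
    using F(1) fF finite_H card_mono[OF finite_H F(1)] by (simp add: card_Diff_subset of_nat_diff)
  note low = max_clique_lower[OF mc]
  note out = disjoint_pairs_outside_clique[OF F]
  have up: "real (card F) \<le> M / 2 + \<eta> * M"
  proof -
    have "2 * D * real (card F) \<le> (D + 530 * \<eta>) * real (card H)" using out unfolding cHF by (simp add: algebra_simps)
    also have "\<dots> \<le> (D + 530 * \<eta>) * M" using cH D eta by (intro mult_left_mono) auto
    also have "\<dots> \<le> (D + 2 * D * \<eta>) * M"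
    proof (rule mult_right_mono, rule add_left_mono)
      show "530 * \<eta> \<le> 2 * D * \<eta>" using D k_large eta by (intro mult_right_mono) auto
    qed (use M_pos in simp)
    finally have "(2 * D) * real (card F) \<le> (2 * D) * (M / 2 + \<eta> * M)" by (simp add: algebra_simps)
    moreover have "2 * D > 0" using D k_large by simp
    ultimately show ?thesis by (simp only: mult_le_cancel_left_pos)
  qed
  have lo: "real (card F) \<ge> M / 2 - 2 * \<eta> * M"
  proof -
    have "(2 * real k + 1) * (M / 2 - 2 * \<eta> * M) \<le> real k * ((1 - \<eta>) * M)"
    proof -
      have "M / 2 * 1 \<le> M / 2 * (\<eta> * real k)" using eta M_pos by (intro mult_left_mono) auto
      then show ?thesis using eta M_pos by (simp add: algebra_simps add_increasing)
    qed
    also have "\<dots> \<le> real k * real (card H)" using cH by (intro mult_left_mono) auto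
    also have "\<dots> \<le> (2 * real k + 1) * real (card F)" by (rule low)
    finally show ?thesis by (simp add: mult_le_cancel_left)
  qed
  define P where "P = {(A,B). A \<in> H \<and> B \<in> H \<and> A \<inter> B = {} \<and> (A \<in> F) \<noteq> (B \<in> H - F)}"
  have "P = {(A,B). A \<in> H - F \<and> B \<in> H - F \<and> A \<inter> B = {}}"
    using clique_meets[OF F] F(1) by (auto simp: P_def)
  then have "(1 - 12 * \<eta>) * real (card P) \<le> W (H - F) (H - F)" using W_count(1)[of "H - F" "H - F"] by auto
  also have "\<dots> \<le> D * (real (card H) - 2 * real (card F)) + 530 * \<eta> * real (card H)"
    using out(1) unfolding cHF by (simp add: algebra_simps)
  also have "\<dots> \<le> (1/2 + 531 * \<eta>) * M"
  proof -
    \<comment> \<open>The average star limits |H| - 2 |F| to |H| / (2 k + 1); multiplied by D, at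
      most k + 1, this is the main term M / 2.\<close>
    have "(2 * real k + 1) * (real (card H) - 2 * real (card F)) \<le> real (card H)" using low by (simp add: algebra_simps)
    then have *: "real (card H) - 2 * real (card F) \<le> real (card H) / (2 * real k + 1)" by (simp add: field_simps)
    have "D * (real (card H) - 2 * real (card F)) \<le> D * (real (card H) / (2 * real k + 1))"
      using D by (intro mult_left_mono *) auto
    also have "\<dots> \<le> (real k + 1) * (M / (2 * real k + 1))"
      using D cH by (intro mult_mono divide_right_mono) auto
    also have "\<dots> \<le> (1/2 + \<eta>) * M"
    proof -
      have "real k + 1 \<le> (1/2 + \<eta>) * (2 * real k + 1)" using eta by (simp add: algebra_simps)
      then have "(real k + 1) * M \<le> (1/2 + \<eta>) * (2 * real k + 1) * M" using M_pos by (intro mult_right_mono) auto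
      then show ?thesis by (simp add: field_simps)
    qed
    finally have 1: "D * (real (card H) - 2 * real (card F)) \<le> (1/2 + \<eta>) * M" .
    have "530 * \<eta> * real (card H) \<le> 530 * \<eta> * M" using cH eta by (intro mult_left_mono) auto
    then show ?thesis using 1 by (simp add: algebra_simps)
  qed
  also have "\<dots> \<le> (1 - 12 * \<eta>) * ((1/2 + 600 * \<eta>) * M)"
  proof -
    have "7200 * (\<eta> * \<eta>) \<le> 7200 * (\<eta> * (1/10^8))" using eta by (intro mult_left_mono) auto
    then have "1/2 + 531 * \<eta> \<le> (1 - 12 * \<eta>) * (1/2 + 600 * \<eta>)" using eta by (simp add: algebra_simps)
    then have "(1/2 + 531 * \<eta>) * M \<le> ((1 - 12 * \<eta>) * (1/2 + 600 * \<eta>)) * M" using M_pos by (intro mult_right_mono) auto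
    then show ?thesis by (simp only: mult.assoc)
  qed
  finally have P: "real (card P) \<le> (1/2 + 600 * \<eta>) * M" using eta by (simp add: mult_le_cancel_left)
  obtain X where X: "X \<subseteq> nsets V k" "X \<inter> H = F"
    "exch_energy V k (\<lambda>A. of_bool (A \<in> X)) \<le> 2 * real (k + 1) * (1 + 200 * \<eta>) * real (card P)"
    using filled_family[OF F(1) Diff_subset[of H F], folded P_def] by auto
  have fX: "finite X" using X(1) fn by (rule finite_subset)
  have cX: "real (card X) \<le> real (card F) + \<eta> * M"
  proof -
    have "X \<subseteq> F \<union> (nsets V k - H)" using X by auto
    then have "card X \<le> card (F \<union> (nsets V k - H))" using fn fF by (intro card_mono) auto
    also have "\<dots> \<le> card F + card (nsets V k - H)" by (rule card_Un_le)
    finally show ?thesis using card_missing by linarith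
  qed
  have FX: "card F \<le> card X" using X(2) fX by (intro card_mono) auto
  have "exch_energy V k (\<lambda>A. of_bool (A \<in> X)) \<le> 2 * real (k + 1) * (1 + 200 * \<eta>) * ((1/2 + 600 * \<eta>) * M)"
    using X(3) P eta by (elim order_trans) (intro mult_left_mono; simp)
  also have "\<dots> = (real (k + 1) * M) * ((1 + 200 * \<eta>) * (1 + 1200 * \<eta>))" by (simp add: algebra_simps)
  also have "\<dots> \<le> (real (k + 1) * M) * (1 + 1800 * \<eta>)"
  proof (intro mult_left_mono)
    have "240000 * (\<eta> * \<eta>) \<le> 240000 * (\<eta> * (1/10^8))" using eta by (intro mult_left_mono) auto
    then show "(1 + 200 * \<eta>) * (1 + 1200 * \<eta>) \<le> 1 + 1800 * \<eta>" using eta by (simp add: algebra_simps)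
  qed (use M_pos in auto)
  finally have en: "exch_energy V k (\<lambda>A. of_bool (A \<in> X)) \<le> real (k + 1) * M * (1 + 1800 * \<eta>)" .
  have "\<bar>real (card X) - M / 2\<bar> \<le> 2 * \<eta> * M" using cX FX up lo unfolding abs_le_iff by linarith
  from near_star_of_low_energy[OF fin card_V X(1) eta M_def en this]
  obtain x where x: "x \<in> V" "real (card {A\<in>X. x \<notin> A}) \<le> M / 50 \<or> real (card {A\<in>X. x \<in> A}) \<le> M / 50" by blast
  \<comment> \<open>If few sets of \<open>F\<close> contained \<open>x\<close>, the others would
    form a clique on 2 k points with at most one set from each complementary pair: about M / 4 sets,
    too few for \<open>F\<close>.\<close>
  have nx: "real (card {A\<in>F. x \<notin> A}) \<le> M / 50"
  proof (rule ccontr)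
    assume "\<not> ?thesis"
    moreover have "card {A\<in>F. x \<notin> A} \<le> card {A\<in>X. x \<notin> A}" using X(2) fX by (intro card_mono) auto
    moreover have "card {A\<in>F. x \<in> A} \<le> card {A\<in>X. x \<in> A}" using X(2) fX by (intro card_mono) auto
    ultimately have few: "real (card {A\<in>F. x \<in> A}) \<le> M / 50" using x(2) by linarith
    define G where "G = {A\<in>F. x \<notin> A}"
    let ?N = "nsets (V - {x}) k"
    have fN: "finite ?N" using fin by (intro finite_imp_finite_nsets) auto
    have GN: "G \<subseteq> ?N" using F(1) H by (auto simp: G_def nsets_def)
    have cVx: "card (V - {x}) = 2 * k" using x(1) fin card_V by simp
    have "card G \<le> card (?N - G)"
    proof (rule card_inj_on_le[where f="\<lambda>A. V - {x} - A"])
      show "inj_on (\<lambda>A. V - {x} - A) G" using GN by (auto simp: inj_on_def nsets_def)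
      show "(\<lambda>A. V - {x} - A) ` G \<subseteq> ?N - G"
      proof clarify
        fix A assume A: "A \<in> G"
        have AN: "A \<subseteq> V - {x}" "finite A" "card A = k" using A GN by (auto simp: nsets_def)
        then have "card (V - {x} - A) = k" using cVx by (subst card_Diff_subset) auto
        then have "V - {x} - A \<in> ?N" using fin by (auto simp: nsets_def)
        moreover have "V - {x} - A \<notin> G" using clique_meets[OF F, of A "V - {x} - A"] A by (auto simp: G_def)
        ultimately show "V - {x} - A \<in> ?N - G" by blast
      qed
    qed (use fN in auto)
    moreover have "card ?N = card G + card (?N - G)" using GN fN by (metis card_Diff_subset card_mono finite_subset le_add_diff_inverse)
    ultimately have "2 * card G \<le> card ?N" by simp
    then have "2 * real (card G) \<le> real (2 * k choose k)" using cVx by (simp add: card_nsets)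
    then have G: "real (card G) \<le> real (2 * k choose k) / 2" by simp
    have "real (2 * k choose k) * (2 * real k + 1) = M * (real k + 1)"
      using middle_binomials(2,3)[OF k_pos] by (simp add: M_def algebra_simps)
    moreover have "M * (real k + 1) \<le> (13/25 * M) * (2 * real k + 1)"
    proof -
      have "M * (real k + 1) \<le> M * (13/25 * (2 * real k + 1))" using M_pos k_large by (intro mult_left_mono) auto
      then show ?thesis by (simp add: algebra_simps)
    qed
    ultimately have "real (2 * k choose k) * (2 * real k + 1) \<le> (13/25 * M) * (2 * real k + 1)" by simp
    then have "real (2 * k choose k) \<le> 13/25 * M" by (simp add: mult_le_cancel_right)
    moreover have "card F = card G + card {A\<in>F. x \<in> A}"
      unfolding G_def using fF by (subst card_Un_disjoint[symmetric]) (auto intro!: arg_cong[where f=card])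
    ultimately have "real (card F) \<le> 13/50 * M + M / 50" using G few by simp
    moreover have "2 * \<eta> * M \<le> 1/100 * M" using eta M_pos by (intro mult_right_mono) auto
    ultimately show False using lo M_pos by linarith
  qed
  have isx: "intersecting (star H x)" by (auto simp: intersecting_def pairwise_def disjnt_def star_def)
  have big: "card (star H x) \<le> card F"
    using mc isx unfolding max_clique_def by (simp add: star_def)
  have "F \<subseteq> star H x" by (rule clique_near_star_in_star[OF F x(1) big nx])
  moreover have "finite (star H x)" using finite_H by (simp add: star_def)
  ultimately have "F = star H x" using big by (simp add: card_seteq)
  then show "\<exists>x\<in>V. F = star H x" using x(1) by blast
qed

end

section \<open>Bounded differences\<close>


lemma finite_set_Pi_bernoulli: "finite A \<Longrightarrow> finite (set_pmf (Pi_pmf A d (\<lambda>_. bernoulli_pmf p)))"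
  by (rule finite_subset[OF set_Pi_pmf_subset']) auto

lemma expectation_Pi_bernoulli_insert:
  fixes g :: "('i \<Rightarrow> bool) \<Rightarrow> real"
  assumes A: "finite A" "x \<notin> A" and p: "0 \<le> p" "p \<le> 1"
  shows "measure_pmf.expectation (Pi_pmf (insert x A) d (\<lambda>_. bernoulli_pmf p)) g
    = p * measure_pmf.expectation (Pi_pmf A d (\<lambda>_. bernoulli_pmf p)) (\<lambda>\<omega>. g ((fun_upd \<omega> x True)))
      + (1 - p) * measure_pmf.expectation (Pi_pmf A d (\<lambda>_. bernoulli_pmf p)) (\<lambda>\<omega>. g ((fun_upd \<omega> x False)))"
proof -
  let ?P = "Pi_pmf A d (\<lambda>_. bernoulli_pmf p)"
  have "Pi_pmf (insert x A) d (\<lambda>_. bernoulli_pmf p) = bind_pmf (bernoulli_pmf p) (\<lambda>b. map_pmf (\<lambda>\<omega>. (fun_upd \<omega> x b)) ?P)"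
    unfolding Pi_pmf_insert'[OF A] map_pmf_def ..
  also have "measure_pmf.expectation \<dots> g
    = (\<Sum>b\<in>UNIV. pmf (bernoulli_pmf p) b *\<^sub>R measure_pmf.expectation (map_pmf (\<lambda>\<omega>. (fun_upd \<omega> x b)) ?P) g)"
    by (rule pmf_expectation_bind) (use finite_set_Pi_bernoulli[OF A(1)] in auto)
  also have "\<dots> = p * measure_pmf.expectation (map_pmf (\<lambda>\<omega>. fun_upd \<omega> x True) ?P) g
      + (1 - p) * measure_pmf.expectation (map_pmf (\<lambda>\<omega>. fun_upd \<omega> x False) ?P) g"
    using p by (simp add: UNIV_bool del: integral_map_pmf)
  finally show ?thesis by (simp only: integral_map_pmf)
qed

text \<open>Hoeffding's lemma for a variable with two values. \<open>Hoeffdings_lemma_aux\<close> is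
  applied with a nonnegative gap; for a negative one the two outcomes change roles.\<close>

lemma two_point_mgf_le:
  fixes u v c s p :: real
  assumes p: "0 \<le> p" "p \<le> 1" and c: "\<bar>u - v\<bar> \<le> c"
  defines "m \<equiv> p * u + (1 - p) * v"
  shows "p * exp (s * (u - m)) + (1 - p) * exp (s * (v - m)) \<le> exp (s\<^sup>2 * c\<^sup>2 / 8)"
proof -
  have main: "q * exp (h * (1 - q)) + (1 - q) * exp (- h * q) \<le> exp (h\<^sup>2 / 8)"
    if q: "0 \<le> q" "q \<le> 1" and h: "0 \<le> h" for q h :: real
  proof -
    have pos: "1 + q * (exp h - 1) > 0"
      using q h by (intro add_pos_nonneg mult_nonneg_nonneg) auto
    have "q * exp (h * (1 - q)) + (1 - q) * exp (- h * q) = exp (- h * q) * (1 + q * (exp h - 1))"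
      by (simp add: exp_add[symmetric] algebra_simps flip: exp_add)
    also have "\<dots> = exp (- h * q + ln (1 + q * (exp h - 1)))"
      unfolding exp_add using pos by simp
    also have "\<dots> \<le> exp (h\<^sup>2 / 8)" using Hoeffdings_lemma_aux[OF h q(1)] by simp
    finally show ?thesis .
  qed
  define h where "h = s * (u - v)"
  have e: "s * (u - m) = h * (1 - p)" "s * (v - m) = - h * p"
    by (simp_all add: h_def m_def algebra_simps)
  have "p * exp (s * (u - m)) + (1 - p) * exp (s * (v - m)) \<le> exp (h\<^sup>2 / 8)"
  proof (cases "h \<ge> 0")
    case True
    then show ?thesis unfolding e using main[OF p] by blast
  next
    case False
    then show ?thesis unfolding e using main[of "1 - p" "- h"] p by (simp add: algebra_simps)
  qed
  also have "\<dots> \<le> exp (s\<^sup>2 * c\<^sup>2 / 8)"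
  proof -
    have "(u - v)\<^sup>2 \<le> c\<^sup>2" using c by (metis abs_ge_zero power2_abs power_mono)
    then show ?thesis by (simp add: h_def power_mult_distrib mult_left_mono)
  qed
  finally show ?thesis .
qed

text \<open>Induction over the coins. Fixing the new coin leaves functions with the same bounds for
  the other coins, whose means differ by at most \<open>c x\<close>. The two-point bound handles the
  means, the induction hypothesis the deviations from them.\<close>

lemma bounded_differences_mgf:
  fixes g :: "('i \<Rightarrow> bool) \<Rightarrow> real" and c :: "'i \<Rightarrow> real"
  assumes fin: "finite A" and p: "0 \<le> p" "p \<le> 1"
    and c: "\<And>\<omega> i. i \<in> A \<Longrightarrow> \<bar>g ((fun_upd \<omega> i True)) - g ((fun_upd \<omega> i False))\<bar> \<le> c i"
  defines "P \<equiv> \<lambda>A. Pi_pmf A False (\<lambda>_. bernoulli_pmf p)"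
  shows "measure_pmf.expectation (P A) (\<lambda>\<omega>. exp (s * (g \<omega> - measure_pmf.expectation (P A) g)))
     \<le> exp (s\<^sup>2 * (\<Sum>i\<in>A. (c i)\<^sup>2) / 8)"
  using fin c
proof (induction A arbitrary: g rule: finite_induct)
  case empty
  then show ?case by (simp add: P_def)
next
  case (insert x A)
  define gb where "gb = (\<lambda>b \<omega>. g ((fun_upd \<omega> x b)))"
  define mu where "mu = (\<lambda>b. measure_pmf.expectation (P A) (gb b))"
  define m where "m = measure_pmf.expectation (P (insert x A)) g"
  define C where "C = (\<Sum>i\<in>A. (c i)\<^sup>2)"
  have int: "integrable (measure_pmf (P A)) f" for f :: "_ \<Rightarrow> real"
    unfolding P_def by (intro integrable_measure_pmf_finite finite_set_Pi_bernoulli insert.hyps)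
  have m: "m = p * mu True + (1 - p) * mu False"
    unfolding m_def mu_def gb_def P_def by (rule expectation_Pi_bernoulli_insert[OF insert.hyps p])
  have IH: "measure_pmf.expectation (P A) (\<lambda>\<omega>. exp (s * (gb b \<omega> - mu b))) \<le> exp (s\<^sup>2 * C / 8)" for b
    unfolding mu_def C_def
  proof (rule insert.IH)
    fix \<omega> i assume i: "i \<in> A"
    then have "x \<noteq> i" using insert.hyps by auto
    then have tw: "fun_upd (fun_upd \<omega> i v) x b = fun_upd (fun_upd \<omega> x b) i v" for v
      by (rule fun_upd_twist[symmetric])
    show "\<bar>gb b (fun_upd \<omega> i True) - gb b (fun_upd \<omega> i False)\<bar> \<le> c i"
      unfolding gb_def tw by (rule insert.prems) (use i in simp)
  qed
  have diff: "\<bar>mu True - mu False\<bar> \<le> c x"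
  proof -
    have pw: "\<bar>gb True \<omega> - gb False \<omega>\<bar> \<le> c x" for \<omega>
      unfolding gb_def by (rule insert.prems) simp
    have "\<bar>mu True - mu False\<bar> = \<bar>measure_pmf.expectation (P A) (\<lambda>\<omega>. gb True \<omega> - gb False \<omega>)\<bar>"
      unfolding mu_def by (simp add: int)
    also have "\<dots> \<le> measure_pmf.expectation (P A) (\<lambda>\<omega>. \<bar>gb True \<omega> - gb False \<omega>\<bar>)"
      by (rule integral_abs_bound)
    also have "\<dots> \<le> measure_pmf.expectation (P A) (\<lambda>\<omega>. c x)"
      by (intro integral_mono int pw)
    finally show ?thesis by simp
  qed
  have part: "measure_pmf.expectation (P A) (\<lambda>\<omega>. exp (s * (gb b \<omega> - m))) \<le> exp (s * (mu b - m)) * exp (s\<^sup>2 * C / 8)" for b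
  proof -
    have "measure_pmf.expectation (P A) (\<lambda>\<omega>. exp (s * (gb b \<omega> - m)))
       = measure_pmf.expectation (P A) (\<lambda>\<omega>. exp (s * (mu b - m)) * exp (s * (gb b \<omega> - mu b)))"
      by (simp add: exp_add[symmetric] algebra_simps)
    also have "\<dots> = exp (s * (mu b - m)) * measure_pmf.expectation (P A) (\<lambda>\<omega>. exp (s * (gb b \<omega> - mu b)))"
      by simp
    finally show ?thesis using IH[of b] by simp
  qed
  have "measure_pmf.expectation (P (insert x A)) (\<lambda>\<omega>. exp (s * (g \<omega> - m)))
    = p * measure_pmf.expectation (P A) (\<lambda>\<omega>. exp (s * (gb True \<omega> - m)))
      + (1 - p) * measure_pmf.expectation (P A) (\<lambda>\<omega>. exp (s * (gb False \<omega> - m)))"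
    unfolding P_def gb_def by (rule expectation_Pi_bernoulli_insert[OF insert.hyps p])
  also have "\<dots> \<le> p * (exp (s * (mu True - m)) * exp (s\<^sup>2 * C / 8)) + (1 - p) * (exp (s * (mu False - m)) * exp (s\<^sup>2 * C / 8))"
    using p by (intro add_mono mult_left_mono part) auto
  also have "\<dots> = (p * exp (s * (mu True - m)) + (1 - p) * exp (s * (mu False - m))) * exp (s\<^sup>2 * C / 8)"
    by (simp add: algebra_simps)
  also have "\<dots> \<le> exp (s\<^sup>2 * (c x)\<^sup>2 / 8) * exp (s\<^sup>2 * C / 8)"
    unfolding m by (intro mult_right_mono two_point_mgf_le p diff) auto
  also have "\<dots> = exp (s\<^sup>2 * (\<Sum>i\<in>insert x A. (c i)\<^sup>2) / 8)"
    using insert.hyps by (simp add: C_def exp_add[symmetric] algebra_simps add_divide_distrib)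
  finally show ?case unfolding m_def .
qed

text \<open>McDiarmid's inequality for independent coins.\<close>

lemma bounded_differences_tail:
  fixes g :: "('i \<Rightarrow> bool) \<Rightarrow> real" and c :: "'i \<Rightarrow> real"
  assumes fin: "finite A" and p: "0 \<le> p" "p \<le> 1"
    and c: "\<And>\<omega> i. i \<in> A \<Longrightarrow> \<bar>g ((fun_upd \<omega> i True)) - g ((fun_upd \<omega> i False))\<bar> \<le> c i"
    and C: "(\<Sum>i\<in>A. (c i)\<^sup>2) \<le> C" "0 < C" and t: "0 \<le> t"
  defines "P \<equiv> Pi_pmf A False (\<lambda>_. bernoulli_pmf p)"
  assumes mean: "measure_pmf.expectation P g = 0"
  shows "measure_pmf.prob P {\<omega>. g \<omega> \<ge> t} \<le> exp (- 2 * t\<^sup>2 / C)"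
proof -
  \<comment> \<open>This \<open>s\<close> minimises - s t + s^2 C / 8.\<close>
  define s where "s = 4 * t / C"
  have s: "s \<ge> 0" using t C by (simp add: s_def)
  have int: "integrable (measure_pmf P) f" for f :: "_ \<Rightarrow> real"
    unfolding P_def by (intro integrable_measure_pmf_finite finite_set_Pi_bernoulli fin)
  have "measure_pmf.prob P {\<omega>. g \<omega> \<ge> t} = measure_pmf.expectation P (indicator {\<omega>. g \<omega> \<ge> t})"
    by simp
  also have "\<dots> \<le> measure_pmf.expectation P (\<lambda>\<omega>. exp (- s * t) * exp (s * g \<omega>))"
  proof (intro integral_mono int)
    fix \<omega>
    have "1 \<le> exp (- s * t) * exp (s * g \<omega>)" if "g \<omega> \<ge> t"
      using that s mult_left_mono[of t "g \<omega>" s] by (simp add: exp_add[symmetric])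
    then show "indicator {\<omega>. g \<omega> \<ge> t} \<omega> \<le> exp (- s * t) * exp (s * g \<omega>)"
      by (auto simp: indicator_def)
  qed
  also have "\<dots> = exp (- s * t) * measure_pmf.expectation P (\<lambda>\<omega>. exp (s * g \<omega>))" by simp
  also have "\<dots> \<le> exp (- s * t) * exp (s\<^sup>2 * (\<Sum>i\<in>A. (c i)\<^sup>2) / 8)"
    using bounded_differences_mgf[OF fin p c, of s] mean by (simp add: P_def)
  also have "\<dots> \<le> exp (- s * t) * exp (s\<^sup>2 * C / 8)"
    using C by (simp add: mult_left_mono divide_right_mono)
  also have "\<dots> = exp (- 2 * t\<^sup>2 / C)"
    using C by (simp add: exp_add[symmetric] s_def field_simps power2_eq_square)
  finally show ?thesis .
qed

text \<open>Coins outside \<open>J\<close> are independent of those in \<open>J\<close>, so a bound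
  that holds for every fixed outcome \<open>f\<close> of the former survives averaging.\<close>

lemma prob_Pi_pmf_condition:
  assumes fin: "finite I" and J: "J \<subseteq> I"
    and b: "\<And>f. measure_pmf.prob (Pi_pmf J d p) {\<omega>. (\<lambda>x. if x \<in> J then \<omega> x else f x) \<in> S} \<le> b"
  shows "measure_pmf.prob (Pi_pmf I d p) S \<le> b"
proof -
  let ?Q = "Pi_pmf (I - J) d p" and ?P = "Pi_pmf J d p"
  have b0: "0 \<le> b" using b by (meson measure_nonneg order_trans)
  have "Pi_pmf I d p = Pi_pmf (J \<union> (I - J)) d p" using J by (metis Un_Diff_cancel Un_absorb1)
  also have "\<dots> = map_pmf (\<lambda>(f,g) x. if x \<in> J then f x else g x) (pair_pmf ?P ?Q)"
    using fin J finite_subset by (intro Pi_pmf_union) auto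
  also have "\<dots> = bind_pmf ?Q (\<lambda>g. map_pmf (\<lambda>f x. if x \<in> J then f x else g x) ?P)"
    by (subst pair_commute_pmf) (simp add: pair_pmf_def map_bind_pmf map_pmf_comp bind_assoc_pmf
        bind_return_pmf map_pmf_def[symmetric] case_prod_unfold cong: if_cong)
  finally have eq: "Pi_pmf I d p = bind_pmf ?Q (\<lambda>g. map_pmf (\<lambda>f x. if x \<in> J then f x else g x) ?P)" .
  have "ennreal (measure_pmf.prob (Pi_pmf I d p) S) = emeasure (measure_pmf (Pi_pmf I d p)) S"
    by (simp add: measure_pmf.emeasure_eq_measure)
  also have "\<dots> = (\<integral>\<^sup>+g. emeasure (measure_pmf (map_pmf (\<lambda>f x. if x \<in> J then f x else g x) ?P)) S \<partial>measure_pmf ?Q)"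
    unfolding eq by (rule emeasure_bind_pmf)
  also have "\<dots> \<le> (\<integral>\<^sup>+g. ennreal b \<partial>measure_pmf ?Q)"
  proof (intro nn_integral_mono)
    fix g
    have "measure_pmf.prob ?P ((\<lambda>f x. if x \<in> J then f x else g x) -` S) \<le> b"
      using b[of g] by (simp add: vimage_def)
    then show "emeasure (measure_pmf (map_pmf (\<lambda>f x. if x \<in> J then f x else g x) ?P)) S \<le> ennreal b"
      by (simp add: measure_pmf.emeasure_eq_measure ennreal_leI)
  qed
  also have "\<dots> = ennreal b" by simp
  finally show ?thesis using b0 by simp
qed

section \<open>Balancing by walks of length three\<close>


text \<open>The cut-off k / 2 makes reciprocals bounded and Lipschitz for every outcome of the
  coins, as bounded differences requires. It is inactive on \<open>k\<close>-sets once
  \<open>sparse\<close> holds with small \<open>r\<close>.\<close>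

definition present_deg :: "nat \<Rightarrow> 'a set set \<Rightarrow> 'a set \<Rightarrow> real" where
  "present_deg k H A = max (real (card {B\<in>H. A \<inter> B = {}})) (real k / 2)"

text \<open>The weight of the walk \<open>U, V-U-{y}, U-{z}+{y}, V-U-{y,w}+{z}\<close>.\<close>

definition walk_weight :: "'a set \<Rightarrow> nat \<Rightarrow> 'a set set \<Rightarrow> 'a set \<Rightarrow> 'a \<Rightarrow> 'a \<Rightarrow> 'a \<Rightarrow> real" where
  "walk_weight V k H U y z w =
     of_bool (V - U - {y} \<in> H \<and> insert y (U - {z}) \<in> H \<and> insert z (V - U - {y,w}) \<in> H)
     / (present_deg k H U * present_deg k H (V - U - {y}) * present_deg k H (insert y (U - {z})))"

text \<open>The neighbours of the end of the walk are the \<open>k\<close>-subsets of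
  \<open>insert y (insert w (U - {z}))\<close>. Dropping a point of \<open>U - {z}\<close> gives the
  ones counted here, which meet \<open>U\<close> in k - 2 points; dropping \<open>w\<close> or
  \<open>y\<close> gives the other two.\<close>

definition fresh_deg :: "'a set set \<Rightarrow> 'a set \<Rightarrow> 'a \<Rightarrow> 'a \<Rightarrow> 'a \<Rightarrow> nat" where
  "fresh_deg H U y z w = card {t\<in>U - {z}. insert y (insert w (U - {z,t})) \<in> H}"

text \<open>The 2 stands for the neighbours that are not fresh: the third vertex of the walk,
  present whenever the weight is nonzero, and \<open>insert w (U - {z})\<close>, which is counted as
  present although it may be missing.\<close>

definition deg_defect :: "nat \<Rightarrow> real \<Rightarrow> nat \<Rightarrow> real" where
  "deg_defect k D m = D / max (2 + real m) (real k / 2) - 1"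

text \<open>Only walks that never step back are summed; \<open>avg3_main\<close> shows that the
  others contribute little.\<close>

definition walk_sum :: "'a set \<Rightarrow> nat \<Rightarrow> real \<Rightarrow> 'a set set \<Rightarrow> 'a set \<Rightarrow> real" where
  "walk_sum V k D H U = (\<Sum>y\<in>V-U. \<Sum>z\<in>U. \<Sum>w\<in>V-U-{y}.
     walk_weight V k H U y z w * deg_defect k D (fresh_deg H U y z w))"

lemma walk_weight_bounds:
  assumes "0 < k"
  shows "0 \<le> walk_weight V k H U y z w" "walk_weight V k H U y z w \<le> 8 / real k ^ 3"
proof -
  have d: "present_deg k H A \<ge> real k / 2" "present_deg k H A \<ge> 0" for A by (auto simp: present_deg_def)
  let ?d = "present_deg k H U * present_deg k H (V - U - {y}) * present_deg k H (insert y (U - {z}))"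
  have "?d \<ge> (real k / 2) * (real k / 2) * (real k / 2)" by (intro mult_mono d mult_nonneg_nonneg) auto
  moreover have "(real k / 2) * (real k / 2) * (real k / 2) > 0" using assms by simp
  ultimately have "1 / ?d \<le> 1 / ((real k / 2) * (real k / 2) * (real k / 2))" by (intro divide_left_mono) auto
  then have "1 / ?d \<le> 8 / real k ^ 3" by (simp add: power3_eq_cube)
  then show "walk_weight V k H U y z w \<le> 8 / real k ^ 3" by (auto simp: walk_weight_def)
  show "0 \<le> walk_weight V k H U y z w" using d(2) by (simp add: walk_weight_def)
qed

lemma inverse_max_diff:
  fixes a b h :: real
  assumes "h > 0"
  shows "\<bar>1 / max a h - 1 / max b h\<bar> \<le> \<bar>a - b\<bar> / h\<^sup>2"
proof -
  have p: "max a h > 0" "max b h > 0" using assms by auto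
  have "1 / max a h - 1 / max b h = (max b h - max a h) / (max a h * max b h)"
    using p by (simp add: field_simps)
  then have "\<bar>1 / max a h - 1 / max b h\<bar> = \<bar>max b h - max a h\<bar> / (max a h * max b h)"
    using p by (simp add: abs_mult)
  also have "\<dots> \<le> \<bar>a - b\<bar> / (h * h)"
    using assms by (intro frac_le mult_mono) auto
  finally show ?thesis by (simp add: power2_eq_square)
qed

text \<open>The bound on \<open>walk_sum\<close> is smaller than the typical defect by a factor k
  because it is multiplied by a degree in the end.\<close>

locale walk_balanced = sparse_complement V k r H \<eta>
  for V :: "'a set" and k r :: nat and H :: "'a set set" and \<eta> :: real +
  fixes D :: real
  assumes D: "(real k + 1) * (1 - 2 * \<eta>) \<le> D" "D \<le> real k + 1"
    and walks: "U \<in> H \<Longrightarrow> \<bar>walk_sum V k D H U\<bar> \<le> \<eta> / real k"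
begin

abbreviation "d \<equiv> present_deg k H"

text \<open>Edge weights \<open>1 + \<phi> A + \<phi> B\<close> have weighted degree exactly
  \<open>D\<close> at \<open>A\<close> if and only if \<phi> + avg \<phi> = defect at
  \<open>A\<close>, where d is the true degree. This equation is the origin of \<open>defect\<close>
  and \<open>avg\<close>.\<close>

definition defect :: "'a set \<Rightarrow> real" where
  "defect A = D / d A - 1"

definition avg :: "('a set \<Rightarrow> real) \<Rightarrow> 'a set \<Rightarrow> real" where
  "avg \<psi> A = (\<Sum>B\<in>{B\<in>H. A \<inter> B = {}}. \<psi> B) / d A"

lemma d_ge: "d A \<ge> real k / 2" "d A > 0" "real (card {B\<in>H. A \<inter> B = {}}) \<le> d A"
  using k_pos by (auto simp: present_deg_def)

lemma nb_image:
  assumes A: "A \<in> nsets V k"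
  shows "{B\<in>H. A \<inter> B = {}} = (\<lambda>y. V - A - {y}) ` {y\<in>V-A. V - A - {y} \<in> H}"
proof (intro set_eqI iffI)
  fix B assume B: "B \<in> {B\<in>H. A \<inter> B = {}}"
  then have BN: "B \<in> nsets V k" using H by auto
  have cVA: "card (V - A) = Suc k" using compl_lower[OF A] by (rule nsetsD)
  have "B \<subseteq> V - A" using B BN by (auto simp: nsets_def)
  moreover have "card (V - A - B) = 1"
    using cVA BN \<open>B \<subseteq> V - A\<close> by (subst card_Diff_subset) (auto simp: nsets_def)
  ultimately obtain y where y: "V - A - B = {y}" by (auto simp: card_1_singleton_iff)
  then have "B = V - A - {y}" using \<open>B \<subseteq> V - A\<close> by blast
  moreover have "y \<in> V - A" using y by blast
  ultimately show "B \<in> (\<lambda>y. V - A - {y}) ` {y\<in>V-A. V - A - {y} \<in> H}" using B by blast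
qed auto

lemma nb_inj: "inj_on (\<lambda>y. V - A - {y}) (V - A)"
  by (auto simp: inj_on_def)

lemma avg_eq:
  assumes A: "A \<in> nsets V k"
  shows "avg \<psi> A = (\<Sum>y\<in>V-A. of_bool (V - A - {y} \<in> H) * \<psi> (V - A - {y})) / d A"
proof -
  have "(\<Sum>B\<in>{B\<in>H. A \<inter> B = {}}. \<psi> B) = (\<Sum>y\<in>{y\<in>V-A. V - A - {y} \<in> H}. \<psi> (V - A - {y}))"
    unfolding nb_image[OF A] by (subst sum.reindex) (auto intro: inj_on_subset[OF nb_inj])
  also have "\<dots> = (\<Sum>y\<in>V-A. of_bool (V - A - {y} \<in> H) * \<psi> (V - A - {y}))"
    using fin by (subst sum.inter_filter) (simp, rule sum.cong[OF refl], simp)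
  finally show ?thesis by (simp only: avg_def)
qed

lemma card_nb:
  assumes A: "A \<in> nsets V k"
  shows "card {B\<in>H. A \<inter> B = {}} = card {y\<in>V-A. V - A - {y} \<in> H}"
  unfolding nb_image[OF A] by (intro card_image inj_on_subset[OF nb_inj]) auto

lemma card_nb_bounds:
  assumes A: "A \<in> nsets V k"
  shows "real k + 1 - real r \<le> real (card {B\<in>H. A \<inter> B = {}})" "real (card {B\<in>H. A \<inter> B = {}}) \<le> real k + 1"
    "d A = real (card {B\<in>H. A \<inter> B = {}})"
proof -
  let ?T = "V - A"
  have T: "?T \<in> nsets V (Suc k)" by (rule compl_lower[OF A])
  have "card ?T = card {y\<in>?T. ?T - {y} \<in> H} + card {y\<in>?T. ?T - {y} \<notin> H}"
    using fin by (subst card_Un_disjoint[symmetric]) (auto intro!: arg_cong[where f=card])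
  then have *: "Suc k = card {B\<in>H. A \<inter> B = {}} + card {y\<in>?T. ?T - {y} \<notin> H}"
    using T by (simp add: card_nb[OF A] nsetsD)
  then show 1: "real k + 1 - real r \<le> real (card {B\<in>H. A \<inter> B = {}})" using sparse[OF T] by linarith
  show "real (card {B\<in>H. A \<inter> B = {}}) \<le> real k + 1" using * by linarith
  have "real r \<le> real k / 2" using r_small by linarith
  then show "d A = real (card {B\<in>H. A \<inter> B = {}})" using 1 by (simp add: present_deg_def)
qed

lemma defect_bound:
  assumes A: "A \<in> nsets V k"
  shows "\<bar>defect A\<bar> \<le> 2 * \<eta>"
proof -
  note b = card_nb_bounds[OF A]
  have dA: "real k + 1 - real r \<le> d A" "d A \<le> real k + 1" using b by auto
  have r2: "real r \<le> \<eta> * (real k + 1)" using r eta by (simp add: algebra_simps)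
  have "D \<le> (1 + 2 * \<eta>) * d A"
  proof -
    have "(1 + 2 * \<eta>) * d A \<ge> (1 + 2 * \<eta>) * ((real k + 1) * (1 - \<eta>))"
      using dA r2 eta by (intro mult_left_mono) (auto simp: algebra_simps)
    also have "(1 + 2 * \<eta>) * ((real k + 1) * (1 - \<eta>)) = (real k + 1) * (1 + \<eta> - 2 * \<eta> * \<eta>)"
      by (simp add: algebra_simps)
    also have "\<dots> \<ge> (real k + 1) * 1"
    proof (intro mult_left_mono)
      have "\<eta> * (2 * \<eta>) \<le> \<eta> * 1" using eta by (intro mult_left_mono) auto
      then show "1 \<le> 1 + \<eta> - 2 * \<eta> * \<eta>" by simp
    qed simp
    finally have "real k + 1 \<le> (1 + 2 * \<eta>) * d A" by simp
    with D(2) show ?thesis by (rule order_trans)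
  qed
  moreover have "D \<ge> (1 - 2 * \<eta>) * d A"
  proof -
    have "(1 - 2 * \<eta>) * d A \<le> (1 - 2 * \<eta>) * (real k + 1)" using dA eta by (intro mult_left_mono) auto
    then show ?thesis using D by (simp add: algebra_simps)
  qed
  ultimately have "D / d A \<le> 1 + 2 * \<eta>" "D / d A \<ge> 1 - 2 * \<eta>"
    using d_ge(2)[of A] by (simp_all add: divide_le_eq le_divide_eq)
  then show ?thesis unfolding defect_def abs_le_iff by linarith
qed

lemma avg_bound:
  assumes b: "\<And>B. B \<in> H \<Longrightarrow> \<bar>\<psi> B\<bar> \<le> c" and "c \<ge> 0"
  shows "\<bar>avg \<psi> A\<bar> \<le> c"
proof -
  have "\<bar>\<Sum>B\<in>{B\<in>H. A \<inter> B = {}}. \<psi> B\<bar> \<le> (\<Sum>B\<in>{B\<in>H. A \<inter> B = {}}. c)"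
    by (rule order_trans[OF sum_abs]) (intro sum_mono, auto intro: b)
  also have "\<dots> \<le> d A * c" using d_ge(3)[of A] \<open>c \<ge> 0\<close> by (simp add: mult_right_mono)
  finally show ?thesis unfolding avg_def using d_ge(2)[of A] by (simp add: divide_le_eq mult.commute)
qed

lemma weighted_sum_error:
  fixes p q :: "'b \<Rightarrow> real"
  assumes "finite Y" and n: "real (card {y\<in>Y. P y}) \<le> n" and "n > 0" "\<epsilon> \<ge> 0"
    and pq: "\<And>y. y \<in> Y \<Longrightarrow> P y \<Longrightarrow> \<bar>p y - q y\<bar> \<le> \<epsilon>"
  shows "\<bar>(\<Sum>y\<in>Y. of_bool (P y) * p y) / n - (\<Sum>y\<in>Y. of_bool (P y) * q y) / n\<bar> \<le> \<epsilon>"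
proof -
  have "\<bar>(\<Sum>y\<in>Y. of_bool (P y) * p y) - (\<Sum>y\<in>Y. of_bool (P y) * q y)\<bar> = \<bar>\<Sum>y\<in>Y. of_bool (P y) * (p y - q y)\<bar>"
    by (simp add: sum_subtractf right_diff_distrib)
  also have "\<dots> \<le> (\<Sum>y\<in>Y. of_bool (P y) * \<epsilon>)"
    by (rule order_trans[OF sum_abs]) (intro sum_mono, auto simp: abs_mult pq)
  also have "\<dots> = real (card {y\<in>Y. P y}) * \<epsilon>"
    using \<open>finite Y\<close> by (simp add: sum_distrib_right[symmetric] Int_def)
  also have "\<dots> \<le> n * \<epsilon>" using n \<open>\<epsilon> \<ge> 0\<close> by (intro mult_right_mono)
  finally show ?thesis
    using \<open>n > 0\<close> by (simp add: diff_divide_distrib[symmetric] divide_le_eq mult.commute)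
qed

definition main_term :: "'a set \<Rightarrow> real" where
  "main_term U = (\<Sum>y\<in>V-U. of_bool (V - U - {y} \<in> H) *
     ((\<Sum>z\<in>U. of_bool (insert y (U - {z}) \<in> H) *
       ((\<Sum>w\<in>V-U-{y}. of_bool (insert z (V - U - {y,w}) \<in> H) * defect (insert z (V - U - {y,w})))
        / d (insert y (U - {z})))) / d (V - U - {y}))) / d U"

lemma swap_in_nsets:
  assumes "U \<in> nsets V k" "y \<in> V - U" "z \<in> U"
  shows "insert y (U - {z}) \<in> nsets V k"
proof -
  have "U - {z} \<in> nsets V (k - 1)" using assms k_pos by (auto simp: nsets_def)
  then have "insert y (U - {z}) \<in> nsets V (Suc (k - 1))" using assms by (intro nsets_insertI) auto
  then show ?thesis using k_pos by simp
qed

text \<open>The omitted neighbour \<open>V - U - {y}\<close> is the set the walk came from; it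
  contributes at most 2 \<eta>, divided by a degree of at least k / 2.\<close>

lemma avg_step2:
  assumes U: "U \<in> nsets V k" and y: "y \<in> V - U" and z: "z \<in> U"
  shows "\<bar>avg defect (insert y (U - {z}))
    - (\<Sum>w\<in>V-U-{y}. of_bool (insert z (V - U - {y,w}) \<in> H) * defect (insert z (V - U - {y,w}))) / d (insert y (U - {z}))\<bar>
    \<le> 4 * \<eta> / real k"
proof -
  let ?A = "insert y (U - {z})"
  have A: "?A \<in> nsets V k" by (rule swap_in_nsets[OF U y z])
  have VA: "V - ?A = insert z (V - U - {y})" using U y z by (auto simp: nsets_def)
  have zn: "z \<notin> V - U - {y}" "finite (V - U - {y})" using z fin by auto
  have e1: "insert z (V - U - {y}) - {w} = insert z (V - U - {y,w})" if "w \<in> V - U - {y}" for w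
    using that z by auto
  have e2: "insert z (V - U - {y}) - {z} = V - U - {y}" using zn by auto
  have "avg defect ?A = (of_bool (V - U - {y} \<in> H) * defect (V - U - {y})
     + (\<Sum>w\<in>V-U-{y}. of_bool (insert z (V - U - {y,w}) \<in> H) * defect (insert z (V - U - {y,w})))) / d ?A"
  proof -
    have "(\<Sum>w\<in>V-U-{y}. of_bool (insert z (V - U - {y}) - {w} \<in> H) * defect (insert z (V - U - {y}) - {w}))
        = (\<Sum>w\<in>V-U-{y}. of_bool (insert z (V - U - {y,w}) \<in> H) * defect (insert z (V - U - {y,w})))"
      by (rule sum.cong[OF refl]) (simp only: e1)
    then show ?thesis unfolding avg_eq[OF A] VA sum.insert[OF zn(2,1)] e2 by (simp only:)
  qed
  then have "\<bar>avg defect ?A - (\<Sum>w\<in>V-U-{y}. of_bool (insert z (V - U - {y,w}) \<in> H) * defect (insert z (V - U - {y,w}))) / d ?A\<bar>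
    = \<bar>of_bool (V - U - {y} \<in> H) * defect (V - U - {y})\<bar> / d ?A"
    using d_ge(2)[of ?A] by (simp add: add_divide_distrib)
  also have "\<dots> \<le> (2 * \<eta>) / (real k / 2)"
    using defect_bound[of "V - U - {y}"] H eta d_ge[of ?A] k_pos
    by (intro frac_le) (auto simp: abs_mult)
  finally show ?thesis by simp
qed

text \<open>A walk can step back at its second or its third step, and each possibility costs 4
  \<eta> / k as in \<open>avg_step2\<close>.\<close>

lemma avg3_main:
  assumes U: "U \<in> H"
  shows "\<bar>avg (avg (avg defect)) U - main_term U\<bar> \<le> 8 * \<eta> / real k"
proof -
  have UN: "U \<in> nsets V k" using U H by auto
  have UV: "U \<subseteq> V" "finite U" using UN by (auto simp: nsets_def)
  define t2 where "t2 = (\<lambda>y z. (\<Sum>w\<in>V-U-{y}. of_bool (insert z (V - U - {y,w}) \<in> H) * defect (insert z (V - U - {y,w}))) / d (insert y (U - {z})))"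
  define t1 where "t1 = (\<lambda>y. (\<Sum>z\<in>U. of_bool (insert y (U - {z}) \<in> H) * t2 y z) / d (V - U - {y}))"
  have eta4: "4 * \<eta> / real k \<ge> 0" using eta by simp
  have db: "\<bar>defect B\<bar> \<le> 2 * \<eta>" if "B \<in> H" for B using that H by (intro defect_bound) auto
  have step1: "\<bar>avg (avg defect) (V - U - {y}) - t1 y\<bar> \<le> 8 * \<eta> / real k" if y: "y \<in> V - U" and vH: "V - U - {y} \<in> H" for y
  proof -
    let ?A = "V - U - {y}"
    have A: "?A \<in> nsets V k" using vH H by auto
    have VA: "V - ?A = insert y U" using UV y by auto
    have zn: "y \<notin> U" "finite U" using y UV by auto
    have e1: "insert y U - {z} = insert y (U - {z})" if "z \<in> U" for z using that y by auto
    have e2: "insert y U - {y} = U" using zn by auto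
    have cnt: "real (card {z\<in>U. insert y (U - {z}) \<in> H}) \<le> d ?A"
    proof -
      have "card {z\<in>U. insert y (U - {z}) \<in> H} \<le> card {z\<in>V-?A. V - ?A - {z} \<in> H}"
        unfolding VA using UV e1 by (intro card_mono) auto
      then show ?thesis using d_ge(3)[of ?A] card_nb[OF A] by simp
    qed
    have "avg (avg defect) ?A = of_bool (U \<in> H) * avg defect U / d ?A
       + (\<Sum>z\<in>U. of_bool (insert y (U - {z}) \<in> H) * avg defect (insert y (U - {z}))) / d ?A"
    proof -
      have "(\<Sum>z\<in>U. of_bool (insert y U - {z} \<in> H) * avg defect (insert y U - {z}))
          = (\<Sum>z\<in>U. of_bool (insert y (U - {z}) \<in> H) * avg defect (insert y (U - {z})))"
        by (rule sum.cong[OF refl]) (simp only: e1)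
      then show ?thesis unfolding avg_eq[OF A] VA sum.insert[OF zn(2,1)] e2 by (simp only: add_divide_distrib)
    qed
    moreover have "\<bar>(\<Sum>z\<in>U. of_bool (insert y (U - {z}) \<in> H) * avg defect (insert y (U - {z}))) / d ?A - t1 y\<bar> \<le> 4 * \<eta> / real k"
      unfolding t1_def using avg_step2[OF UN y] unfolding t2_def[symmetric]
      by (intro weighted_sum_error UV cnt d_ge(2) eta4) (auto simp: t2_def)
    moreover have "\<bar>of_bool (U \<in> H) * avg defect U / d ?A\<bar> \<le> 4 * \<eta> / real k"
    proof -
      have "\<bar>of_bool (U \<in> H) * avg defect U / d ?A\<bar> = \<bar>avg defect U\<bar> / d ?A" using U d_ge(2)[of ?A] by simp
      also have "\<dots> \<le> (2 * \<eta>) / (real k / 2)"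
        using avg_bound[of defect "2 * \<eta>" U, OF db] eta d_ge[of ?A] k_pos by (intro frac_le) auto
      finally show ?thesis by simp
    qed
    ultimately show ?thesis by linarith
  qed
  have cnt: "real (card {y\<in>V-U. V - U - {y} \<in> H}) \<le> d U"
    using d_ge(3)[of U] card_nb[OF UN] by simp
  have "main_term U = (\<Sum>y\<in>V-U. of_bool (V - U - {y} \<in> H) * t1 y) / d U"
    unfolding main_term_def t1_def t2_def ..
  then show ?thesis unfolding avg_eq[OF UN]
    using step1 fin eta by (simp only:) (intro weighted_sum_error cnt d_ge(2); simp)
qed

text \<open>The end of the walk has two neighbours more than the fresh ones, or just one if
  \<open>insert w (U - {z})\<close> is missing. The expressions agree in the first case and differ
  by O(1 / k) in the second.\<close>

lemma defect_vs_fresh: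
  assumes U: "U \<in> nsets V k" and y: "y \<in> V - U" and z: "z \<in> U" and w: "w \<in> V - U - {y}"
    and pr: "insert y (U - {z}) \<in> H"
  shows "\<bar>defect (insert z (V - U - {y,w})) - deg_defect k D (fresh_deg H U y z w)\<bar>
     \<le> 8 / real k * of_bool (insert w (U - {z}) \<notin> H)"
proof -
  let ?A = "insert z (V - U - {y,w})"
  have UV: "U \<subseteq> V" "finite U" using U by (auto simp: nsets_def)
  have VA: "V - ?A = insert y (insert w (U - {z}))" using UV y z w by auto
  have "insert w (U - {z}) \<in> nsets V k" using w by (intro swap_in_nsets[OF U _ z]) auto
  then have "V - ?A \<in> nsets V (Suc k)" unfolding VA using y w by (intro nsets_insertI) auto
  then have A: "?A \<in> nsets V k" using compl_upper[of "V - ?A"] UV z by (simp add: double_diff insert_absorb subset_iff)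
  define F where "F = {t\<in>U - {z}. insert y (insert w (U - {z,t})) \<in> H}"
  define W where "W = insert y (insert w (U - {z}))"
  have out: "w \<notin> F" "y \<notin> F" "y \<noteq> w" "finite F" using y w UV by (auto simp: F_def)
  have e: "W - {y} = insert w (U - {z})" "W - {w} = insert y (U - {z})"
    "\<And>t. t \<in> U - {z} \<Longrightarrow> W - {t} = insert y (insert w (U - {z,t}))"
    using y w by (auto simp: W_def)
  have "{t\<in>W. W - {t} \<in> H} = insert w (F \<union> (if insert w (U - {z}) \<in> H then {y} else {}))"
  proof (rule set_eqI)
    fix t
    consider "t = y" | "t = w" | "t \<in> U - {z}" "t \<noteq> y" "t \<noteq> w" | "t \<notin> W" by (auto simp: W_def)
    then show "t \<in> {t\<in>W. W - {t} \<in> H} \<longleftrightarrow> t \<in> insert w (F \<union> (if insert w (U - {z}) \<in> H then {y} else {}))"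
    proof cases
      case 1
      have "y \<in> W" by (simp add: W_def)
      then show ?thesis using 1 out by (simp add: e(1))
    next
      case 2
      have "w \<in> W" by (simp add: W_def)
      then show ?thesis using 2 pr by (simp add: e(2))
    next
      case 3
      have "t \<in> W" using 3 by (simp add: W_def)
      moreover have "t \<in> F \<longleftrightarrow> W - {t} \<in> H" unfolding e(3)[OF 3(1)] F_def using 3(1) by simp
      ultimately show ?thesis using 3 by simp
    next
      case 4
      then have "t \<noteq> w" "t \<noteq> y" "t \<notin> F" by (auto simp: W_def F_def)
      then show ?thesis using 4 by simp
    qed
  qed
  moreover have "{t\<in>V-?A. V - ?A - {t} \<in> H} = {t\<in>W. W - {t} \<in> H}" unfolding VA W_def ..
  moreover note out
  ultimately have c: "card {B\<in>H. ?A \<inter> B = {}} = card F + 1 + of_bool (insert w (U - {z}) \<in> H)"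
    unfolding card_nb[OF A] by auto
  have fr: "fresh_deg H U y z w = card F" by (simp add: fresh_deg_def F_def)
  show ?thesis
  proof (cases "insert w (U - {z}) \<in> H")
    case True
    then have "defect ?A = deg_defect k D (fresh_deg H U y z w)"
      using c by (simp add: defect_def deg_defect_def present_deg_def fr add.commute)
    then show ?thesis by simp
  next
    case False
    let ?h = "real k / 2"
    have D0: "0 \<le> D"
    proof -
      have "0 \<le> (real k + 1) * (1 - 2 * \<eta>)" using eta by (intro mult_nonneg_nonneg) auto
      then show ?thesis using D by linarith
    qed
    have "defect ?A - deg_defect k D (fresh_deg H U y z w)
      = D * (1 / max (real (card F) + 1) ?h) - D * (1 / max (2 + real (card F)) ?h)"
      using False c by (simp add: defect_def deg_defect_def present_deg_def fr add.commute)
    then have "\<bar>defect ?A - deg_defect k D (fresh_deg H U y z w)\<bar> = D * \<bar>1 / max (real (card F) + 1) ?h - 1 / max (2 + real (card F)) ?h\<bar>"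
      using D0 by (simp only: right_diff_distrib[symmetric] abs_mult abs_of_nonneg)
    also have "\<dots> \<le> D * (\<bar>(real (card F) + 1) - (2 + real (card F))\<bar> / ?h\<^sup>2)"
      using k_pos D0 by (intro mult_left_mono inverse_max_diff) auto
    also have "\<dots> = D * (4 / (real k)\<^sup>2)" by (simp add: power2_eq_square)
    also have "\<dots> \<le> (2 * real k) * (4 / (real k)\<^sup>2)" using D k_large by (intro mult_right_mono) auto
    also have "\<dots> = 8 / real k" using k_pos by (simp add: power2_eq_square)
    finally show ?thesis using False by simp
  qed
qed

text \<open>A wrong degree costs at most 64 / k^4 per walk. By sparsity below
  \<open>insert w U\<close>, at most (k + 1)^2 r triples have \<open>insert w (U - {z})\<close>
  missing, and r is at most \<eta> k.\<close>

lemma main_term_walk_sum: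
  assumes U: "U \<in> H"
  shows "\<bar>main_term U - walk_sum V k D H U\<bar> \<le> 256 * \<eta> / real k"
proof -
  have UN: "U \<in> nsets V k" using U H by auto
  have UV: "U \<subseteq> V" "finite U" "card U = k" using UN by (auto simp: nsets_def)
  have cVU: "card (V - U) = Suc k" using compl_lower[OF UN] by (rule nsetsD)
  let ?v = "\<lambda>y z w. insert z (V - U - {y,w})"
  have m: "main_term U = (\<Sum>y\<in>V-U. \<Sum>z\<in>U. \<Sum>w\<in>V-U-{y}. walk_weight V k H U y z w * defect (?v y z w))"
    unfolding main_term_def sum_distrib_left sum_divide_distrib
    by (intro sum.cong refl) (auto simp: walk_weight_def)
  note wb = walk_weight_bounds[OF k_pos, of V H U]
  have "\<bar>main_term U - walk_sum V k D H U\<bar> \<le> (\<Sum>y\<in>V-U. \<Sum>z\<in>U. \<Sum>w\<in>V-U-{y}.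
     \<bar>walk_weight V k H U y z w * defect (?v y z w) - walk_weight V k H U y z w * deg_defect k D (fresh_deg H U y z w)\<bar>)"
    unfolding m walk_sum_def sum_subtractf[symmetric]
    by (intro order_trans[OF sum_abs] sum_mono order_refl)
  also have "\<dots> \<le> (\<Sum>y\<in>V-U. \<Sum>z\<in>U. \<Sum>w\<in>V-U-{y}. 64 / real k ^ 4 * of_bool (insert w (U - {z}) \<notin> H))"
  proof (intro sum_mono)
    fix y z w assume a: "y \<in> V - U" "z \<in> U" "w \<in> V - U - {y}"
    show "\<bar>walk_weight V k H U y z w * defect (?v y z w) - walk_weight V k H U y z w * deg_defect k D (fresh_deg H U y z w)\<bar>
      \<le> 64 / real k ^ 4 * of_bool (insert w (U - {z}) \<notin> H)"
    proof (cases "insert y (U - {z}) \<in> H")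
      case False
      then show ?thesis by (simp add: walk_weight_def)
    next
      case True
      have "\<bar>walk_weight V k H U y z w * defect (?v y z w) - walk_weight V k H U y z w * deg_defect k D (fresh_deg H U y z w)\<bar>
        = walk_weight V k H U y z w * \<bar>defect (?v y z w) - deg_defect k D (fresh_deg H U y z w)\<bar>"
        using wb(1)[of y z w] by (simp add: right_diff_distrib[symmetric] abs_mult)
      also have "\<dots> \<le> 8 / real k ^ 3 * (8 / real k * of_bool (insert w (U - {z}) \<notin> H))"
        using wb[of y z w] by (intro mult_mono defect_vs_fresh[OF UN a True]) auto
      also have "\<dots> = 64 / real k ^ 4 * of_bool (insert w (U - {z}) \<notin> H)" by (simp add: power_def)
      finally show ?thesis .
    qed
  qed
  also have "\<dots> \<le> (\<Sum>y\<in>V-U. 64 / real k ^ 4 * ((real k + 1) * real r))"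
  proof (intro sum_mono)
    fix y assume y: "y \<in> V - U"
    have "(\<Sum>z\<in>U. \<Sum>w\<in>V-U-{y}. 64 / real k ^ 4 * of_bool (insert w (U - {z}) \<notin> H))
      = 64 / real k ^ 4 * (\<Sum>w\<in>V-U-{y}. \<Sum>z\<in>U. of_bool (insert w (U - {z}) \<notin> H))"
      by (subst sum.swap) (simp only: sum_distrib_left)
    also have "\<dots> \<le> 64 / real k ^ 4 * (\<Sum>w\<in>V-U-{y}. real r)"
    proof (intro mult_left_mono sum_mono)
      fix w assume w: "w \<in> V - U - {y}"
      have T: "insert w U \<in> nsets V (Suc k)" using UN w by (auto simp: nsets_def)
      have "(\<Sum>z\<in>U. of_bool (insert w (U - {z}) \<notin> H)) = real (card {z\<in>U. insert w (U - {z}) \<notin> H})"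
        using UV by (simp add: Int_def)
      also have "card {z\<in>U. insert w (U - {z}) \<notin> H} \<le> card {z\<in>insert w U. insert w U - {z} \<notin> H}"
      proof (intro card_mono)
        show "{z\<in>U. insert w (U - {z}) \<notin> H} \<subseteq> {z\<in>insert w U. insert w U - {z} \<notin> H}"
          using w by (auto simp: insert_Diff_if)
      qed (use UV in auto)
      also have "\<dots> \<le> r" by (rule sparse[OF T])
      finally show "(\<Sum>z\<in>U. of_bool (insert w (U - {z}) \<notin> H)) \<le> real r" by simp
    qed simp
    also have "\<dots> \<le> 64 / real k ^ 4 * ((real k + 1) * real r)"
    proof -
      have "card (V - U - {y}) \<le> Suc k" using cVU by (simp add: card_Diff_singleton_if)
      then show ?thesis by (intro mult_left_mono) (auto intro!: mult_right_mono)
    qed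
    finally show "(\<Sum>z\<in>U. \<Sum>w\<in>V-U-{y}. 64 / real k ^ 4 * of_bool (insert w (U - {z}) \<notin> H)) \<le> 64 / real k ^ 4 * ((real k + 1) * real r)" .
  qed
  also have "\<dots> = 64 / real k ^ 4 * ((real k + 1) * (real k + 1) * real r)"
    unfolding sum_constant cVU by (simp only: of_nat_Suc mult_ac add.commute)
  also have "\<dots> \<le> 64 / real k ^ 4 * ((2 * real k) * (2 * real k) * (\<eta> * real k))"
    using k_large r by (intro mult_left_mono mult_mono) auto
  also have "\<dots> = 256 * \<eta> / real k" using k_pos by (simp add: field_simps power4_eq_xxxx)
  finally show ?thesis .
qed

text \<open>Partial sum of the series for (1 + avg)^(-1) applied to \<open>defect\<close>. In
  \<open>potential + avg potential\<close> everything telescopes except \<open>defect\<close> and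
  the triple average.\<close>

definition potential :: "'a set \<Rightarrow> real" where
  "potential A = defect A - avg defect A + avg (avg defect) A"

lemma avg_potential: "avg potential A = avg defect A - avg (avg defect) A + avg (avg (avg defect)) A"
  unfolding avg_def[of potential] avg_def[of defect A] avg_def[of "avg defect" A] avg_def[of "avg (avg defect)" A] potential_def
  by (simp add: sum.distrib sum_subtractf add_divide_distrib diff_divide_distrib)

text \<open>265 = 8 + 256 + 1 collects the steps back, the missing non-fresh neighbours and the walk
  sum; a degree of at most 2 k turns 265 \<eta> / k into 530 \<eta>.\<close>

sublocale balanced_hypergraph V k r H \<eta> D potential
proof
  have db: "\<bar>defect B\<bar> \<le> 2 * \<eta>" if "B \<in> H" for B using that H by (intro defect_bound) auto
  have e0: "2 * \<eta> \<ge> 0" using eta by simp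
  show "real k / 2 \<le> D"
  proof -
    have "real k / 2 \<le> (real k + 1) * (1/2)" by simp
    also have "\<dots> \<le> (real k + 1) * (1 - 2 * \<eta>)" using eta by (intro mult_left_mono) auto
    finally show ?thesis using D by simp
  qed
  show "D \<le> real k + 1" by (rule D)
  fix A assume A: "A \<in> H"
  then have AN: "A \<in> nsets V k" using H by auto
  have "\<bar>avg defect B\<bar> \<le> 2 * \<eta>" for B by (rule avg_bound[OF db e0])
  moreover from this have "\<bar>avg (avg defect) B\<bar> \<le> 2 * \<eta>" for B by (rule avg_bound[OF _ e0])
  ultimately show "\<bar>potential A\<bar> \<le> 6 * \<eta>" unfolding potential_def
    using db[OF A] by (smt (verit))
  let ?N = "{B\<in>H. A \<inter> B = {}}"
  have dA: "d A = real (card ?N)" by (rule card_nb_bounds[OF AN])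
  have "(\<Sum>B\<in>?N. 1 + potential A + potential B) = d A * (1 + potential A) + d A * avg potential A"
    using d_ge(2)[of A] by (simp add: sum.distrib avg_def dA algebra_simps)
  also have "\<dots> = d A * (1 + defect A) + d A * avg (avg (avg defect)) A"
    unfolding avg_potential by (simp add: potential_def algebra_simps)
  also have "d A * (1 + defect A) = D" using d_ge(2)[of A] by (simp add: defect_def)
  finally have "(\<Sum>B\<in>?N. 1 + potential A + potential B) - D = d A * avg (avg (avg defect)) A" by simp
  moreover have "\<bar>avg (avg (avg defect)) A\<bar> \<le> 265 * \<eta> / real k"
  proof -
    have "\<bar>avg (avg (avg defect)) A\<bar> \<le> 8 * \<eta> / real k + 256 * \<eta> / real k + \<eta> / real k"
      using avg3_main[OF A] main_term_walk_sum[OF A] walks[OF A] by linarith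
    then show ?thesis by (simp add: add_divide_distrib[symmetric])
  qed
  moreover have "d A \<le> 2 * real k" using card_nb_bounds(2)[OF AN] dA k_large by simp
  ultimately have "\<bar>(\<Sum>B\<in>?N. 1 + potential A + potential B) - D\<bar> \<le> (2 * real k) * (265 * \<eta> / real k)"
    using d_ge(2)[of A] by (simp only: abs_mult) (intro mult_mono; simp)
  then show "\<bar>(\<Sum>B\<in>?N. 1 + potential A + potential B) - D\<bar> \<le> 530 * \<eta>"
    using k_pos by simp
qed

end

section \<open>The random hypergraph\<close>


lemma prob_all_missing:
  assumes I: "finite I" "X \<subseteq> I" and p: "0 \<le> p" "p \<le> 1"
  shows "measure_pmf.prob (Pi_pmf I False (\<lambda>_. bernoulli_pmf p)) {\<omega>. \<forall>A\<in>X. \<not> \<omega> A} = (1 - p) ^ card X"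
proof -
  let ?B = "\<lambda>A. if A \<in> X then {False} else UNIV"
  have "{\<omega>. \<forall>A\<in>X. \<not> \<omega> A} = Pi I ?B" using I by (auto simp: Pi_def split: if_splits)
  then have "measure_pmf.prob (Pi_pmf I False (\<lambda>_. bernoulli_pmf p)) {\<omega>. \<forall>A\<in>X. \<not> \<omega> A}
      = (\<Prod>A\<in>I. measure_pmf.prob (bernoulli_pmf p) (?B A))"
    using measure_Pi_pmf_Pi[OF I(1)] by simp
  also have "\<dots> = (\<Prod>A\<in>I. if A \<in> X then 1 - p else 1)"
    using p by (intro prod.cong refl) (simp add: measure_pmf_single)
  also have "\<dots> = (\<Prod>A\<in>X. 1 - p)"
    using I by (simp add: prod.If_cases Int_absorb1)
  finally show ?thesis by simp
qed

definition kgraph_of :: "'a set \<Rightarrow> nat \<Rightarrow> ('a set \<Rightarrow> bool) \<Rightarrow> 'a set set" where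
  "kgraph_of V k \<omega> = {A\<in>nsets V k. \<omega> A}"

text \<open>If more than \<open>r\<close> subsets are missing, some \<open>r + 1\<close> distinct
  coins all fail; there are at most 2^(k + 1) choices for them.\<close>

lemma prob_not_sparse:
  assumes fin: "finite V" and T: "T \<in> nsets V (Suc k)" and p: "0 \<le> p" "p \<le> 1"
  shows "measure_pmf.prob (Pi_pmf (nsets V k) False (\<lambda>_. bernoulli_pmf p))
      {\<omega>. r < card {z\<in>T. T - {z} \<notin> kgraph_of V k \<omega>}} \<le> 2 ^ (k + 1) * (1 - p) ^ Suc r"
proof -
  let ?P = "Pi_pmf (nsets V k) False (\<lambda>_. bernoulli_pmf p)"
  have fI: "finite (nsets V k)" using fin by (rule finite_imp_finite_nsets)
  have fT: "finite T" "card T = Suc k" using T by (auto dest: nsetsD)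
  define Zs where "Zs = {Z. Z \<subseteq> T \<and> card Z = Suc r}"
  have fZ: "finite Zs" unfolding Zs_def using fT by auto
  have sub: "{\<omega>. r < card {z\<in>T. T - {z} \<notin> kgraph_of V k \<omega>}} \<subseteq> (\<Union>Z\<in>Zs. {\<omega>. \<forall>A\<in>(\<lambda>z. T - {z}) ` Z. \<not> \<omega> A})"
  proof
    fix \<omega> assume "\<omega> \<in> {\<omega>. r < card {z\<in>T. T - {z} \<notin> kgraph_of V k \<omega>}}"
    then have "Suc r \<le> card {z\<in>T. T - {z} \<notin> kgraph_of V k \<omega>}" by simp
    from obtain_subset_with_card_n[OF this]
    obtain Z where Z: "Z \<subseteq> {z\<in>T. T - {z} \<notin> kgraph_of V k \<omega>}" "card Z = Suc r" .
    then have "Z \<in> Zs" by (auto simp: Zs_def)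
    moreover have "\<not> \<omega> (T - {z})" if "z \<in> Z" for z
      using Z(1) that nsets_removeI[OF T, of z] by (auto simp: kgraph_of_def)
    ultimately show "\<omega> \<in> (\<Union>Z\<in>Zs. {\<omega>. \<forall>A\<in>(\<lambda>z. T - {z}) ` Z. \<not> \<omega> A})" by auto
  qed
  have each: "measure_pmf.prob ?P {\<omega>. \<forall>A\<in>(\<lambda>z. T - {z}) ` Z. \<not> \<omega> A} = (1 - p) ^ Suc r" if "Z \<in> Zs" for Z
  proof -
    have Z: "Z \<subseteq> T" "card Z = Suc r" using that by (auto simp: Zs_def)
    have "(\<lambda>z. T - {z}) ` Z \<subseteq> nsets V k" using Z nsets_removeI[OF T] by auto
    moreover have "card ((\<lambda>z. T - {z}) ` Z) = Suc r"
      using Z by (subst card_image) (auto simp: inj_on_def)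
    ultimately show ?thesis using prob_all_missing[OF fI _ p, of "(\<lambda>z. T - {z}) ` Z"] by (simp only:)
  qed
  have "measure_pmf.prob ?P {\<omega>. r < card {z\<in>T. T - {z} \<notin> kgraph_of V k \<omega>}}
     \<le> measure_pmf.prob ?P (\<Union>Z\<in>Zs. {\<omega>. \<forall>A\<in>(\<lambda>z. T - {z}) ` Z. \<not> \<omega> A})"
    using sub by (intro measure_pmf.finite_measure_mono) auto
  also have "\<dots> \<le> (\<Sum>Z\<in>Zs. measure_pmf.prob ?P {\<omega>. \<forall>A\<in>(\<lambda>z. T - {z}) ` Z. \<not> \<omega> A})"
    by (intro measure_pmf.finite_measure_subadditive_finite fZ) auto
  also have "\<dots> = real (card Zs) * (1 - p) ^ Suc r" using each by simp
  also have "\<dots> \<le> 2 ^ (k + 1) * (1 - p) ^ Suc r"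
  proof (intro mult_right_mono)
    have "card Zs \<le> card (Pow T)" using fT by (intro card_mono) (auto simp: Zs_def)
    also have "\<dots> = 2 ^ (k + 1)" using fT by (simp add: card_Pow)
    finally have "real (card Zs) \<le> real (2 ^ (k + 1))" by (simp only: of_nat_le_iff)
    then show "real (card Zs) \<le> 2 ^ (k + 1)" by simp
  qed (use p in auto)
  finally show ?thesis .
qed

section \<open>The mean of the defect and the choice of D\<close>

text \<open>The constant for which \<^const>\<open>deg_defect\<close> has mean zero at a binomial argument.\<close>

definition balance_const :: "nat \<Rightarrow> real \<Rightarrow> real" where
  "balance_const k p = 1 / measure_pmf.expectation (binomial_pmf (k - 1) p) (\<lambda>m. 1 / max (2 + real m) (real k / 2))"

context
  fixes k :: nat and p :: real
  assumes k: "4 \<le> k" and p: "0 \<le> p" "p \<le> 1"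
begin

lemma integrable_binomial: "integrable (measure_pmf (binomial_pmf n p)) (f :: nat \<Rightarrow> real)"
  using p by (intro integrable_measure_pmf_finite) auto

lemma binomial_le: "m \<in> set_pmf (binomial_pmf n p) \<Longrightarrow> m \<le> n"
  using p by (auto simp: set_pmf_binomial_eq split: if_splits)

lemma expectation_binomial: "measure_pmf.expectation (binomial_pmf n p) real = real n * p"
proof -
  let ?P = "Pi_pmf {..<n} False (\<lambda>_. bernoulli_pmf p)"
  have int: "integrable (measure_pmf ?P) f" for f :: "_ \<Rightarrow> real"
    by (intro integrable_measure_pmf_finite finite_set_Pi_bernoulli) auto
  have "binomial_pmf n p = map_pmf (\<lambda>f. card {x\<in>{..<n}. f x}) ?P"
    by (rule binomial_pmf_altdef') (use p in auto)
  then have "measure_pmf.expectation (binomial_pmf n p) real = measure_pmf.expectation ?P (\<lambda>f. \<Sum>x<n. of_bool (f x))"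
    by (simp add: Int_def)
  also have "\<dots> = (\<Sum>x<n. measure_pmf.expectation ?P (\<lambda>f. of_bool (f x)))"
    by (intro Bochner_Integration.integral_sum int)
  also have "\<dots> = (\<Sum>x<n. p)"
  proof (intro sum.cong refl)
    fix x assume x: "x \<in> {..<n}"
    have "measure_pmf.expectation ?P (\<lambda>f. of_bool (f x)) = measure_pmf.expectation (map_pmf (\<lambda>f. f x) ?P) (of_bool :: bool \<Rightarrow> real)"
      by simp
    also have "map_pmf (\<lambda>f. f x) ?P = bernoulli_pmf p" using x by (subst Pi_pmf_component) auto
    finally show "measure_pmf.expectation ?P (\<lambda>f. of_bool (f x)) = p" using p by simp
  qed
  finally show ?thesis by simp
qed

text \<open>A lower bound on the constant needs the reciprocal from above. With y = max (2 + m) (k /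
  2), the excess 1 / y - 1 / (k + 1) is at most (k - 1 - m) * 2 / (k (k + 1)), because y is at least
  k / 2, and k - 1 - m has mean (k - 1) (1 - p).\<close>

lemma balance_const_bounds:
  "(real k + 1) * (1 - 2 * (1 - p)) \<le> balance_const k p" "balance_const k p \<le> real k + 1"
  "measure_pmf.expectation (binomial_pmf (k - 1) p) (deg_defect k (balance_const k p)) = 0"
proof -
  let ?E = "measure_pmf.expectation (binomial_pmf (k - 1) p)"
  let ?f = "\<lambda>m. 1 / max (2 + real m) (real k / 2)"
  define \<kappa> where "\<kappa> = ?E ?f"
  have low: "1 / (real k + 1) \<le> ?f m" if "m \<in> set_pmf (binomial_pmf (k - 1) p)" for m
    using binomial_le[OF that] k by (intro divide_left_mono) auto
  have "?E (\<lambda>_. 1 / (real k + 1)) \<le> \<kappa>"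
    unfolding \<kappa>_def by (intro integral_mono_AE integrable_binomial AE_pmfI low)
  then have k1: "1 / (real k + 1) \<le> \<kappa>" by simp
  then have k0: "\<kappa> > 0" using k by (intro less_le_trans[OF _ k1]) auto
  have up: "?f m \<le> 1 / (real k + 1) + (real k - 1 - real m) * (2 / (real k * (real k + 1)))"
    if "m \<in> set_pmf (binomial_pmf (k - 1) p)" for m
  proof -
    let ?y = "max (2 + real m) (real k / 2)"
    have y: "?y \<le> real k + 1" "?y \<ge> real k / 2" "?y > 0" using binomial_le[OF that] k by auto
    have "?f m - 1 / (real k + 1) = (real k + 1 - ?y) * (1 / (?y * (real k + 1)))"
      using y by (simp add: field_simps)
    also have "\<dots> \<le> (real k - 1 - real m) * (2 / (real k * (real k + 1)))"
    proof (intro mult_mono)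
      have "(real k / 2) * (real k + 1) \<le> ?y * (real k + 1)" using y by (intro mult_right_mono) auto
      then have "1 / (?y * (real k + 1)) \<le> 1 / ((real k / 2) * (real k + 1))"
        using k by (intro divide_left_mono) auto
      then show "1 / (?y * (real k + 1)) \<le> 2 / (real k * (real k + 1))" by simp
      show "0 \<le> real k - 1 - real m" using binomial_le[OF that] k by (simp add: of_nat_diff)
    qed (use y in auto)
    finally show ?thesis by simp
  qed
  have "\<kappa> \<le> ?E (\<lambda>m. 1 / (real k + 1) + (real k - 1 - real m) * (2 / (real k * (real k + 1))))"
    unfolding \<kappa>_def by (intro integral_mono_AE integrable_binomial AE_pmfI up)
  also have "\<dots> = 1 / (real k + 1) + (real k - 1 - real (k - 1) * p) * (2 / (real k * (real k + 1)))"
    by (simp add: integrable_binomial expectation_binomial)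
  also have "\<dots> = 1 / (real k + 1) + (real k - 1) * (1 - p) * (2 / (real k * (real k + 1)))"
    using k by (simp add: of_nat_diff algebra_simps)
  also have "\<dots> \<le> 1 / (real k + 1) + real k * (1 - p) * (2 / (real k * (real k + 1)))"
    using p k by (intro add_left_mono mult_right_mono) auto
  also have "real k * (1 - p) * (2 / (real k * (real k + 1))) = 2 * (1 - p) / (real k + 1)"
    using k by simp
  finally have k2': "\<kappa> \<le> 1 / (real k + 1) + 2 * (1 - p) / (real k + 1)" .
  have "1 / (real k + 1) + 2 * (1 - p) / (real k + 1) = (1 + 2 * (1 - p)) / (real k + 1)"
    by (simp only: add_divide_distrib)
  with k2' have k2: "\<kappa> \<le> (1 + 2 * (1 - p)) / (real k + 1)" by simp
  have D: "balance_const k p = 1 / \<kappa>" by (simp add: balance_const_def \<kappa>_def)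
  show "balance_const k p \<le> real k + 1" unfolding D using k1 k0 by (simp add: field_simps)
  have "((real k + 1) * (1 - 2 * (1 - p))) * \<kappa> \<le> 1"
  proof (cases "1 - 2 * (1 - p) \<ge> 0")
    case True
    then have "((real k + 1) * (1 - 2 * (1 - p))) * \<kappa> \<le> ((real k + 1) * (1 - 2 * (1 - p))) * ((1 + 2 * (1 - p)) / (real k + 1))"
      by (intro mult_left_mono k2) auto
    also have "\<dots> = 1 - (2 * (1 - p))\<^sup>2" using k by (simp add: field_simps power2_eq_square)
    also have "\<dots> \<le> 1" by simp
    finally show ?thesis .
  next
    case False
    then have "((real k + 1) * (1 - 2 * (1 - p))) * \<kappa> \<le> 0" using k0 by (intro mult_nonpos_nonneg mult_nonneg_nonpos) auto
    then show ?thesis by simp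
  qed
  then show "(real k + 1) * (1 - 2 * (1 - p)) \<le> balance_const k p"
    unfolding D using k0 by (simp add: le_divide_eq)
  have "?E (deg_defect k (balance_const k p)) = ?E (\<lambda>m. (1 / \<kappa>) * ?f m - 1)"
    by (simp add: deg_defect_def[abs_def] D)
  also have "\<dots> = (1 / \<kappa>) * \<kappa> - 1"
    unfolding \<kappa>_def by (subst Bochner_Integration.integral_diff) (simp_all add: integrable_binomial del: times_divide_eq_left times_divide_eq_right)
  finally show "?E (deg_defect k (balance_const k p)) = 0" using k0 by simp
qed

end

lemma deg_defect_diff:
  assumes k: "4 \<le> k" and D: "0 \<le> D" "D \<le> real k + 1" and m: "\<bar>real a - real b\<bar> \<le> 1"
  shows "\<bar>deg_defect k D a - deg_defect k D b\<bar> \<le> 8 / real k"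
proof -
  let ?h = "real k / 2"
  have "deg_defect k D a - deg_defect k D b = D * (1 / max (2 + real a) ?h) - D * (1 / max (2 + real b) ?h)"
    by (simp add: deg_defect_def)
  then have "\<bar>deg_defect k D a - deg_defect k D b\<bar> = D * \<bar>1 / max (2 + real a) ?h - 1 / max (2 + real b) ?h\<bar>"
    using D by (simp only: right_diff_distrib[symmetric] abs_mult abs_of_nonneg)
  also have "\<dots> \<le> D * (\<bar>(2 + real a) - (2 + real b)\<bar> / ?h\<^sup>2)"
    using k D by (intro mult_left_mono inverse_max_diff) auto
  also have "\<dots> \<le> (2 * real k) * (1 / ?h\<^sup>2)"
    using D k m by (intro mult_mono divide_right_mono) auto
  also have "\<dots> = 8 / real k" using k by (simp add: power2_eq_square)
  finally show ?thesis .
qed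

section \<open>Concentration of the walk sum at one centre\<close>

text \<open>\<open>mean\<close> is the property for which \<open>balance_const\<close> was made. The
  condition \<open>4 \<le> k\<close> separates intersections with \<open>U\<close> of size at most 1
  from those of size k - 2.\<close>

locale walk_centre =
  fixes V :: "'a set" and k :: nat and U :: "'a set" and p D :: real
  assumes fin: "finite V" and card_V: "card V = 2 * k + 1" and U: "U \<in> nsets V k" and k: "4 \<le> k"
    and p: "0 \<le> p" "p \<le> 1" and D: "0 \<le> D" "D \<le> real k + 1"
    and mean: "measure_pmf.expectation (binomial_pmf (k - 1) p) (deg_defect k D) = 0"
begin

text \<open>The sets at distance four from \<open>U\<close> in the Kneser graph; the weights of the walks of length three
  do not depend on them.\<close>

definition outer :: "'a set set" where
  "outer = {B\<in>nsets V k. card (B \<inter> U) = k - 2}"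

definition fresh :: "'a \<Rightarrow> 'a \<Rightarrow> 'a \<Rightarrow> 'a \<Rightarrow> 'a set" where
  "fresh y z w t = insert y (insert w (U - {z,t}))"

lemma U': "U \<subseteq> V" "finite U" "card U = k" using U by (auto simp: nsets_def)

lemma cVU: "card (V - U) = k + 1" using U' fin card_V by (simp add: card_Diff_subset)

lemma finite_outer: "finite outer"
  unfolding outer_def using finite_imp_finite_nsets[OF fin] by simp

lemma outer_diffs:
  assumes "B \<in> outer"
  shows "card (B - U) = 2" "card (U - B) = 2"
proof -
  have B: "finite B" "card B = k" "card (B \<inter> U) = k - 2" using assms by (auto simp: outer_def nsets_def)
  have "card (B - U) = card B - card (B \<inter> U)" using B by (simp add: card_Diff_subset_Int)
  then show "card (B - U) = 2" using B k by simp
  have "card (U - B) = card U - card (U \<inter> B)" using B U' by (simp add: card_Diff_subset_Int)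
  then show "card (U - B) = 2" using B k U' by (simp add: Int_commute)
qed

lemma card_outer: "real (card outer) \<le> real k ^ 4"
proof -
  have "card outer \<le> card (nsets U 2 \<times> nsets (V - U) 2)"
  proof (rule card_inj_on_le[where f="\<lambda>B. (U - B, B - U)"])
    show "inj_on (\<lambda>B. (U - B, B - U)) outer" by (auto simp: inj_on_def)
    show "(\<lambda>B. (U - B, B - U)) ` outer \<subseteq> nsets U 2 \<times> nsets (V - U) 2"
    proof clarify
      fix B assume B: "B \<in> outer"
      then have "B \<subseteq> V" "finite B" by (auto simp: outer_def nsets_def)
      then show "U - B \<in> nsets U 2 \<and> B - U \<in> nsets (V - U) 2"
        using outer_diffs[OF B] U' by (auto simp: nsets_def)
    qed
    show "finite (nsets U 2 \<times> nsets (V - U) 2)"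
      using U' fin by (intro finite_cartesian_product finite_imp_finite_nsets) auto
  qed
  also have "\<dots> = (k choose 2) * (Suc k choose 2)" using U' cVU by (simp add: card_cartesian_product card_nsets)
  also have "\<dots> \<le> (k * k) * (k * k)"
  proof (rule mult_mono)
    show "k choose 2 \<le> k * k" by (simp add: choose_two) (meson diff_le_self div_le_dividend le_trans mult_le_mono2)
    show "Suc k choose 2 \<le> k * k"
    proof -
      have "Suc k \<le> 2 * k" using k by simp
      then have "Suc k * k \<le> 2 * k * k" by (intro mult_right_mono) auto
      then have "Suc k * k div 2 \<le> 2 * k * k div 2" by (rule div_le_mono)
      moreover have "2 * k * k div 2 = k * k" by (simp add: mult.assoc)
      moreover have "Suc k choose 2 = Suc k * k div 2" by (simp add: choose_two)
      ultimately show ?thesis by (simp only:)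
    qed
  qed auto
  finally have "real (card outer) \<le> real ((k * k) * (k * k))" by (simp only: of_nat_le_iff)
  then show ?thesis by (simp add: power4_eq_xxxx)
qed

lemma fresh_outer:
  assumes "y \<in> V - U" "z \<in> U" "w \<in> V - U - {y}" "t \<in> U - {z}"
  shows "fresh y z w t \<in> outer"
proof -
  have "card {z,t} = 2" using assms by auto
  then have c: "card (U - {z,t}) = k - 2" using assms U' by (subst card_Diff_subset) auto
  have "fresh y z w t \<inter> U = U - {z,t}" using assms by (auto simp: fresh_def)
  moreover have "card (fresh y z w t) = k"
  proof -
    have "y \<notin> insert w (U - {z,t})" "w \<notin> U - {z,t}" "finite (U - {z,t})" using assms U' by auto
    then show ?thesis using c k unfolding fresh_def by simp
  qed
  ultimately show ?thesis using assms U' c unfolding outer_def nsets_def by (auto simp: fresh_def)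
qed

text \<open>The weight looks at the vertices of the walk and at the neighbours of the first three.
  All these sets have at most one point in \<open>U\<close> or at most one point outside, whereas
  outer sets have k - 2 points in \<open>U\<close> and two outside.\<close>

lemma walk_weight_cong:
  assumes H: "H \<subseteq> nsets V k" "H' \<subseteq> nsets V k" and eq: "\<And>A. A \<notin> outer \<Longrightarrow> A \<in> H \<longleftrightarrow> A \<in> H'"
    and yzw: "y \<in> V - U" "z \<in> U" "w \<in> V - U - {y}"
  shows "walk_weight V k H U y z w = walk_weight V k H' U y z w"
proof -
  have out: "A \<notin> outer" if "card (A \<inter> U) \<noteq> k - 2" for A using that by (auto simp: outer_def)
  have low: "A \<notin> outer" if "card (A \<inter> U) \<le> 1" for A using that k by (intro out) linarith
  have nb: "present_deg k H A = present_deg k H' A" if "\<And>B. B \<in> nsets V k \<Longrightarrow> A \<inter> B = {} \<Longrightarrow> B \<notin> outer" for A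
  proof -
    have "{B\<in>H. A \<inter> B = {}} = {B\<in>H'. A \<inter> B = {}}" using that eq H by blast
    then show ?thesis by (simp add: present_deg_def)
  qed
  have 1: "present_deg k H U = present_deg k H' U"
  proof (rule nb)
    fix B assume "U \<inter> B = {}"
    then have "B \<inter> U = {}" by auto
    then show "B \<notin> outer" by (intro low) simp
  qed
  have 2: "present_deg k H (V - U - {y}) = present_deg k H' (V - U - {y})"
  proof (rule nb)
    fix B assume B: "B \<in> nsets V k" "(V - U - {y}) \<inter> B = {}"
    then have "B - U \<subseteq> {y}" by (auto simp: nsets_def)
    then have "card (B - U) \<le> 1" by (metis card_mono finite.emptyI finite_insert is_singletonI is_singleton_altdef)
    then show "B \<notin> outer" using outer_diffs(1)[of B] by auto
  qed
  have 3: "present_deg k H (insert y (U - {z})) = present_deg k H' (insert y (U - {z}))"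
  proof (rule nb)
    fix B assume "insert y (U - {z}) \<inter> B = {}"
    then have "B \<inter> U \<subseteq> {z}" by auto
    then have "card (B \<inter> U) \<le> card {z}" by (intro card_mono) auto
    then show "B \<notin> outer" by (intro low) simp
  qed
  have "V - U - {y} \<notin> outer" by (intro low) (simp add: Int_Diff Diff_Int_distrib2)
  moreover have "insert y (U - {z}) \<notin> outer"
  proof (rule out)
    have "insert y (U - {z}) \<inter> U = U - {z}" using yzw by auto
    then show "card (insert y (U - {z}) \<inter> U) \<noteq> k - 2" using yzw U' k by simp
  qed
  moreover have "insert z (V - U - {y,w}) \<notin> outer"
  proof (rule low)
    have "insert z (V - U - {y,w}) \<inter> U = {z}" using yzw by auto
    then show "card (insert z (V - U - {y,w}) \<inter> U) \<le> 1" by simp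
  qed
  ultimately show ?thesis unfolding walk_weight_def 1 2 3 using eq by simp
qed

context
  fixes f :: "'a set \<Rightarrow> bool"
begin

text \<open>Outer coins follow \<omega>, all others are frozen to \<open>f\<close>.\<close>

definition merged :: "('a set \<Rightarrow> bool) \<Rightarrow> 'a set set" where
  "merged \<omega> = kgraph_of V k (\<lambda>A. if A \<in> outer then \<omega> A else f A)"

definition weight :: "'a \<Rightarrow> 'a \<Rightarrow> 'a \<Rightarrow> real" where
  "weight y z w = walk_weight V k (merged (\<lambda>_. False)) U y z w"

definition fresh_count :: "('a set \<Rightarrow> bool) \<Rightarrow> 'a \<Rightarrow> 'a \<Rightarrow> 'a \<Rightarrow> nat" where
  "fresh_count \<omega> y z w = card {t\<in>U-{z}. \<omega> (fresh y z w t)}"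

lemma walk_sum_merged:
  "walk_sum V k D (merged \<omega>) U = (\<Sum>y\<in>V-U. \<Sum>z\<in>U. \<Sum>w\<in>V-U-{y}. weight y z w * deg_defect k D (fresh_count \<omega> y z w))"
  unfolding walk_sum_def
proof (intro sum.cong refl arg_cong2[where f="(*)"])
  fix y z w assume a: "y \<in> V - U" "z \<in> U" "w \<in> V - U - {y}"
  show "walk_weight V k (merged \<omega>) U y z w = weight y z w"
    unfolding weight_def by (rule walk_weight_cong[OF _ _ _ a]) (auto simp: merged_def kgraph_of_def)
  have "fresh y z w t \<in> merged \<omega> \<longleftrightarrow> \<omega> (fresh y z w t)" if "t \<in> U - {z}" for t
    using fresh_outer[OF a that] by (auto simp: merged_def kgraph_of_def outer_def)
  then show "deg_defect k D (fresh_deg (merged \<omega>) U y z w) = deg_defect k D (fresh_count \<omega> y z w)"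
    unfolding fresh_deg_def fresh_count_def fresh_def[symmetric] by (metis (mono_tags, lifting))
qed

text \<open>The potential fresh neighbours of one walk are k - 1 different outer sets, so their
  count is binomial, and \<open>D\<close> makes this mean vanish.\<close>

lemma expectation_fresh:
  assumes a: "y \<in> V - U" "z \<in> U" "w \<in> V - U - {y}"
  shows "measure_pmf.expectation (Pi_pmf outer False (\<lambda>_. bernoulli_pmf p)) (\<lambda>\<omega>. deg_defect k D (fresh_count \<omega> y z w)) = 0"
proof -
  let ?P = "Pi_pmf outer False (\<lambda>_. bernoulli_pmf p)"
  define X where "X = fresh y z w ` (U - {z})"
  have inj: "inj_on (fresh y z w) (U - {z})"
  proof (rule inj_onI)
    fix t t' assume t: "t \<in> U - {z}" "t' \<in> U - {z}" "fresh y z w t = fresh y z w t'"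
    have "U - {z} - fresh y z w s = {s}" if "s \<in> U - {z}" for s using that a by (auto simp: fresh_def)
    then show "t = t'" using t by (metis singleton_inject)
  qed
  have X: "X \<subseteq> outer" "finite X" "card X = k - 1"
    using fresh_outer[OF a] U' a(2) inj by (auto simp: X_def card_image)
  have cnt: "fresh_count \<omega> y z w = card {x\<in>X. \<omega> x}" for \<omega>
  proof -
    have "{x\<in>X. \<omega> x} = fresh y z w ` {t\<in>U-{z}. \<omega> (fresh y z w t)}" by (auto simp: X_def)
    moreover have "card (fresh y z w ` {t\<in>U-{z}. \<omega> (fresh y z w t)}) = card {t\<in>U-{z}. \<omega> (fresh y z w t)}"
      by (intro card_image inj_on_subset[OF inj]) auto
    ultimately show ?thesis unfolding fresh_count_def by (simp only:)
  qed
  have "binomial_pmf (k - 1) p = map_pmf (\<lambda>f. card {x\<in>X. f x}) (Pi_pmf X False (\<lambda>_. bernoulli_pmf p))"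
    by (rule binomial_pmf_altdef') (use X p in auto)
  also have "Pi_pmf X False (\<lambda>_. bernoulli_pmf p) = map_pmf (\<lambda>f x. if x \<in> X then f x else False) ?P"
    by (rule Pi_pmf_subset[OF finite_outer X(1)])
  finally have "binomial_pmf (k - 1) p = map_pmf (\<lambda>\<omega>. fresh_count \<omega> y z w) ?P"
    by (simp add: map_pmf_comp cnt cong: conj_cong)
  then have "measure_pmf.expectation (binomial_pmf (k - 1) p) (deg_defect k D)
     = measure_pmf.expectation ?P (\<lambda>\<omega>. deg_defect k D (fresh_count \<omega> y z w))" by simp
  then show ?thesis using mean by simp
qed

lemma expectation_walk_sum:
  "measure_pmf.expectation (Pi_pmf outer False (\<lambda>_. bernoulli_pmf p)) (\<lambda>\<omega>. walk_sum V k D (merged \<omega>) U) = 0"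
proof -
  let ?P = "Pi_pmf outer False (\<lambda>_. bernoulli_pmf p)"
  have int: "integrable (measure_pmf ?P) h" for h :: "_ \<Rightarrow> real"
    by (intro integrable_measure_pmf_finite finite_set_Pi_bernoulli finite_outer)
  have "measure_pmf.expectation ?P (\<lambda>\<omega>. walk_sum V k D (merged \<omega>) U)
    = (\<Sum>y\<in>V-U. \<Sum>z\<in>U. \<Sum>w\<in>V-U-{y}. weight y z w * measure_pmf.expectation ?P (\<lambda>\<omega>. deg_defect k D (fresh_count \<omega> y z w)))"
    unfolding walk_sum_merged by (simp add: int)
  also have "\<dots> = 0" by (intro sum.neutral ballI) (simp add: expectation_fresh)
  finally show ?thesis .
qed

text \<open>\<open>B\<close> is fresh for a walk only if \<open>y\<close> and \<open>w\<close> lie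
  in \<open>B - U\<close> and \<open>z\<close> in \<open>U - B\<close>. Both sets have two points,
  so at most 8 walks notice \<open>B\<close>, and each changes by at most (8 / k^3) (8 / k).\<close>

lemma walk_sum_bounded_difference:
  assumes B: "B \<in> outer"
  shows "\<bar>walk_sum V k D (merged (fun_upd \<omega> B True)) U - walk_sum V k D (merged (fun_upd \<omega> B False)) U\<bar> \<le> 512 / real k ^ 4"
proof -
  have s1: "(\<Sum>y\<in>V-U. of_bool (y \<in> B - U) :: real) = 2"
  proof -
    have "(V - U) \<inter> {y. y \<in> B - U} = B - U" using B by (auto simp: outer_def nsets_def)
    then show ?thesis using fin outer_diffs(1)[OF B] by (subst sum_of_bool_eq) auto
  qed
  have s2: "(\<Sum>z\<in>U. of_bool (z \<in> U - B) :: real) = 2"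
  proof -
    have "U \<inter> {y. y \<in> U - B} = U - B" by auto
    then show ?thesis using U' outer_diffs(2)[OF B] by (subst sum_of_bool_eq) auto
  qed
  let ?m = "\<lambda>b y z w. fresh_count (fun_upd \<omega> B b) y z w"
  let ?bnd = "\<lambda>y z w. 64 / real k ^ 4 * (of_bool (y \<in> B - U) * (of_bool (z \<in> U - B) * of_bool (w \<in> B - U)))"
  have term_le: "\<bar>weight y z w * deg_defect k D (?m True y z w) - weight y z w * deg_defect k D (?m False y z w)\<bar> \<le> ?bnd y z w"
    if a: "y \<in> V - U" "z \<in> U" "w \<in> V - U - {y}" for y z w
  proof (cases "\<exists>t\<in>U-{z}. fresh y z w t = B")
    case False
    then have "?m True y z w = ?m False y z w"
      unfolding fresh_count_def by (intro arg_cong[where f=card] Collect_cong) auto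
    then show ?thesis by simp
  next
    case True
    then obtain t where t: "t \<in> U - {z}" "fresh y z w t = B" by blast
    have mem: "y \<in> B - U" "z \<in> U - B" "w \<in> B - U" using a t by (auto simp: fresh_def)
    have uniq: "s = t" if "s \<in> U - {z}" "fresh y z w s = B" for s
    proof -
      have "U - {z} - fresh y z w s = {s}" "U - {z} - fresh y z w t = {t}" using that t a by (auto simp: fresh_def)
      then show ?thesis using that t by simp
    qed
    have "{s\<in>U-{z}. fun_upd \<omega> B True (fresh y z w s)} = insert t {s\<in>U-{z}. fun_upd \<omega> B False (fresh y z w s)}"
    proof (intro set_eqI)
      fix s
      show "s \<in> {s\<in>U-{z}. fun_upd \<omega> B True (fresh y z w s)} \<longleftrightarrow> s \<in> insert t {s\<in>U-{z}. fun_upd \<omega> B False (fresh y z w s)}"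
        using t uniq[of s] by (cases "fresh y z w s = B") auto
    qed
    then have "?m True y z w = Suc (?m False y z w)"
      unfolding fresh_count_def using U' t by (simp add: card_insert_if)
    then have "\<bar>deg_defect k D (?m True y z w) - deg_defect k D (?m False y z w)\<bar> \<le> 8 / real k"
      by (intro deg_defect_diff k D) simp
    moreover have "\<bar>weight y z w\<bar> \<le> 8 / real k ^ 3"
      unfolding weight_def using walk_weight_bounds[of k V "merged (\<lambda>_. False)" U y z w] k by simp
    ultimately have "\<bar>weight y z w\<bar> * \<bar>deg_defect k D (?m True y z w) - deg_defect k D (?m False y z w)\<bar> \<le> 8 / real k ^ 3 * (8 / real k)"
      by (intro mult_mono) auto
    then show ?thesis using mem by (simp add: right_diff_distrib[symmetric] abs_mult power_def)
  qed
  have "\<bar>walk_sum V k D (merged (fun_upd \<omega> B True)) U - walk_sum V k D (merged (fun_upd \<omega> B False)) U\<bar>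
     \<le> (\<Sum>y\<in>V-U. \<Sum>z\<in>U. \<Sum>w\<in>V-U-{y}. \<bar>weight y z w * deg_defect k D (?m True y z w) - weight y z w * deg_defect k D (?m False y z w)\<bar>)"
    unfolding walk_sum_merged sum_subtractf[symmetric]
    by (intro order_trans[OF sum_abs] sum_mono order_refl)
  also have "\<dots> \<le> (\<Sum>y\<in>V-U. \<Sum>z\<in>U. \<Sum>w\<in>V-U-{y}. ?bnd y z w)"
    by (intro sum_mono term_le)
  also have "\<dots> \<le> (\<Sum>y\<in>V-U. \<Sum>z\<in>U. \<Sum>w\<in>V-U. ?bnd y z w)"
    using fin by (intro sum_mono sum_mono2) auto
  also have "\<dots> = 64 / real k ^ 4 * ((\<Sum>y\<in>V-U. of_bool (y \<in> B - U)) * ((\<Sum>z\<in>U. of_bool (z \<in> U - B)) * (\<Sum>w\<in>V-U. of_bool (w \<in> B - U))))"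
    by (simp only: sum_distrib_left[symmetric] sum_distrib_right[symmetric])
  also have "\<dots> = 512 / real k ^ 4" unfolding s1 s2 by simp
  finally show ?thesis .
qed

end

text \<open>Conditionally on the coins outside \<open>outer\<close>, the squared differences sum to
  at most k^4 (512 / k^4)^2 = 2^18 / k^4. The factor 2 covers both signs.\<close>

lemma prob_walk_sum_large:
  assumes t: "0 \<le> t"
  shows "measure_pmf.prob (Pi_pmf (nsets V k) False (\<lambda>_. bernoulli_pmf p))
      {\<omega>. t < \<bar>walk_sum V k D (kgraph_of V k \<omega>) U\<bar>} \<le> 2 * exp (- 2 * t\<^sup>2 * real k ^ 4 / 2 ^ 18)"
proof (rule prob_Pi_pmf_condition[OF finite_imp_finite_nsets[OF fin]])
  show "outer \<subseteq> nsets V k" by (auto simp: outer_def)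
  fix f :: "'a set \<Rightarrow> bool"
  let ?P = "Pi_pmf outer False (\<lambda>_. bernoulli_pmf p)"
  let ?g = "\<lambda>\<omega>. walk_sum V k D (merged f \<omega>) U"
  define C where "C = 2 ^ 18 / real k ^ 4"
  have C: "(\<Sum>i\<in>outer. (512 / real k ^ 4)\<^sup>2) \<le> C" "0 < C"
  proof -
    have "(\<Sum>i\<in>outer. (512 / real k ^ 4)\<^sup>2) = real (card outer) * (512 / real k ^ 4)\<^sup>2" by simp
    also have "\<dots> \<le> real k ^ 4 * (512 / real k ^ 4)\<^sup>2" by (intro mult_right_mono card_outer) auto
    also have "\<dots> = C"
    proof -
      have "q * (512 / q)\<^sup>2 = 2 ^ 18 / q" if "q > 0" for q :: real
        using that by (simp add: power2_eq_square)
      then show ?thesis using k unfolding C_def by simp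
    qed
    finally show "(\<Sum>i\<in>outer. (512 / real k ^ 4)\<^sup>2) \<le> C" .
    show "0 < C" using k by (simp add: C_def)
  qed
  have 1: "measure_pmf.prob ?P {\<omega>. ?g \<omega> \<ge> t} \<le> exp (- 2 * t\<^sup>2 / C)"
    by (rule bounded_differences_tail[OF finite_outer p walk_sum_bounded_difference C t expectation_walk_sum])
  have 2: "measure_pmf.prob ?P {\<omega>. - ?g \<omega> \<ge> t} \<le> exp (- 2 * t\<^sup>2 / C)"
  proof (rule bounded_differences_tail[OF finite_outer p _ C t])
    fix \<omega> B assume B: "B \<in> outer"
    show "\<bar>- ?g (fun_upd \<omega> B True) - - ?g (fun_upd \<omega> B False)\<bar> \<le> 512 / real k ^ 4"
      using walk_sum_bounded_difference[OF B, of f \<omega>] by (simp add: abs_minus_commute)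
  next
    show "measure_pmf.expectation ?P (\<lambda>\<omega>. - ?g \<omega>) = 0" using expectation_walk_sum[of f] by simp
  qed
  have "{\<omega>. (\<lambda>x. if x \<in> outer then \<omega> x else f x) \<in> {\<omega>. t < \<bar>walk_sum V k D (kgraph_of V k \<omega>) U\<bar>}}
      \<subseteq> {\<omega>. ?g \<omega> \<ge> t} \<union> {\<omega>. - ?g \<omega> \<ge> t}"
    unfolding merged_def by auto
  then have "measure_pmf.prob ?P {\<omega>. (\<lambda>x. if x \<in> outer then \<omega> x else f x) \<in> {\<omega>. t < \<bar>walk_sum V k D (kgraph_of V k \<omega>) U\<bar>}}
     \<le> measure_pmf.prob ?P ({\<omega>. ?g \<omega> \<ge> t} \<union> {\<omega>. - ?g \<omega> \<ge> t})"
    by (intro measure_pmf.finite_measure_mono) auto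
  also have "\<dots> \<le> measure_pmf.prob ?P {\<omega>. ?g \<omega> \<ge> t} + measure_pmf.prob ?P {\<omega>. - ?g \<omega> \<ge> t}"
    by (intro measure_Un_le) auto
  also have "\<dots> \<le> 2 * exp (- 2 * t\<^sup>2 / C)" using 1 2 by simp
  also have "- 2 * t\<^sup>2 / C = - 2 * t\<^sup>2 * real k ^ 4 / 2 ^ 18" by (simp add: C_def)
  finally show "measure_pmf.prob ?P {\<omega>. (\<lambda>x. if x \<in> outer then \<omega> x else f x) \<in> {\<omega>. t < \<bar>walk_sum V k D (kgraph_of V k \<omega>) U\<bar>}}
     \<le> 2 * exp (- 2 * t\<^sup>2 * real k ^ 4 / 2 ^ 18)" .
qed

end

text \<open>At t = \<eta> / k the tail for one centre is 2 exp(- \<eta>^2 k^2 / 2^17), at most 2 *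
  8^(-k) by \<open>big\<close>, and (1 - p)^(\<eta> k) is at most 16^(-k). The first beats the at
  most 2 * 4^k sets, the second also the 2^(k + 1) choices in
  \<open>prob_not_sparse\<close>.\<close>

lemma prob_strong_EKR:
  fixes V :: "'a set" and \<eta> p :: real
  assumes fin: "finite V" and cV: "card V = 2 * k + 1"
    and eta: "0 < \<eta>" "\<eta> \<le> 1 / 10^8" "1 \<le> \<eta> * real k" and big: "ln 8 \<le> \<eta>\<^sup>2 / 2 ^ 17 * real k"
    and p: "0 \<le> p" "p \<le> 1" "1 - p \<le> \<eta>" "1 - p \<le> (1 / 16) powr (1 / \<eta>)"
  shows "measure_pmf.prob (Pi_pmf (nsets V k) False (\<lambda>_. bernoulli_pmf p)) {\<omega>. strong_EKR V (kgraph_of V k \<omega>)}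
     \<ge> 1 - 8 * (1 / 2) ^ k"
proof -
  let ?P = "Pi_pmf (nsets V k) False (\<lambda>_. bernoulli_pmf p)"
  \<comment> \<open>Rounded down, so that the exponent \<open>Suc r\<close> is still at least \<eta>
    k.\<close>
  define r where "r = nat \<lfloor>\<eta> * real k\<rfloor>"
  have r: "real r \<le> \<eta> * real k" "\<eta> * real k \<le> real (Suc r)"
    using eta unfolding r_def by linarith+
  have k8: "real k \<ge> 10^8" using eta(2,3) by (rule large_of_eta)
  have "(4 :: real) \<le> 10^8" by simp
  then have "4 \<le> real k" using k8 by (rule order_trans)
  then have k4: "4 \<le> k" by simp
  define D where "D = balance_const k p"
  note Db = balance_const_bounds[OF k4 p(1,2), folded D_def]
  have D1: "(real k + 1) * (1 - 2 * \<eta>) \<le> D"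
  proof -
    have "(real k + 1) * (1 - 2 * \<eta>) \<le> (real k + 1) * (1 - 2 * (1 - p))" using p by (intro mult_left_mono) auto
    then show ?thesis using Db(1) by (rule order_trans)
  qed
  have D0: "0 \<le> D"
  proof -
    have "0 \<le> (real k + 1) * (1 - 2 * \<eta>)" using eta by (intro mult_nonneg_nonneg) auto
    then show ?thesis using D1 by simp
  qed
  define S where "S = (\<lambda>T. {\<omega>. r < card {z\<in>T. T - {z} \<notin> kgraph_of V k \<omega>}})"
  define Z where "Z = (\<lambda>U. {\<omega>. \<eta> / real k < \<bar>walk_sum V k D (kgraph_of V k \<omega>) U\<bar>})"
  have good: "strong_EKR V (kgraph_of V k \<omega>)"
    if \<omega>: "\<omega> \<notin> (\<Union>T\<in>nsets V (Suc k). S T)" "\<omega> \<notin> (\<Union>U\<in>nsets V k. Z U)" for \<omega>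
  proof -
    interpret walk_balanced V k r "kgraph_of V k \<omega>" \<eta> D
    proof
      show "card {z\<in>T. T - {z} \<notin> kgraph_of V k \<omega>} \<le> r" if "T \<in> nsets V (Suc k)" for T
        using that \<omega>(1) by (auto simp: S_def not_less)
      show "\<bar>walk_sum V k D (kgraph_of V k \<omega>) U\<bar> \<le> \<eta> / real k" if "U \<in> kgraph_of V k \<omega>" for U
        using that \<omega>(2) by (auto simp: Z_def kgraph_of_def not_less)
    qed (use fin cV eta r D1 Db(2) in \<open>auto simp: kgraph_of_def\<close>)
    show ?thesis by (rule strong_EKR_if_balanced)
  qed
  have binom: "real (2 * k + 1 choose i) \<le> 2 * 4 ^ k" for i
  proof -
    have "real (2 * k + 1 choose i) \<le> real (2 ^ (2 * k + 1))"
      using binomial_le_pow2[of "2 * k + 1" i] by (simp only: of_nat_le_iff)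
    also have "\<dots> = 2 * 4 ^ k" by (simp add: power_mult)
    finally show ?thesis .
  qed
  have fI: "finite (nsets V j)" for j using fin by (rule finite_imp_finite_nsets)
  have PS: "measure_pmf.prob ?P (\<Union>T\<in>nsets V (Suc k). S T) \<le> 4 * (1 / 2) ^ k"
  proof -
    have pw: "(1 - p) ^ Suc r \<le> (1 / 16) ^ k"
    proof -
      let ?e = "(1 / 16 :: real) powr (1 / \<eta>)"
      have e: "0 < ?e" "?e \<le> 1" using eta by (auto intro: powr_le1)
      have "(1 - p) ^ Suc r \<le> ?e ^ Suc r" using p by (intro power_mono) auto
      also have "\<dots> = ?e powr real (Suc r)" using e(1) by (rule powr_realpow[symmetric])
      also have "\<dots> \<le> ?e powr (\<eta> * real k)" using e r by (intro powr_mono') auto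
      also have "\<dots> = (1 / 16) powr real k" using eta by (simp add: powr_powr)
      also have "\<dots> = (1 / 16) ^ k" by (simp add: powr_realpow)
      finally show ?thesis .
    qed
    have "measure_pmf.prob ?P (\<Union>T\<in>nsets V (Suc k). S T) \<le> (\<Sum>T\<in>nsets V (Suc k). measure_pmf.prob ?P (S T))"
      by (intro measure_pmf.finite_measure_subadditive_finite fI) auto
    also have "\<dots> \<le> (\<Sum>T\<in>nsets V (Suc k). 2 ^ (k + 1) * (1 / 16) ^ k)"
    proof (intro sum_mono)
      fix T assume T: "T \<in> nsets V (Suc k)"
      have "measure_pmf.prob ?P (S T) \<le> 2 ^ (k + 1) * (1 - p) ^ Suc r"
        unfolding S_def by (rule prob_not_sparse[OF fin T p(1,2)])
      also have "\<dots> \<le> 2 ^ (k + 1) * (1 / 16) ^ k" by (intro mult_left_mono pw) auto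
      finally show "measure_pmf.prob ?P (S T) \<le> 2 ^ (k + 1) * (1 / 16) ^ k" .
    qed
    also have "\<dots> = real (2 * k + 1 choose Suc k) * (2 ^ (k + 1) * (1 / 16) ^ k)" by (simp add: card_nsets cV)
    also have "\<dots> \<le> (2 * 4 ^ k) * (2 ^ (k + 1) * (1 / 16) ^ k)" by (intro mult_right_mono binom) auto
    also have "\<dots> = 4 * (4 * 2 * (1 / 16)) ^ k" by (simp only: power_mult_distrib) simp
    finally show ?thesis by simp
  qed
  have PZ: "measure_pmf.prob ?P (\<Union>U\<in>nsets V k. Z U) \<le> 4 * (1 / 2) ^ k"
  proof -
    have ex: "exp (- 2 * (\<eta> / real k)\<^sup>2 * real k ^ 4 / 2 ^ 18) \<le> (1 / 8) ^ k"
    proof -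
      have "(\<eta> / real k)\<^sup>2 * real k ^ 4 = \<eta>\<^sup>2 * real k * real k"
        using k4 by (simp add: power2_eq_square power4_eq_xxxx)
      then have "- 2 * (\<eta> / real k)\<^sup>2 * real k ^ 4 / 2 ^ 18 = - ((\<eta>\<^sup>2 / 2 ^ 17 * real k) * real k)"
        by (simp add: mult.assoc)
      also have "\<dots> \<le> - (ln 8 * real k)" using mult_right_mono[OF big, of "real k"] by simp
      finally have "exp (- 2 * (\<eta> / real k)\<^sup>2 * real k ^ 4 / 2 ^ 18) \<le> exp (real k * (- ln 8))" by (simp add: mult.commute)
      also have "\<dots> = exp (- ln 8) ^ k" by (rule exp_of_nat_mult)
      also have "exp (- ln 8) = (1 / 8 :: real)" by (simp add: exp_minus)
      finally show ?thesis .
    qed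
    have "measure_pmf.prob ?P (\<Union>U\<in>nsets V k. Z U) \<le> (\<Sum>U\<in>nsets V k. measure_pmf.prob ?P (Z U))"
      by (intro measure_pmf.finite_measure_subadditive_finite fI) auto
    also have "\<dots> \<le> (\<Sum>U\<in>nsets V k. 2 * (1 / 8) ^ k)"
    proof (intro sum_mono)
      fix U assume U: "U \<in> nsets V k"
      interpret walk_centre V k U p D
        by standard (use fin cV U k4 p D0 Db in auto)
      have "measure_pmf.prob ?P (Z U) \<le> 2 * exp (- 2 * (\<eta> / real k)\<^sup>2 * real k ^ 4 / 2 ^ 18)"
        unfolding Z_def by (rule prob_walk_sum_large) (use eta in auto)
      also have "\<dots> \<le> 2 * (1 / 8) ^ k" using ex by simp
      finally show "measure_pmf.prob ?P (Z U) \<le> 2 * (1 / 8) ^ k" .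
    qed
    also have "\<dots> = real (2 * k + 1 choose k) * (2 * (1 / 8) ^ k)" by (simp add: card_nsets cV)
    also have "\<dots> \<le> (2 * 4 ^ k) * (2 * (1 / 8) ^ k)" by (intro mult_right_mono binom) auto
    also have "\<dots> = 4 * (4 * (1 / 8)) ^ k" by (simp only: power_mult_distrib)
    finally show ?thesis by simp
  qed
  let ?G = "{\<omega>. strong_EKR V (kgraph_of V k \<omega>)}"
  have "1 - measure_pmf.prob ?P ?G = measure_pmf.prob ?P (UNIV - ?G)"
    using measure_pmf.prob_compl[of ?G ?P] by simp
  also have "\<dots> \<le> measure_pmf.prob ?P ((\<Union>T\<in>nsets V (Suc k). S T) \<union> (\<Union>U\<in>nsets V k. Z U))"
    using good by (intro measure_pmf.finite_measure_mono) auto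
  also have "\<dots> \<le> measure_pmf.prob ?P (\<Union>T\<in>nsets V (Suc k). S T) + measure_pmf.prob ?P (\<Union>U\<in>nsets V k. Z U)"
    by (intro measure_Un_le) auto
  also have "\<dots> \<le> 8 * (1 / 2) ^ k" using PS PZ by simp
  finally show ?thesis by simp
qed

theorem theorem1p1:
  "\<exists>\<epsilon>>0. \<forall>p :: nat \<Rightarrow> real. (\<forall>k. 1 - \<epsilon> < p k \<and> 0 \<le> p k \<and> p k \<le> 1) \<longrightarrow>
     (\<lambda>k. measure_pmf.prob (random_kgraph k (2 * k + 1) (p k))
            {H. strong_EKR {1..2 * k + 1} H}) \<longlonglongrightarrow> 1"
proof -
  define \<eta> :: real where "\<eta> = 1 / 10^8"
  have eta: "0 < \<eta>" "\<eta> \<le> 1 / 10^8" by (simp_all add: \<eta>_def)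
  \<comment> \<open>The first bound on 1 - p keeps D close to k + 1; the power makes (1 - p)^(\<eta>
    k) at most 16^(-k).\<close>
  define \<epsilon> where "\<epsilon> = min \<eta> ((1 / 16) powr (1 / \<eta>))"
  have eps: "\<epsilon> > 0" using eta by (simp add: \<epsilon>_def)
  show ?thesis
  proof (intro exI[of _ \<epsilon>] conjI eps allI impI)
    fix p :: "nat \<Rightarrow> real" assume p: "\<forall>k. 1 - \<epsilon> < p k \<and> 0 \<le> p k \<and> p k \<le> 1"
    let ?f = "\<lambda>k. measure_pmf.prob (random_kgraph k (2 * k + 1) (p k)) {H. strong_EKR {1..2 * k + 1} H}"
    have ev: "\<forall>\<^sub>F k in sequentially. c \<le> a * real k" if "a > 0" for a c :: real
    proof -
      obtain N :: nat where N: "c / a \<le> real N" using real_arch_simple by blast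
      have "c \<le> a * real k" if "k \<ge> N" for k
      proof -
        have "c / a \<le> real k" using N that by (meson of_nat_mono order_trans)
        then show ?thesis using \<open>a > 0\<close> by (simp add: divide_le_eq mult.commute)
      qed
      then show ?thesis unfolding eventually_sequentially by blast
    qed
    have low: "\<forall>\<^sub>F k in sequentially. 1 - 8 * (1 / 2) ^ k \<le> ?f k"
      using ev[OF eta(1), of 1] ev[of "\<eta>\<^sup>2 / 2 ^ 17" "ln 8"]
    proof (rule eventually_elim2)
      show "0 < \<eta>\<^sup>2 / 2 ^ 17" using eta by simp
      fix k assume k: "1 \<le> \<eta> * real k" "ln 8 \<le> \<eta>\<^sup>2 / 2 ^ 17 * real k"
      have pk: "0 \<le> p k" "p k \<le> 1" "1 - p k \<le> \<eta>" "1 - p k \<le> (1 / 16) powr (1 / \<eta>)"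
        using p[rule_format, of k] by (auto simp: \<epsilon>_def)
      have "?f k = measure_pmf.prob (Pi_pmf (nsets {1..2 * k + 1} k) False (\<lambda>_. bernoulli_pmf (p k)))
          {\<omega>. strong_EKR {1..2 * k + 1} (kgraph_of {1..2 * k + 1} k \<omega>)}"
        by (simp add: random_kgraph_def kgraph_of_def vimage_def)
      then show "1 - 8 * (1 / 2) ^ k \<le> ?f k"
        using prob_strong_EKR[OF _ _ eta k pk, of "{1..2 * k + 1}"] by simp
    qed
    have "(\<lambda>k. 1 - 8 * (1 / 2 :: real) ^ k) \<longlonglongrightarrow> 1 - 8 * 0"
      by (intro tendsto_intros LIMSEQ_power_zero) simp
    then have lim: "(\<lambda>k. 1 - 8 * (1 / 2 :: real) ^ k) \<longlonglongrightarrow> 1" by simp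
    show "?f \<longlonglongrightarrow> 1"
      by (rule tendsto_sandwich[OF low _ lim tendsto_const]) (simp add: measure_pmf.prob_le_1)
  qed
qed

end
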